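(* Let $S,\lambda,\rho,\beta_1,\beta_2,R$ be as in the context (the data of a Strauss process on $S$), and let $$r=\sup_{v\in S}\lambda(B(v,R)),\qquad B(v,R)=\{w\in S:\rho(v,w)\le R\}.$$ Let $N\ge 1$ be an integer, and let $(L_N,U_N)$ be the bounding process defined in the context: the dominating process is generated backwards in time from time $0$ for $N$ events, and the lower and upper processes are then run forward from the time $\tau_N$ of the $N$th backward event to time $0$. (1) For the chain without the swap move ($p_{\mathrm{swap}}=0$), if $\beta_1(1-\beta_2)r<1$, then $$\mathbf{P}\bigl(U_N(0)\neq L_N(0)\bigr)\le 2\exp(-0.09N)+\beta_1\lambda(S)\exp\Bigl(-\frac{N\,(1-\beta_1(1-\beta_2)r)}{4\beta_1\lambda(S)}\Bigr).$$ (2) For the chain in which a swap is executed with probability $1/4$ ($p_{\mathrm{swap}}=1/4$), if $\beta_1(1-\beta_2)r<2$, then $$\mathbf{P}\bigl(U_N(0)\neq L_N(0)\bigr)\le 2\exp(-0.09N)+\beta_1\lambda(S)\exp\Bigl(-\frac{N\,(1-0.5\,\beta_1(1-\beta_2)r)}{4\beta_1\lambda(S)}\Bigr).$$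
   Context: Setting. $S$ is a separable measurable space with a (jointly measurable) metric $\rho$ (e.g. a bounded Borel subset of $\mathbf{R}^2$ with Euclidean distance), and $\lambda$ is a diffuse measure on $S$ (that is, $\lambda(\{v\})=0$ for all $v\in S$) with $0<\lambda(S)<\infty$. The parameters are $\beta_1>0$, $\beta_2\in[0,1]$, $R>0$. A configuration is a finite subset of $S$. The Strauss process is the point process on $S$ whose density with respect to the Poisson point process of intensity measure $\lambda$ is proportional to $\beta_1^{\#x}\beta_2^{s(x)}$, where $s(x)$ is the number of unordered pairs of distinct points of $x$ at $\rho$-distance at most $R$. Two distinct points $v,w\in S$ are neighbors if $\rho(v,w)\le R$. Dominating process. $D(t)$, $t\in(-\infty,0]$, is the stationary spatial birth-death process on $S$ in which births occur at total rate $\beta_1\lambda(S)$, each new point being chosen independently according to $\lambda(\cdot)/\lambda(S)$, and each point present dies independently at rate $1$. Its stationary distribution is the Poisson point process with intensity measure $\beta_1\lambda$, and it is time-reversible. Paths are right-continuous, and $A(t-)$ denotes the state of a process $A$ immediately before time $t$. An event is a birth or a death in $D$. For an integer $N\ge1$, $\tau_N<0$ is the time of the $N$th event encountered when moving backwards in time from $0$. Marks. Independently of $D$, each point $v$ born in $D$ carries i.i.d. $\mathrm{Bernoulli}(\beta_2)$ variables, one for each neighbor $w$ of $v$ in $D(t-)$, where $t$ is the birth time of $v$. A neighbor $w$ blocks $v$ if the corresponding variable equals $0$. Each birth also carries an independent coin that equals "swap" with probability $p_{\mathrm{swap}}$ and "no swap" with probability $1-p_{\mathrm{swap}}$. All marks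 are independent across births. Target chain (for motivation of the rules below). When $v$ is born in $D$ at time $t$, the target chain $X$, with $X\subseteq D$, behaves as follows. If no point of $X(t-)$ blocks $v$, then $v$ is added to $X$. If exactly one point $w\in X(t-)$ blocks $v$ and the coin is "swap", then $w$ is removed and $v$ is added. Otherwise $X$ is unchanged. When a point dies in $D$ it is removed from $X$ if present. Bounding process. The lower process $L_N$ and upper process $U_N$ are started at time $\tau_N$ with $L_N(\tau_N)=\varnothing$ and $U_N(\tau_N)=D(\tau_N)$, and evolve on $[\tau_N,0]$, changing only at events of $D$, using the events and marks above, as follows. - If a point dies in $D$ at time $t$, it is removed from $L_N$ and from $U_N$ (wherever present). - If $v$ is born in $D$ at time $t$, let $A_L$ (resp. $A_U$) be the set of points of $L_N(t-)$ (resp. $U_N(t-)$) that block $v$. - If the coin is "no swap": $v$ is added to $L_N$ if and only if $A_U=\varnothing$, and $v$ is added to $U_N$ if and only if $A_L=\varnothing$; nothing else changes. - If the coin is "swap": Case 1: $\#A_U\le1$. The point of $A_U$ (if any) is removed from $U_N$ and from $L_N$ (if it is there), and $v$ is added to both $L_N$ and $U_N$. Case 2: $\#A_L\ge2$. Both $L_N$ and $U_N$ are unchanged. Case 3: $\#A_L\le1$ and $\#A_U\ge2$. The point $v$ is added to $U_N$ but not to $L_N$, and the point of $A_L$ (if any) is removed from $L_N$; $U_N$ loses no point. The chain without the swap move is the case $p_{\mathrm{swap}}=0$. *)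

theory Defs
  imports "HOL-Probability.Probability"
begin

text \<open>
  The space S is the carrier \<open>space lam\<close> of the measure \<open>lam\<close>, with its sigma-algebra \<open>sets lam\<close>.
  A separable measurable space is one whose sigma-algebra is countably generated; that it also
  contains the singletons follows from the joint measurability of the metric.
\<close>

locale strauss_data =
  fixes lam :: "'a measure" and rho :: "'a \<Rightarrow> 'a \<Rightarrow> real" and beta1 beta2 R :: real
  assumes separable: "\<exists>G. countable G \<and> G \<subseteq> Pow (space lam) \<and> sets lam = sigma_sets (space lam) G"
    and metric: "Metric_space (space lam) rho"
    and rho_measurable: "(\<lambda>(v, w). rho v w) \<in> borel_measurable (lam \<Otimes>\<^sub>M lam)"
    and diffuse: "\<And>v. v \<in> space lam \<Longrightarrow> emeasure lam {v} = 0"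
    and lam_pos: "0 < emeasure lam (space lam)"
    and lam_finite: "emeasure lam (space lam) < \<infinity>"
    and beta1_pos: "0 < beta1"
    and beta2_range: "beta2 \<in> {0..1}"
    and R_pos: "0 < R"

text \<open>
  The dominating process is realised from its births. The births on \<open>(-\<infinity>, 0)\<close> are numbered
  backwards from time 0, so that birth 0 is the most recent one; \<open>gap n\<close> is the distance from
  birth \<open>n\<close> to the next later birth (to time 0 if \<open>n = 0\<close>), \<open>loc n\<close> the point born, and \<open>life n\<close>
  its lifetime. The Bernoulli variable carried by birth \<open>n\<close> for a neighbor that was itself
  birth \<open>m\<close> is \<open>mark n m\<close> (\<open>False\<close> is the value 0, that is, the neighbor blocks); it is consulted
  only for neighbors alive just before birth \<open>n\<close>. The value \<open>True\<close> of \<open>coin n\<close> is "swap".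
  The last argument \<open>\<omega>\<close> of each of these is the outcome.
\<close>

locale birth_record =
  fixes rho :: "'a \<Rightarrow> 'a \<Rightarrow> real" and R :: real
    and gap :: "nat \<Rightarrow> 'w \<Rightarrow> real"
    and loc :: "nat \<Rightarrow> 'w \<Rightarrow> 'a"
    and life :: "nat \<Rightarrow> 'w \<Rightarrow> real"
    and mark :: "nat \<Rightarrow> nat \<Rightarrow> 'w \<Rightarrow> bool"
    and coin :: "nat \<Rightarrow> 'w \<Rightarrow> bool"
begin

definition birth :: "nat \<Rightarrow> 'w \<Rightarrow> real" where
  "birth n \<omega> = - (\<Sum>i\<le>n. gap i \<omega>)"

definition death :: "nat \<Rightarrow> 'w \<Rightarrow> real" where
  "death n \<omega> = birth n \<omega> + life n \<omega>"

definition D :: "real \<Rightarrow> 'w \<Rightarrow> 'a set" where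
  "D t \<omega> = {loc n \<omega> | n. birth n \<omega> \<le> t \<and> t < death n \<omega>}"

definition event_times :: "'w \<Rightarrow> real set" where
  "event_times \<omega> = {t. t < 0 \<and> (\<exists>n. t = birth n \<omega> \<or> t = death n \<omega>)}"

text \<open>Almost surely the event times are distinct and locally finite, so the suprema are maxima.\<close>

primrec tau :: "nat \<Rightarrow> 'w \<Rightarrow> real" where
  "tau 0 \<omega> = 0"
| "tau (Suc k) \<omega> = Sup {t \<in> event_times \<omega>. t < tau k \<omega>}"

text \<open>
  The points that block birth \<open>n\<close>. As paths are right-continuous, birth \<open>m\<close> is present in
  \<open>D(t-)\<close> iff \<open>birth m < t \<le> death m\<close>.
\<close>

definition blockers :: "nat \<Rightarrow> 'w \<Rightarrow> 'a set" where
  "blockers n \<omega> = {loc m \<omega> | m. birth m \<omega> < birth n \<omega> \<and> birth n \<omega> \<le> death m \<omega>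
      \<and> loc m \<omega> \<noteq> loc n \<omega> \<and> rho (loc n \<omega>) (loc m \<omega>) \<le> R \<and> \<not> mark n m \<omega>}"

definition birth_update :: "bool \<Rightarrow> 'a \<Rightarrow> 'a set \<Rightarrow> 'a set \<times> 'a set \<Rightarrow> 'a set \<times> 'a set" where
  "birth_update swap v K LU =
    (let L = fst LU; U = snd LU; AL = L \<inter> K; AU = U \<inter> K in
     if \<not> swap then (if AU = {} then insert v L else L, if AL = {} then insert v U else U)
     else if card AU \<le> 1 then (insert v (L - AU), insert v (U - AU))
     else if card AL \<ge> 2 then (L, U)
     else (L - AL, insert v U))"

definition death_update :: "'a set \<Rightarrow> 'a set \<times> 'a set \<Rightarrow> 'a set \<times> 'a set" where
  "death_update W LU = (fst LU - W, snd LU - W)"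

text \<open>Almost surely a single birth or a single death takes place at an event time \<open>t\<close>.\<close>

definition event_update :: "real \<Rightarrow> 'w \<Rightarrow> 'a set \<times> 'a set \<Rightarrow> 'a set \<times> 'a set" where
  "event_update t \<omega> LU =
    (if \<exists>n. birth n \<omega> = t
     then let n = (LEAST n. birth n \<omega> = t) in birth_update (coin n \<omega>) (loc n \<omega>) (blockers n \<omega>) LU
     else death_update {loc n \<omega> | n. death n \<omega> = t} LU)"

text \<open>
  \<open>bounding N k\<close> is the pair of lower and upper state right after time \<open>tau (N - k)\<close>. The
  event at \<open>tau N\<close> itself is already accounted for in \<open>D (tau N)\<close>.
\<close>

primrec bounding :: "nat \<Rightarrow> nat \<Rightarrow> 'w \<Rightarrow> 'a set \<times> 'a set" where
  "bounding N 0 \<omega> = ({}, D (tau N \<omega>) \<omega>)"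
| "bounding N (Suc k) \<omega> = event_update (tau (N - Suc k) \<omega>) \<omega> (bounding N k \<omega>)"

definition events_until :: "nat \<Rightarrow> real \<Rightarrow> 'w \<Rightarrow> nat" where
  "events_until N t \<omega> = card {j \<in> {1..<N}. tau j \<omega> \<le> t}"

text \<open>The processes \<open>L_N\<close> and \<open>U_N\<close>, meaningful for \<open>tau N \<le> t \<le> 0\<close>.\<close>

definition lower :: "nat \<Rightarrow> real \<Rightarrow> 'w \<Rightarrow> 'a set" where
  "lower N t \<omega> = fst (bounding N (events_until N t \<omega>) \<omega>)"

definition upper :: "nat \<Rightarrow> real \<Rightarrow> 'w \<Rightarrow> 'a set" where
  "upper N t \<omega> = snd (bounding N (events_until N t \<omega>) \<omega>)"

end

text \<open>
  The law of one birth: births form a Poisson process of rate \<open>beta1 * lam(S)\<close> (so gaps are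
  exponential), the location has law \<open>lam / lam(S)\<close>, and dying at rate 1 means having an
  exponential lifetime with parameter 1. The process \<open>D\<close> built from an infinite past of
  such births is the stationary one.
\<close>

definition birth_law ::
    "'a measure \<Rightarrow> real \<Rightarrow> real \<Rightarrow> real \<Rightarrow> (real \<times> 'a \<times> real \<times> (nat \<Rightarrow> bool) \<times> bool) measure" where
  "birth_law lam beta1 beta2 pswap =
     density lborel (exponential_density (beta1 * measure lam (space lam)))
     \<Otimes>\<^sub>M uniform_measure lam (space lam)
     \<Otimes>\<^sub>M density lborel (exponential_density 1)
     \<Otimes>\<^sub>M (\<Pi>\<^sub>M m\<in>UNIV. measure_pmf (bernoulli_pmf beta2))
     \<Otimes>\<^sub>M measure_pmf (bernoulli_pmf pswap)"

locale bounding_process =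
  strauss_data lam rho beta1 beta2 R + birth_record rho R gap loc life mark coin + prob_space M
  for lam :: "'a measure" and rho and beta1 beta2 R :: real
    and pswap :: real and M :: "'w measure"
    and gap :: "nat \<Rightarrow> 'w \<Rightarrow> real" and loc :: "nat \<Rightarrow> 'w \<Rightarrow> 'a" and life :: "nat \<Rightarrow> 'w \<Rightarrow> real"
    and mark :: "nat \<Rightarrow> nat \<Rightarrow> 'w \<Rightarrow> bool" and coin :: "nat \<Rightarrow> 'w \<Rightarrow> bool" +
  assumes pswap_range: "pswap \<in> {0..1}"
    and births_indep: "indep_vars (\<lambda>_. birth_law lam beta1 beta2 pswap)
      (\<lambda>n \<omega>. (gap n \<omega>, loc n \<omega>, life n \<omega>, (\<lambda>m. mark n m \<omega>), coin n \<omega>)) UNIV"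
    and births_law: "\<And>n. distr M (birth_law lam beta1 beta2 pswap)
      (\<lambda>\<omega>. (gap n \<omega>, loc n \<omega>, life n \<omega>, (\<lambda>m. mark n m \<omega>), coin n \<omega>))
      = birth_law lam beta1 beta2 pswap"

text \<open>
  The event that the two processes differ at time \<open>t\<close> is measurable, so that its probability is
  not an artefact of \<open>measure\<close> being 0 off the sigma-algebra. A random set is traced if it
  consists of born points and membership of each birth in it is a measurable event.
\<close>

context bounding_process
begin

definition traced :: "('w \<Rightarrow> 'a set) \<Rightarrow> bool" where
  "traced A \<longleftrightarrow> (\<forall>m. Measurable.pred M (\<lambda>\<omega>. loc m \<omega> \<in> A \<omega>)) \<and> (\<forall>\<omega>. A \<omega> \<subseteq> range (\<lambda>m. loc m \<omega>))"

lemma tuple_measurable: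
  "(\<lambda>\<omega>. (gap n \<omega>, loc n \<omega>, life n \<omega>, (\<lambda>m. mark n m \<omega>), coin n \<omega>)) \<in> measurable M
     (borel \<Otimes>\<^sub>M lam \<Otimes>\<^sub>M borel \<Otimes>\<^sub>M (\<Pi>\<^sub>M m\<in>UNIV. count_space UNIV) \<Otimes>\<^sub>M count_space UNIV)"
proof -
  have "sets (birth_law lam beta1 beta2 pswap) =
      sets (borel \<Otimes>\<^sub>M lam \<Otimes>\<^sub>M borel \<Otimes>\<^sub>M (\<Pi>\<^sub>M m\<in>UNIV. count_space UNIV) \<Otimes>\<^sub>M count_space UNIV)"
    unfolding birth_law_def
    by (intro sets_pair_measure_cong sets_PiM_cong) auto
  moreover have "(\<lambda>\<omega>. (gap n \<omega>, loc n \<omega>, life n \<omega>, (\<lambda>m. mark n m \<omega>), coin n \<omega>))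
      \<in> measurable M (birth_law lam beta1 beta2 pswap)"
    using births_indep unfolding indep_vars_def by auto
  ultimately show ?thesis
    using measurable_cong_sets[OF refl] by blast
qed

lemma gap_measurable [measurable]: "gap n \<in> borel_measurable M"
  using measurable_compose[OF tuple_measurable measurable_fst] by simp

lemma loc_measurable [measurable]: "loc n \<in> measurable M lam"
  using measurable_compose[OF measurable_compose[OF tuple_measurable measurable_snd] measurable_fst]
  by simp

lemma life_measurable [measurable]: "life n \<in> borel_measurable M"
  using measurable_compose[OF measurable_compose[OF measurable_compose[OF tuple_measurable
    measurable_snd] measurable_snd] measurable_fst] by simp

lemma mark_measurable [measurable]: "Measurable.pred M (mark n m)"
proof -
  have "(\<lambda>\<omega>. (\<lambda>m. mark n m \<omega>)) \<in> measurable M (\<Pi>\<^sub>M m\<in>(UNIV::nat set). count_space (UNIV::bool set))"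
    using measurable_compose[OF measurable_compose[OF measurable_compose[OF measurable_compose[OF
      tuple_measurable measurable_snd] measurable_snd] measurable_snd] measurable_fst] by simp
  from measurable_compose[OF this measurable_component_singleton[of m]]
  show ?thesis by simp
qed

lemma coin_measurable [measurable]: "Measurable.pred M (coin n)"
  using measurable_compose[OF measurable_compose[OF measurable_compose[OF measurable_compose[OF
      tuple_measurable measurable_snd] measurable_snd] measurable_snd] measurable_snd] by simp

lemma birth_measurable [measurable]: "birth n \<in> borel_measurable M"
  unfolding birth_def[abs_def] by measurable

lemma death_measurable [measurable]: "death n \<in> borel_measurable M"
  unfolding death_def[abs_def] by measurable

lemma rho_loc_measurable [measurable]: "(\<lambda>\<omega>. rho (loc m \<omega>) (loc n \<omega>)) \<in> borel_measurable M"
proof -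
  have "(\<lambda>\<omega>. (loc m \<omega>, loc n \<omega>)) \<in> measurable M (lam \<Otimes>\<^sub>M lam)" by measurable
  from measurable_compose[OF this rho_measurable] show ?thesis by simp
qed

lemma loc_eq_measurable [measurable]: "Measurable.pred M (\<lambda>\<omega>. loc m \<omega> = loc n \<omega>)"
proof -
  have "loc m \<omega> = loc n \<omega> \<longleftrightarrow> rho (loc m \<omega>) (loc n \<omega>) = 0" if "\<omega> \<in> space M" for \<omega>
    using Metric_space.zero[OF metric measurable_space[OF loc_measurable that]
      measurable_space[OF loc_measurable that]] by simp
  moreover have "Measurable.pred M (\<lambda>\<omega>. rho (loc m \<omega>) (loc n \<omega>) = 0)" by measurable
  ultimately show ?thesis by (simp cong: measurable_cong)
qed

lemma tracedD: "traced A \<Longrightarrow> Measurable.pred M (\<lambda>\<omega>. loc m \<omega> \<in> A \<omega>)"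
  by (simp add: traced_def)

lemma traced_sub: "traced A \<Longrightarrow> x \<in> A \<omega> \<Longrightarrow> \<exists>m. x = loc m \<omega>"
  unfolding traced_def by blast

lemma traced_empty: "traced (\<lambda>\<omega>. {})"
  by (simp add: traced_def)

lemma traced_Collect:
  assumes "\<And>m. Measurable.pred M (P m)"
  shows "traced (\<lambda>\<omega>. {loc m \<omega> | m. P m \<omega>})"
proof -
  note assms[measurable]
  have "Measurable.pred M (\<lambda>\<omega>. \<exists>k. loc m \<omega> = loc k \<omega> \<and> P k \<omega>)" for m by measurable
  then show ?thesis by (auto simp: traced_def)
qed

lemma traced_Int:
  assumes "traced A" "traced B"
  shows "traced (\<lambda>\<omega>. A \<omega> \<inter> B \<omega>)"
proof -
  note assms[THEN tracedD, measurable]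
  have "Measurable.pred M (\<lambda>\<omega>. loc m \<omega> \<in> A \<omega> \<and> loc m \<omega> \<in> B \<omega>)" for m by measurable
  with assms show ?thesis by (auto simp: traced_def)
qed

lemma traced_Diff:
  assumes "traced A" "traced B"
  shows "traced (\<lambda>\<omega>. A \<omega> - B \<omega>)"
proof -
  note assms[THEN tracedD, measurable]
  have "Measurable.pred M (\<lambda>\<omega>. loc m \<omega> \<in> A \<omega> \<and> loc m \<omega> \<notin> B \<omega>)" for m by measurable
  with assms show ?thesis by (auto simp: traced_def)
qed

lemma traced_insert:
  assumes "traced A"
  shows "traced (\<lambda>\<omega>. insert (loc n \<omega>) (A \<omega>))"
proof -
  note assms[THEN tracedD, measurable]
  have "Measurable.pred M (\<lambda>\<omega>. loc m \<omega> = loc n \<omega> \<or> loc m \<omega> \<in> A \<omega>)" for m by measurable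
  with assms show ?thesis by (auto simp: traced_def)
qed

lemma traced_If:
  assumes [measurable]: "Measurable.pred M P" and A: "traced A" "traced B"
  shows "traced (\<lambda>\<omega>. if P \<omega> then A \<omega> else B \<omega>)"
proof -
  note A[THEN tracedD, measurable]
  have "Measurable.pred M (\<lambda>\<omega>. (P \<omega> \<and> loc m \<omega> \<in> A \<omega>) \<or> (\<not> P \<omega> \<and> loc m \<omega> \<in> B \<omega>))" for m
    by measurable
  moreover have "(loc m \<omega> \<in> (if P \<omega> then A \<omega> else B \<omega>)) \<longleftrightarrow>
      ((P \<omega> \<and> loc m \<omega> \<in> A \<omega>) \<or> (\<not> P \<omega> \<and> loc m \<omega> \<in> B \<omega>))" for m \<omega> by auto
  ultimately show ?thesis using A by (auto simp: traced_def)
qed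

lemma eq_measurable:
  assumes "traced A" "traced B"
  shows "Measurable.pred M (\<lambda>\<omega>. A \<omega> = B \<omega>)"
proof -
  note assms[THEN tracedD, measurable]
  have "A \<omega> = B \<omega> \<longleftrightarrow> (\<forall>m. loc m \<omega> \<in> A \<omega> \<longleftrightarrow> loc m \<omega> \<in> B \<omega>)" for \<omega>
    using assms by (blast dest: traced_sub)
  then show ?thesis by simp
qed

lemma finite_measurable:
  assumes "traced A"
  shows "Measurable.pred M (\<lambda>\<omega>. finite (A \<omega>))"
proof -
  note tracedD[OF assms, measurable]
  have "finite (A \<omega>) \<longleftrightarrow> (\<exists>k. \<forall>m. loc m \<omega> \<in> A \<omega> \<longrightarrow> (\<exists>j\<in>{..k}. loc m \<omega> = loc j \<omega>))"
    (is "_ = ?R") for \<omega>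
  proof
    assume "finite (A \<omega>)"
    moreover have "A \<omega> \<subseteq> (\<lambda>m. loc m \<omega>) ` UNIV" using assms by (simp add: traced_def)
    ultimately obtain C where C: "finite C" "A \<omega> = (\<lambda>m. loc m \<omega>) ` C"
      by (meson finite_subset_image)
    then obtain k where "C \<subseteq> {..k}" using finite_nat_iff_bounded_le by auto
    with C have "\<forall>m. loc m \<omega> \<in> A \<omega> \<longrightarrow> (\<exists>j\<in>{..k}. loc m \<omega> = loc j \<omega>)" by auto
    then show ?R by blast
  next
    assume ?R
    then obtain k where "\<And>m. loc m \<omega> \<in> A \<omega> \<Longrightarrow> \<exists>j\<in>{..k}. loc m \<omega> = loc j \<omega>" by blast
    then have "A \<omega> \<subseteq> (\<lambda>m. loc m \<omega>) ` {..k}" using assms by (blast dest: traced_sub)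
    then show "finite (A \<omega>)" by (rule finite_subset) simp
  qed
  then show ?thesis by simp
qed

lemma card_le_1_measurable:
  assumes "traced A"
  shows "Measurable.pred M (\<lambda>\<omega>. card (A \<omega>) \<le> 1)"
proof -
  note tracedD[OF assms, measurable] finite_measurable[OF assms, measurable]
  have "card (A \<omega>) \<le> 1 \<longleftrightarrow> \<not> finite (A \<omega>) \<or>
      (\<forall>m k. loc m \<omega> \<in> A \<omega> \<longrightarrow> loc k \<omega> \<in> A \<omega> \<longrightarrow> loc m \<omega> = loc k \<omega>)" for \<omega>
  proof (cases "finite (A \<omega>)")
    case True
    then have "card (A \<omega>) \<le> 1 \<longleftrightarrow> (\<forall>x\<in>A \<omega>. \<forall>y\<in>A \<omega>. x = y)"
      using card_le_Suc0_iff_eq[of "A \<omega>"] by simp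
    with True assms show ?thesis by (metis traced_sub)
  qed simp
  then show ?thesis by simp
qed

lemma tau_measurable [measurable]: "tau k \<in> borel_measurable M"
proof (induction k)
  case 0
  then show ?case by simp
next
  case (Suc k)
  note Suc[measurable]
  define X where "X \<omega> = {t \<in> event_times \<omega>. t < tau k \<omega>}" for \<omega>
  have bdd: "bdd_above (X \<omega>)" for \<omega>
    by (rule bdd_aboveI[of _ 0]) (auto simp: X_def event_times_def)
  have ne: "X \<omega> \<noteq> {} \<longleftrightarrow> (\<exists>n. (birth n \<omega> < 0 \<and> birth n \<omega> < tau k \<omega>) \<or>
      (death n \<omega> < 0 \<and> death n \<omega> < tau k \<omega>))" for \<omega>
    by (auto simp: X_def event_times_def)
  have gr: "(\<exists>x\<in>X \<omega>. a < x) \<longleftrightarrow> (\<exists>n. (birth n \<omega> < 0 \<and> birth n \<omega> < tau k \<omega> \<and> a < birth n \<omega>) \<or>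
      (death n \<omega> < 0 \<and> death n \<omega> < tau k \<omega> \<and> a < death n \<omega>))" for \<omega> a
    by (auto simp: X_def event_times_def)
  have "Measurable.pred M (\<lambda>\<omega>. a < Sup (X \<omega>))" for a
  proof -
    have [measurable]: "Measurable.pred M (\<lambda>\<omega>. X \<omega> \<noteq> {})" unfolding ne by measurable
    have [measurable]: "Measurable.pred M (\<lambda>\<omega>. \<exists>x\<in>X \<omega>. a < x)" unfolding gr by measurable
    have "a < Sup (X \<omega>) \<longleftrightarrow> (X \<omega> \<noteq> {} \<and> (\<exists>x\<in>X \<omega>. a < x)) \<or> (\<not> X \<omega> \<noteq> {} \<and> a < Sup {})" for \<omega>
      using less_cSup_iff[OF _ bdd, of \<omega>] by (cases "X \<omega> = {}") auto
    moreover have "Measurable.pred M (\<lambda>\<omega>. (X \<omega> \<noteq> {} \<and> (\<exists>x\<in>X \<omega>. a < x)) \<or>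
        (\<not> X \<omega> \<noteq> {} \<and> a < Sup {}))"
      by (intro pred_intros_logic \<open>Measurable.pred M (\<lambda>\<omega>. X \<omega> \<noteq> {})\<close>
        \<open>Measurable.pred M (\<lambda>\<omega>. \<exists>x\<in>X \<omega>. a < x)\<close>) simp
    ultimately show ?thesis by presburger
  qed
  then have "(\<lambda>\<omega>. Sup (X \<omega>)) \<in> borel_measurable M"
    by (simp add: borel_measurable_iff_greater pred_def)
  then show ?case by (simp add: X_def)
qed

lemma traced_birth_update:
  assumes LU: "traced (\<lambda>\<omega>. fst (S \<omega>))" "traced (\<lambda>\<omega>. snd (S \<omega>))" and K: "traced K"
  shows "traced (\<lambda>\<omega>. fst (birth_update (coin n \<omega>) (loc n \<omega>) (K \<omega>) (S \<omega>)))"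
    and "traced (\<lambda>\<omega>. snd (birth_update (coin n \<omega>) (loc n \<omega>) (K \<omega>) (S \<omega>)))"
proof -
  define L where "L \<omega> = fst (S \<omega>)" for \<omega>
  define U where "U \<omega> = snd (S \<omega>)" for \<omega>
  have L: "traced L" and U: "traced U" using LU by (simp_all add: L_def[abs_def] U_def[abs_def])
  note AL = traced_Int[OF L K] and AU = traced_Int[OF U K]
  have m [measurable]: "Measurable.pred M (\<lambda>\<omega>. L \<omega> \<inter> K \<omega> = {})"
    "Measurable.pred M (\<lambda>\<omega>. U \<omega> \<inter> K \<omega> = {})"
    "Measurable.pred M (\<lambda>\<omega>. card (U \<omega> \<inter> K \<omega>) \<le> 1)"
    "Measurable.pred M (\<lambda>\<omega>. card (L \<omega> \<inter> K \<omega>) \<le> 1)"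
    using eq_measurable[OF AL traced_empty] eq_measurable[OF AU traced_empty]
      card_le_1_measurable[OF AU] card_le_1_measurable[OF AL] by simp_all
  have c: "(card (L \<omega> \<inter> K \<omega>) \<ge> 2) \<longleftrightarrow> \<not> card (L \<omega> \<inter> K \<omega>) \<le> 1" for \<omega> by auto
  have f: "fst (birth_update (coin n \<omega>) (loc n \<omega>) (K \<omega>) (S \<omega>)) =
    (if \<not> coin n \<omega> then if U \<omega> \<inter> K \<omega> = {} then insert (loc n \<omega>) (L \<omega>) else L \<omega>
     else if card (U \<omega> \<inter> K \<omega>) \<le> 1 then insert (loc n \<omega>) (L \<omega> - (U \<omega> \<inter> K \<omega>))
     else if \<not> card (L \<omega> \<inter> K \<omega>) \<le> 1 then L \<omega> else L \<omega> - (L \<omega> \<inter> K \<omega>))" for \<omega>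
    unfolding birth_update_def Let_def c[symmetric] L_def[symmetric] U_def[symmetric] by simp
  have s: "snd (birth_update (coin n \<omega>) (loc n \<omega>) (K \<omega>) (S \<omega>)) =
    (if \<not> coin n \<omega> then if L \<omega> \<inter> K \<omega> = {} then insert (loc n \<omega>) (U \<omega>) else U \<omega>
     else if card (U \<omega> \<inter> K \<omega>) \<le> 1 then insert (loc n \<omega>) (U \<omega> - (U \<omega> \<inter> K \<omega>))
     else if \<not> card (L \<omega> \<inter> K \<omega>) \<le> 1 then U \<omega> else insert (loc n \<omega>) (U \<omega>))" for \<omega>
    unfolding birth_update_def Let_def c[symmetric] L_def[symmetric] U_def[symmetric] by simp
  show "traced (\<lambda>\<omega>. fst (birth_update (coin n \<omega>) (loc n \<omega>) (K \<omega>) (S \<omega>)))"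
    unfolding f by (intro traced_If traced_insert traced_Diff L AL AU) measurable
  show "traced (\<lambda>\<omega>. snd (birth_update (coin n \<omega>) (loc n \<omega>) (K \<omega>) (S \<omega>)))"
    unfolding s by (intro traced_If traced_insert traced_Diff U AL AU) measurable
qed

lemma traced_blockers: "traced (blockers n)"
  unfolding blockers_def[abs_def] by (intro traced_Collect) measurable

lemma traced_select:
  assumes "\<And>n. traced (A n)" and [measurable]: "N \<in> measurable M (count_space UNIV)"
  shows "traced (\<lambda>\<omega>. A (N \<omega> :: nat) \<omega>)"
proof -
  note assms(1)[THEN tracedD, measurable]
  have "Measurable.pred M (\<lambda>\<omega>. \<exists>n. N \<omega> = n \<and> loc m \<omega> \<in> A n \<omega>)" for m by measurable
  then show ?thesis using assms(1) by (auto simp: traced_def)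
qed

lemma traced_event_update:
  assumes [measurable]: "t \<in> borel_measurable M"
    and S: "traced (\<lambda>\<omega>. fst (S \<omega>))" "traced (\<lambda>\<omega>. snd (S \<omega>))"
  shows "traced (\<lambda>\<omega>. fst (event_update (t \<omega>) \<omega> (S \<omega>)))"
    and "traced (\<lambda>\<omega>. snd (event_update (t \<omega>) \<omega> (S \<omega>)))"
proof -
  have P [measurable]: "Measurable.pred M (\<lambda>\<omega>. \<exists>n. birth n \<omega> = t \<omega>)" by measurable
  have N: "(\<lambda>\<omega>. LEAST n. birth n \<omega> = t \<omega>) \<in> measurable M (count_space UNIV)" by measurable
  have W: "traced (\<lambda>\<omega>. {loc n \<omega> | n. death n \<omega> = t \<omega>})" by (intro traced_Collect) measurable
  have f: "fst (event_update (t \<omega>) \<omega> (S \<omega>)) = (if \<exists>n. birth n \<omega> = t \<omega>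
      then (\<lambda>n. fst (birth_update (coin n \<omega>) (loc n \<omega>) (blockers n \<omega>) (S \<omega>)))
        (LEAST n. birth n \<omega> = t \<omega>)
      else fst (S \<omega>) - {loc n \<omega> | n. death n \<omega> = t \<omega>})" for \<omega>
    by (simp add: event_update_def death_update_def Let_def)
  have s: "snd (event_update (t \<omega>) \<omega> (S \<omega>)) = (if \<exists>n. birth n \<omega> = t \<omega>
      then (\<lambda>n. snd (birth_update (coin n \<omega>) (loc n \<omega>) (blockers n \<omega>) (S \<omega>)))
        (LEAST n. birth n \<omega> = t \<omega>)
      else snd (S \<omega>) - {loc n \<omega> | n. death n \<omega> = t \<omega>})" for \<omega>
    by (simp add: event_update_def death_update_def Let_def)
  note B = traced_birth_update[OF S traced_blockers]
  show "traced (\<lambda>\<omega>. fst (event_update (t \<omega>) \<omega> (S \<omega>)))"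
    unfolding f by (rule traced_If[OF P traced_select[OF B(1) N] traced_Diff[OF S(1) W]])
  show "traced (\<lambda>\<omega>. snd (event_update (t \<omega>) \<omega> (S \<omega>)))"
    unfolding s by (rule traced_If[OF P traced_select[OF B(2) N] traced_Diff[OF S(2) W]])
qed

lemma traced_bounding:
  "traced (\<lambda>\<omega>. fst (bounding N k \<omega>)) \<and> traced (\<lambda>\<omega>. snd (bounding N k \<omega>))"
proof (induction k)
  case 0
  have "traced (\<lambda>\<omega>. D (tau N \<omega>) \<omega>)"
    unfolding D_def by (intro traced_Collect) measurable
  then show ?case by (simp add: traced_empty)
next
  case (Suc k)
  then show ?case using traced_event_update[OF tau_measurable] by simp
qed

lemma events_until_measurable: "(\<lambda>\<omega>. events_until N t \<omega>) \<in> measurable M (count_space UNIV)"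
proof -
  have "events_until N t \<omega> = (\<Sum>j\<in>{1..<N}. if tau j \<omega> \<le> t then 1 else 0)" for \<omega>
    unfolding events_until_def card_eq_sum
    by (intro sum.mono_neutral_cong_left) auto
  moreover have "(\<lambda>\<omega>. \<Sum>j\<in>{1..<N}. if tau j \<omega> \<le> t then 1 else (0::nat)) \<in> measurable M (count_space UNIV)"
    by measurable
  ultimately show ?thesis by presburger
qed

lemma disagreement_measurable: "{\<omega> \<in> space M. upper N t \<omega> \<noteq> lower N t \<omega>} \<in> events"
proof -
  have "traced (upper N t)"
    unfolding upper_def[abs_def]
    by (rule traced_select[where A = "\<lambda>k \<omega>. snd (bounding N k \<omega>)"])
       (simp_all only: traced_bounding events_until_measurable)
  moreover have "traced (lower N t)"
    unfolding lower_def[abs_def]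
    by (rule traced_select[where A = "\<lambda>k \<omega>. fst (bounding N k \<omega>)"])
       (simp_all only: traced_bounding events_until_measurable)
  ultimately have "Measurable.pred M (\<lambda>\<omega>. upper N t \<omega> \<noteq> lower N t \<omega>)"
    by (intro pred_intros_logic eq_measurable)
  then show ?thesis by (simp add: pred_def)
qed

end

end

theory Submission
  imports Defs "HOL-Real_Asymp.Real_Asymp"
begin

text \<open>
  Put \<open>B = beta1 * lam(S)\<close> and \<open>t = N / (4 B)\<close>. The numbers of births and of deaths in \<open>(-t, 0)\<close>
  both have exponential moment \<open>E 2^X \<le> exp (B t)\<close>, so by Markov's inequality each exceeds \<open>N / 2\<close>
  with probability at most \<open>exp (- 0.09 N)\<close>; otherwise \<open>tau N \<le> -t\<close>. As the update is monotone,
  the bounding process is then sandwiched by the one started at \<open>-t\<close> with every point undecided.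
  Between births each undecided point survives independently with exponential lifetime. A birth
  blocked by \<open>d\<close> undecided points raises the expected number of undecided points by at most \<open>d\<close>
  (by \<open>d / 2\<close> if a swap has probability 1/4: a lone undecided blocker may be swapped out), and \<open>d\<close> has
  mean \<open>c = (1 - beta2) r / lam(S)\<close> per undecided point. Hence the expected number of undecided points
  at time 0 is at most \<open>B exp (B c t - t)\<close>, with \<open>c / 2\<close> in place of \<open>c\<close> for the swap chain.

  The expectations over the backward sequence of births are bounded by supersolutions of renewal
  equations, obtained by integrating out the most recent birth.
\<close>

section \<open>Monotonicity of the update and the sandwich\<close>

text \<open>The obstacle is that \<open>tau N\<close> depends on births and deaths together:
  conditioning on it would destroy the independence of lifetimes, locations and marks. The
  deterministic time \<open>-t\<close> avoids this. With \<open>B t = N / 4\<close>, births and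
  deaths in the window are Poisson with mean \<open>N / 4\<close> each, so \<open>N\<close> events
  would be twice the expected total; the constant comes from
  \<open>2^(-N/2) exp (N/4) = exp (- (ln 2 / 2 - 1/4) N)\<close> and
  \<open>0.68 / 2 - 0.25 = 0.09\<close>. The number \<open>k\<close> of births in the window is
  still random, but it is a function of the gaps. The bounds on undecided points are therefore
  proved for fixed \<open>k\<close> under a weight \<open>w\<close> that depends on the gaps only,
  and the sum over \<open>k\<close> is taken last. Each undecided point alive at a birth is
  discounted by its probability of surviving until time 0. Deaths are then absorbed exactly, and
  every birth costs one factor \<open>1 + c\<close>. The points present at \<open>-t\<close>
  contribute \<open>B exp (-t)\<close> in the mean, and the mean of \<open>(1 + c)^X\<close> for the
  Poisson number \<open>X\<close> of births in the window is \<open>exp (B c t)\<close>.\<close>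

definition at_most_one :: "'b set \<Rightarrow> bool" where
  "at_most_one A \<longleftrightarrow> (\<forall>x\<in>A. \<forall>y\<in>A. x = y)"

text \<open>
  Agrees with \<open>birth_update\<close> on finite sets; without \<open>card\<close>, infinite sets of points need no special
  treatment (there \<open>card\<close> is 0).
\<close>

definition update_step :: "bool \<Rightarrow> 'b \<Rightarrow> 'b set \<Rightarrow> 'b set \<times> 'b set \<Rightarrow> 'b set \<times> 'b set" where
  "update_step swap v K LU =
    (if \<not> swap then (if snd LU \<inter> K = {} then insert v (fst LU) else fst LU,
                      if fst LU \<inter> K = {} then insert v (snd LU) else snd LU)
     else if at_most_one (snd LU \<inter> K) then (insert v (fst LU - K), insert v (snd LU - K))
     else if \<not> at_most_one (fst LU \<inter> K) then LU
     else (fst LU - K, insert v (snd LU)))"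

lemma at_most_one_iff_card: "finite A \<Longrightarrow> at_most_one A \<longleftrightarrow> card A \<le> 1"
  using card_le_Suc0_iff_eq[of A] by (simp add: at_most_one_def)

lemma at_most_one_subset: "A \<subseteq> B \<Longrightarrow> at_most_one B \<Longrightarrow> at_most_one A"
  unfolding at_most_one_def by blast

lemma at_most_one_image: "inj f \<Longrightarrow> at_most_one (f ` A) \<longleftrightarrow> at_most_one A"
  by (auto simp: at_most_one_def inj_eq)

text \<open>\<open>birth_update\<close> takes only the upper blockers out of the lower set,
  \<open>update_step\<close> all of \<open>K\<close>; nesting makes the two agree. Finiteness of
  \<open>K\<close> ties \<open>card\<close> to \<open>at_most_one\<close>.\<close>

lemma birth_update_eq_update_step:
  assumes "finite K" "fst LU \<subseteq> snd LU"
  shows "birth_record.birth_update swap v K LU = update_step swap v K LU"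
proof -
  have "finite (snd LU \<inter> K)" "finite (fst LU \<inter> K)" using assms by auto
  then have "card (snd LU \<inter> K) \<le> 1 \<longleftrightarrow> at_most_one (snd LU \<inter> K)"
    "2 \<le> card (fst LU \<inter> K) \<longleftrightarrow> \<not> at_most_one (fst LU \<inter> K)"
    by (auto simp: at_most_one_iff_card)
  moreover have "fst LU - snd LU \<inter> K = fst LU - K" using assms(2) by auto
  moreover have "A - A \<inter> K = A - K" for A :: "'a set" by auto
  ultimately show ?thesis
    by (simp add: birth_record.birth_update_def update_step_def Let_def prod_eq_iff)
qed

lemma update_step_nested:
  assumes "fst LU \<subseteq> snd LU"
  shows "fst (update_step c v K LU) \<subseteq> snd (update_step c v K LU)"
proof -
  have "fst LU \<inter> K \<subseteq> snd LU \<inter> K" using assms by auto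
  with assms show ?thesis unfolding update_step_def by auto
qed

text \<open>\<open>P\<close> knows less than \<open>Q\<close>. Passing from \<open>P\<close> to
  \<open>Q\<close>, lower blockers can only increase and upper blockers only decrease. With the swap
  coin, a case settled for \<open>P\<close> (at most one upper blocker, or two lower ones) is thus
  the same case for \<open>Q\<close>. Only the undecided case of \<open>P\<close> can become another
  one, and there \<open>P\<close> drops its lower blockers and admits \<open>v\<close> to the upper
  set, which covers every outcome for \<open>Q\<close>.\<close>

lemma update_step_mono:
  assumes "fst P \<subseteq> fst Q" "fst Q \<subseteq> snd Q" "snd Q \<subseteq> snd P"
  shows "fst (update_step c v K P) \<subseteq> fst (update_step c v K Q)"
    and "snd (update_step c v K Q) \<subseteq> snd (update_step c v K P)"
proof -
  have 1: "fst P \<inter> K \<subseteq> fst Q \<inter> K" "snd Q \<inter> K \<subseteq> snd P \<inter> K" "fst Q \<inter> K \<subseteq> snd Q \<inter> K"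
    using assms by auto
  have 2: "at_most_one (fst Q \<inter> K) \<Longrightarrow> at_most_one (fst P \<inter> K)"
    "at_most_one (snd P \<inter> K) \<Longrightarrow> at_most_one (snd Q \<inter> K)"
    "at_most_one (snd Q \<inter> K) \<Longrightarrow> at_most_one (fst Q \<inter> K)"
    using at_most_one_subset 1 by metis+
  have "fst (update_step c v K P) \<subseteq> fst (update_step c v K Q) \<and>
    snd (update_step c v K Q) \<subseteq> snd (update_step c v K P)"
  proof (cases c)
    case True
    then show ?thesis using assms 2
      by (cases "at_most_one (snd P \<inter> K)"; cases "at_most_one (snd Q \<inter> K)";
          cases "at_most_one (fst Q \<inter> K)"; cases "at_most_one (fst P \<inter> K)")
        (simp_all add: update_step_def, blast+)
  next
    case False
    then show ?thesis using assms 1 by (auto simp: update_step_def)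
  qed
  then show "fst (update_step c v K P) \<subseteq> fst (update_step c v K Q)"
    "snd (update_step c v K Q) \<subseteq> snd (update_step c v K P)" by blast+
qed

lemma update_step_image:
  assumes "inj f"
  shows "update_step c (f v) (f ` K) (f ` L, f ` U)
    = map_prod (image f) (image f) (update_step c v K (L, U))"
  using assms by (simp add: update_step_def image_Int[symmetric] at_most_one_image image_set_diff)

text \<open>If only points of \<open>A\<close> can block, points outside \<open>A\<close> do not
  influence what happens inside. This is why \<open>run\<close> may carry dead points along and have
  them cut off at the end.\<close>

lemma update_step_Int:
  assumes "K \<subseteq> A" "v \<notin> L" "v \<notin> U"
  shows "fst (update_step c v K (L, U)) \<inter> insert v A = fst (update_step c v K (L \<inter> A, U \<inter> A))"
    and "snd (update_step c v K (L, U)) \<inter> insert v A = snd (update_step c v K (L \<inter> A, U \<inter> A))"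
proof -
  have "L \<inter> A \<inter> K = L \<inter> K" "U \<inter> A \<inter> K = U \<inter> K" using assms by auto
  with assms show "fst (update_step c v K (L, U)) \<inter> insert v A = fst (update_step c v K (L \<inter> A, U \<inter> A))"
    "snd (update_step c v K (L, U)) \<inter> insert v A = snd (update_step c v K (L \<inter> A, U \<inter> A))"
    by (auto simp: update_step_def)
qed

section \<open>The birth sequence of one outcome and the comparison process on birth indices\<close>

type_synonym 'a birth = "real \<times> 'a \<times> real \<times> (nat \<Rightarrow> bool) \<times> bool"

definition bgap :: "'a birth \<Rightarrow> real" where "bgap y = fst y"
definition bloc :: "'a birth \<Rightarrow> 'a" where "bloc y = fst (snd y)"
definition blife :: "'a birth \<Rightarrow> real" where "blife y = fst (snd (snd y))"
definition bmark :: "'a birth \<Rightarrow> nat \<Rightarrow> bool" where "bmark y = fst (snd (snd (snd y)))"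
definition bcoin :: "'a birth \<Rightarrow> bool" where "bcoin y = snd (snd (snd (snd y)))"

lemmas birth_simps = bgap_def bloc_def blife_def bmark_def bcoin_def

text \<open>Birth \<open>n\<close> happens at time \<open>- age x (Suc n)\<close>.\<close>

definition age :: "(nat \<Rightarrow> 'a birth) \<Rightarrow> nat \<Rightarrow> real" where
  "age x j = (\<Sum>i<j. bgap (x i))"

text \<open>Death not before \<open>- age x j\<close>, which is the time of birth
  \<open>j - 1\<close>, or 0 if \<open>j = 0\<close>. The inequality is not strict because the state
  just before that time is meant. Nothing requires \<open>m\<close> to be born by then; that
  restriction (\<open>m \<ge> j\<close>) is imposed wherever the set is used.\<close>

definition alive :: "(nat \<Rightarrow> 'a birth) \<Rightarrow> nat \<Rightarrow> nat set" where
  "alive x j = {m. age x (Suc m) - age x j \<le> blife (x m)}"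

text \<open>The index version of \<open>blockers\<close>: \<open>Suc j\<close> because birth
  \<open>j\<close> happens at \<open>- age x (Suc j)\<close>, and \<open>j < m\<close> encodes the
  order of the birth times and, when locations are distinct, that the neighbor is another
  point.\<close>

definition blocking :: "('a \<Rightarrow> 'a \<Rightarrow> real) \<Rightarrow> real \<Rightarrow> (nat \<Rightarrow> 'a birth) \<Rightarrow> nat \<Rightarrow> nat set" where
  "blocking rho R x j = {m \<in> alive x (Suc j).
     j < m \<and> rho (bloc (x j)) (bloc (x m)) \<le> R \<and> \<not> bmark (x j) m}"

text \<open>
  \<open>run rho R x j i\<close> is the pair of lower and upper state after the \<open>i\<close> births \<open>j + i - 1, ..., j\<close>
  when nothing is known before them. Deaths are not executed: only points that are alive block, so
  it suffices to intersect with \<open>alive\<close> at the end.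
\<close>

primrec run :: "('a \<Rightarrow> 'a \<Rightarrow> real) \<Rightarrow> real \<Rightarrow> (nat \<Rightarrow> 'a birth) \<Rightarrow> nat \<Rightarrow> nat \<Rightarrow> nat set \<times> nat set" where
  "run rho R x j 0 = ({}, {j..})"
| "run rho R x j (Suc i) = update_step (bcoin (x j)) j (blocking rho R x j) (run rho R x (Suc j) i)"

lemma run_nested: "fst (run rho R x j i) \<subseteq> snd (run rho R x j i)"
  by (induction i arbitrary: j) (auto intro!: update_step_nested)

lemma update_step_subset:
  "fst (update_step c v K LU) \<subseteq> insert v (fst LU)" "snd (update_step c v K LU) \<subseteq> insert v (snd LU)"
  by (auto simp: update_step_def)

lemma run_subset: "snd (run rho R x j i) \<subseteq> {j..}"
proof (induction i arbitrary: j)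
  case (Suc i)
  have "snd (run rho R x j (Suc i)) \<subseteq> insert j {Suc j..}"
    using update_step_subset(2) Suc[of "Suc j"] by fastforce
  then show ?case by auto
qed simp

text \<open>One fixed outcome with the almost sure properties that the pathwise comparison uses.
  Since every birth precedes its death, \<open>finite_deaths\<close> gives local finiteness of
  births as well.\<close>

locale regular_record = birth_record rho R gap loc life mark coin
  for rho :: "'a \<Rightarrow> 'a \<Rightarrow> real" and R :: real
    and gap :: "nat \<Rightarrow> 'w \<Rightarrow> real" and loc :: "nat \<Rightarrow> 'w \<Rightarrow> 'a" and life :: "nat \<Rightarrow> 'w \<Rightarrow> real"
    and mark :: "nat \<Rightarrow> nat \<Rightarrow> 'w \<Rightarrow> bool" and coin :: "nat \<Rightarrow> 'w \<Rightarrow> bool" +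
  fixes \<omega> :: 'w and x :: "nat \<Rightarrow> 'a birth"
  assumes gap_pos: "\<And>n. 0 < gap n \<omega>"
    and life_pos: "\<And>n. 0 < life n \<omega>"
    and loc_inj: "inj (\<lambda>n. loc n \<omega>)"
    and no_ties: "\<And>m n. death n \<omega> \<noteq> birth m \<omega>"
    and finite_deaths: "\<And>s. finite {n. s \<le> death n \<omega>}"
    and x_def: "x = (\<lambda>n. (gap n \<omega>, loc n \<omega>, life n \<omega>, (\<lambda>m. mark n m \<omega>), coin n \<omega>))"
begin

section \<open>Event times of a regular outcome\<close>

lemma birth_age: "birth n \<omega> = - age x (Suc n)"
  by (simp add: birth_def age_def x_def bgap_def lessThan_Suc_atMost)

lemma age_strict_mono: "strict_mono (age x)"
  by (rule strict_monoI_Suc) (simp add: age_def x_def bgap_def gap_pos)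

lemma birth_less_iff: "birth m \<omega> < birth n \<omega> \<longleftrightarrow> n < m"
  using strict_mono_less[OF age_strict_mono] by (simp add: birth_age)

lemma birth_le_iff: "birth m \<omega> \<le> birth n \<omega> \<longleftrightarrow> n \<le> m"
  using birth_less_iff[of n m] by linarith

lemma birth_eq_iff: "birth m \<omega> = birth n \<omega> \<longleftrightarrow> n = m"
  using birth_le_iff[of n m] birth_le_iff[of m n] by auto

lemma birth_neg: "birth n \<omega> < 0"
  using strict_mono_less[OF age_strict_mono, of 0 "Suc n"] by (simp add: birth_age age_def)

lemma birth_in_events: "birth n \<omega> \<in> event_times \<omega>"
  using birth_neg by (auto simp: event_times_def)

lemma birth_less_death: "birth n \<omega> < death n \<omega>"
  using life_pos by (simp add: death_def)

lemma finite_births: "finite {n. s \<le> birth n \<omega>}"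
  using birth_less_death less_imp_le order.trans
  by (intro finite_subset[OF _ finite_deaths[of s]]) blast

lemma ex_birth_less: "\<exists>n. birth n \<omega> < s"
  using finite_births[of s] infinite_UNIV_nat by (metis (mono_tags) UNIV_eq_I mem_Collect_eq not_le)

lemma finite_events: "finite (event_times \<omega> \<inter> {s..})"
proof (rule finite_subset)
  show "event_times \<omega> \<inter> {s..} \<subseteq>
      (\<lambda>n. birth n \<omega>) ` {n. s \<le> birth n \<omega>} \<union> (\<lambda>n. death n \<omega>) ` {n. s \<le> death n \<omega>}"
    by (auto simp: event_times_def)
qed (simp add: finite_births finite_deaths)

text \<open>The supremum is a maximum: births reach arbitrarily far back, so some birth
  \<open>n\<close> lies below \<open>tau k\<close>, and only the finitely many events from that
  birth on compete.\<close>

lemma tau_Suc: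
  shows "tau (Suc k) \<omega> \<in> event_times \<omega>" "tau (Suc k) \<omega> < tau k \<omega>"
    and "e \<in> event_times \<omega> \<Longrightarrow> e < tau k \<omega> \<Longrightarrow> e \<le> tau (Suc k) \<omega>"
proof -
  define E where "E = {e \<in> event_times \<omega>. e < tau k \<omega>}"
  obtain n where n: "birth n \<omega> < tau k \<omega>" using ex_birth_less by blast
  define F where "F = {e \<in> E. birth n \<omega> \<le> e}"
  have F: "finite F" "birth n \<omega> \<in> F"
    using n birth_neg finite_subset[OF _ finite_events[of "birth n \<omega>"], of F]
    by (auto simp: F_def E_def event_times_def)
  have "Sup E = Max F"
  proof (rule cSup_eq_maximum)
    show "Max F \<in> E" using Max_in[of F] F by (auto simp: F_def)
    show "e \<le> Max F" if "e \<in> E" for e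
      using that F by (cases "birth n \<omega> \<le> e")
        (auto simp: F_def intro: order.trans[of e "birth n \<omega>"])
  qed
  then have t: "tau (Suc k) \<omega> = Max F" by (simp add: E_def)
  then have "tau (Suc k) \<omega> \<in> E" using Max_in[of F] F by (auto simp: F_def)
  then show "tau (Suc k) \<omega> \<in> event_times \<omega>" "tau (Suc k) \<omega> < tau k \<omega>"
    by (auto simp: E_def)
  show "e \<le> tau (Suc k) \<omega>" if "e \<in> event_times \<omega>" "e < tau k \<omega>"
    unfolding t using that F by (cases "birth n \<omega> \<le> e")
        (auto simp: F_def E_def intro: order.trans[of e "birth n \<omega>"])
qed

lemma tau_less: "j < k \<Longrightarrow> tau k \<omega> < tau j \<omega>"
  by (rule lift_Suc_mono_less[of "\<lambda>i. - tau i \<omega>", simplified]) (use tau_Suc(2) in auto)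

lemma blockers_eq: "blockers n \<omega> = (\<lambda>m. loc m \<omega>) ` blocking rho R x n"
proof -
  have "m \<in> blocking rho R x n \<longleftrightarrow> birth m \<omega> < birth n \<omega> \<and> birth n \<omega> \<le> death m \<omega> \<and> loc m \<omega> \<noteq> loc n \<omega>
      \<and> rho (loc n \<omega>) (loc m \<omega>) \<le> R \<and> \<not> mark n m \<omega>" for m
  proof -
    have "n < m \<Longrightarrow> loc m \<omega> \<noteq> loc n \<omega>" using loc_inj by (auto dest: injD)
    moreover have "birth n \<omega> \<le> death m \<omega> \<longleftrightarrow> age x (Suc m) - age x (Suc n) \<le> life m \<omega>"
      by (auto simp: death_def birth_age)
    ultimately show ?thesis
      by (auto simp: blocking_def alive_def birth_less_iff) (auto simp: x_def birth_simps)
  qed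
  then show ?thesis unfolding blockers_def by auto
qed

lemma finite_blocking: "finite (blocking rho R x n)"
proof (rule finite_subset[OF _ finite_deaths[of "birth n \<omega>"]])
  show "blocking rho R x n \<subseteq> {m. birth n \<omega> \<le> death m \<omega>}"
    by (auto simp: blocking_def alive_def death_def birth_age) (auto simp: x_def birth_simps)
qed

text \<open>\<open>J\<close> is the latest birth up to time \<open>s\<close>, pinned down by the set
  equation. For \<open>J \<ge> k\<close> the difference \<open>k - J\<close> is truncated to 0, and
  the run is the uninformed pair of the empty set and everything born. Dead points are cut off here
  because \<open>run\<close> keeps them.\<close>

definition sandwiched :: "nat \<Rightarrow> real \<Rightarrow> 'a set \<times> 'a set \<Rightarrow> bool" where
  "sandwiched k s LU \<longleftrightarrow> fst LU \<subseteq> snd LU \<and> (\<forall>J. {n. birth n \<omega> \<le> s} = {J..} \<longrightarrow>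
     (\<lambda>n. loc n \<omega>) ` (fst (run rho R x J (k - J)) \<inter> {n. s < death n \<omega>}) \<subseteq> fst LU \<and>
     snd LU \<subseteq> (\<lambda>n. loc n \<omega>) ` (snd (run rho R x J (k - J)) \<inter> {n. s < death n \<omega>}))"

lemma sandwiched_start:
  assumes "\<And>i. i < k \<Longrightarrow> s < birth i \<omega>"
  shows "sandwiched k s ({}, D s \<omega>)"
  unfolding sandwiched_def
proof (intro conjI allI impI)
  fix J assume J: "{n. birth n \<omega> \<le> s} = {J..}"
  then have "birth J \<omega> \<le> s" by auto
  with assms[of J] have "k \<le> J" by (cases "J < k") auto
  then have r: "run rho R x J (k - J) = ({}, {J..})" by simp
  show "(\<lambda>n. loc n \<omega>) ` (fst (run rho R x J (k - J)) \<inter> {n. s < death n \<omega>}) \<subseteq> fst ({}, D s \<omega>)"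
    unfolding r by simp
  show "snd ({}, D s \<omega>) \<subseteq> (\<lambda>n. loc n \<omega>) ` (snd (run rho R x J (k - J)) \<inter> {n. s < death n \<omega>})"
    unfolding r using J by (auto simp: D_def)
qed simp

text \<open>At a birth both sides take the same step, and monotonicity of \<open>update_step\<close>
  preserves the sandwich. At a death the run does not move; only the cut-off set loses the dying
  point, as do both processes.\<close>

lemma sandwiched_event:
  assumes LU: "sandwiched k s LU"
    and t: "t \<in> event_times \<omega>" "s < t"
    and gap: "\<And>e. e \<in> event_times \<omega> \<Longrightarrow> s < e \<Longrightarrow> t \<le> e"
  shows "sandwiched k t (event_update t \<omega> LU)"
proof (cases "\<exists>n. birth n \<omega> = t")
  case True
  then obtain m where m: "t = birth m \<omega>" by blast
  have least: "(LEAST n. birth n \<omega> = t) = m" unfolding m birth_eq_iff by (rule Least_equality) auto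
  let ?f = "\<lambda>n. loc n \<omega>" and ?K = "blocking rho R x m"
  have upd: "event_update t \<omega> LU = update_step (coin m \<omega>) (?f m) (?f ` ?K) LU"
  proof -
    have "event_update t \<omega> LU = birth_update (coin m \<omega>) (?f m) (?f ` ?K) LU"
      unfolding event_update_def using True by (simp add: least blockers_eq)
    also have "\<dots> = update_step (coin m \<omega>) (?f m) (?f ` ?K) LU"
      by (rule birth_update_eq_update_step) (use LU finite_blocking in \<open>auto simp: sandwiched_def\<close>)
    finally show ?thesis .
  qed
  have born: "{n. birth n \<omega> \<le> t} = {m..}" by (auto simp: m birth_le_iff)
  have born_s: "{n. birth n \<omega> \<le> s} = {Suc m..}"
  proof -
    have *: "birth n \<omega> \<le> s \<longleftrightarrow> Suc m \<le> n" for n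
    proof -
      have "birth n \<omega> \<le> s \<longleftrightarrow> birth n \<omega> < birth m \<omega>"
        using gap[OF birth_in_events, of n] t(2) unfolding m by linarith
      then show ?thesis by (simp only: birth_less_iff Suc_le_eq)
    qed
    show ?thesis by (simp only: * atLeast_def)
  qed
  define A where "A = {n. Suc m \<le> n \<and> s < death n \<omega>}"
  \<comment> \<open>No event lies strictly between \<open>s\<close> and \<open>t\<close>, so
    surviving beyond \<open>s\<close> means surviving up to \<open>t\<close>.\<close>
  have A: "s < death n \<omega> \<longleftrightarrow> t \<le> death n \<omega>" for n
  proof
    assume "s < death n \<omega>"
    moreover have "death n \<omega> \<in> event_times \<omega>" if "death n \<omega> < 0"
      using that unfolding event_times_def by blast
    moreover have "t < 0" using t(1) by (simp add: event_times_def)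
    ultimately show "t \<le> death n \<omega>" using gap[of "death n \<omega>"] by linarith
  qed (use t in simp)
  \<comment> \<open>Since \<open>t\<close> is a birth time and there are no ties, the points alive
    just before \<open>t\<close> are still alive at \<open>t\<close>.\<close>
  have A': "t \<le> death n \<omega> \<longleftrightarrow> t < death n \<omega>" for n using no_ties[of n m] m by auto
  define LU0 where "LU0 = run rho R x (Suc m) (k - Suc m)"
  have KA: "?K \<subseteq> A"
  proof
    fix n assume "n \<in> ?K"
    then have "m < n" "t \<le> death n \<omega>"
      by (auto simp: blocking_def alive_def death_def birth_age m) (auto simp: x_def birth_simps)
    then show "n \<in> A" by (simp add: A_def A)
  qed
  have sub: "fst LU0 \<subseteq> {Suc m..}" "snd LU0 \<subseteq> {Suc m..}"
    using run_subset[of rho R x "Suc m"] run_nested[of rho R x "Suc m"] by (auto simp: LU0_def)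
  have LU0: "?f ` (fst LU0 \<inter> A) \<subseteq> fst LU" "snd LU \<subseteq> ?f ` (snd LU0 \<inter> A)" "fst LU \<subseteq> snd LU"
  proof -
    have "fst LU0 \<inter> A = fst LU0 \<inter> {n. s < death n \<omega>}" "snd LU0 \<inter> A = snd LU0 \<inter> {n. s < death n \<omega>}"
      using sub by (auto simp: A_def)
    then show "?f ` (fst LU0 \<inter> A) \<subseteq> fst LU" "snd LU \<subseteq> ?f ` (snd LU0 \<inter> A)" "fst LU \<subseteq> snd LU"
      using LU born_s by (auto simp: sandwiched_def LU0_def)
  qed
  define S where "S = update_step (coin m \<omega>) m ?K LU0"
  have img: "update_step (coin m \<omega>) (?f m) (?f ` ?K) (?f ` (fst LU0 \<inter> A), ?f ` (snd LU0 \<inter> A))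
      = (?f ` (fst S \<inter> insert m A), ?f ` (snd S \<inter> insert m A))"
  proof -
    have "m \<notin> fst LU0" "m \<notin> snd LU0" using sub by auto
    from update_step_Int[OF KA this, of "coin m \<omega>"] show ?thesis
      unfolding update_step_image[OF loc_inj] by (simp add: prod_eq_iff S_def)
  qed
  note mono = update_step_mono[of "(?f ` (fst LU0 \<inter> A), ?f ` (snd LU0 \<inter> A))" LU "coin m \<omega>" "?f m" "?f ` ?K",
      simplified, OF LU0(1,3,2), unfolded img, simplified, folded upd]
  have run: "fst (run rho R x m (k - m)) \<inter> {n. t < death n \<omega>} \<subseteq> fst S \<inter> insert m A"
      "snd S \<inter> insert m A \<subseteq> snd (run rho R x m (k - m)) \<inter> {n. t < death n \<omega>}"
  proof -
    have *: "insert m A = {n. m \<le> n \<and> t < death n \<omega>}"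
      using A A' birth_less_death[of m] m by (auto simp: A_def Suc_le_eq order.order_iff_strict)
    show "fst (run rho R x m (k - m)) \<inter> {n. t < death n \<omega>} \<subseteq> fst S \<inter> insert m A"
      "snd S \<inter> insert m A \<subseteq> snd (run rho R x m (k - m)) \<inter> {n. t < death n \<omega>}"
    proof -
      \<comment> \<open>For \<open>m < k\<close> the birth adds one step to the run. For older
        births the truncated difference is 0, and the trivial pair bounds whatever the step
        produces.\<close>
      have "run rho R x m (k - m) = S" if "m < k"
      proof -
        have "k - m = Suc (k - Suc m)" using that by simp
        moreover have "bcoin (x m) = coin m \<omega>" by (simp add: x_def bcoin_def)
        ultimately show ?thesis by (simp only: run.simps S_def LU0_def)
      qed
      moreover have "run rho R x m (k - m) = ({}, {m..})" if "\<not> m < k" using that by simp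
      ultimately show "fst (run rho R x m (k - m)) \<inter> {n. t < death n \<omega>} \<subseteq> fst S \<inter> insert m A"
        "snd S \<inter> insert m A \<subseteq> snd (run rho R x m (k - m)) \<inter> {n. t < death n \<omega>}"
        unfolding * using run_subset[of rho R x m "k - m"] run_nested[of rho R x m "k - m"]
        by (cases "m < k"; auto)+
    qed
  qed
  have nest: "fst (event_update t \<omega> LU) \<subseteq> snd (event_update t \<omega> LU)"
    unfolding upd by (rule update_step_nested[OF LU0(3)])
  show ?thesis unfolding sandwiched_def born
  proof (intro conjI allI impI nest)
    fix J assume "{m..} = {J..}"
    then have J: "J = m" by (metis atLeast_eq_iff)
    show "?f ` (fst (run rho R x J (k - J)) \<inter> {n. t < death n \<omega>}) \<subseteq> fst (event_update t \<omega> LU)"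
      unfolding J using mono(1) run(1) by (blast intro: order.trans[OF image_mono])
    show "snd (event_update t \<omega> LU) \<subseteq> ?f ` (snd (run rho R x J (k - J)) \<inter> {n. t < death n \<omega>})"
      unfolding J using mono(2) run(2) by (blast intro: order.trans[OF _ image_mono])
  qed
next
  case False
  let ?f = "\<lambda>n. loc n \<omega>" and ?W = "{loc n \<omega> | n. death n \<omega> = t}"
  have upd: "event_update t \<omega> LU = (fst LU - ?W, snd LU - ?W)"
    unfolding event_update_def death_update_def using False by simp
  have born: "{n. birth n \<omega> \<le> t} = {n. birth n \<omega> \<le> s}"
  proof -
    have "birth n \<omega> \<le> t \<longleftrightarrow> birth n \<omega> \<le> s" for n
      using gap[OF birth_in_events, of n] t(2) False by (metis less_le_trans linorder_not_le nle_le)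
    then show ?thesis by simp
  qed
  have A: "{n. t < death n \<omega>} = {n. s < death n \<omega>} - {n. death n \<omega> = t}"
  proof -
    have "t < death n \<omega>" if "s < death n \<omega>" "death n \<omega> \<noteq> t" for n
    proof -
      have "death n \<omega> \<in> event_times \<omega>" if "death n \<omega> < 0"
        using that unfolding event_times_def by blast
      moreover have "t < 0" using t(1) by (simp add: event_times_def)
      ultimately show ?thesis using gap[of "death n \<omega>"] that by linarith
    qed
    then show ?thesis using t by force
  qed
  have img: "?f ` (B \<inter> {n. t < death n \<omega>}) = ?f ` (B \<inter> {n. s < death n \<omega>}) - ?W" for B
    unfolding A using loc_inj by (auto simp: inj_def)
  show ?thesis using LU unfolding sandwiched_def born upd img by auto
qed

text \<open>The hypothesis on \<open>k\<close> places births \<open>0, ..., k - 1\<close> after the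
  start at \<open>tau N\<close>, so the bounding process executes all of them and the sandwich can
  be carried from \<open>tau N\<close> to the last event \<open>tau 1\<close>, where
  \<open>J = 0\<close>.\<close>

lemma disagreement_imp:
  assumes neq: "upper N 0 \<omega> \<noteq> lower N 0 \<omega>" and N: "1 \<le> N"
    and k: "\<And>i. i < k \<Longrightarrow> tau N \<omega> < birth i \<omega>"
  shows "\<exists>n \<in> alive x 0. n \<in> snd (run rho R x 0 k) - fst (run rho R x 0 k)"
proof -
  have "sandwiched k (tau (N - i) \<omega>) (bounding N i \<omega>)" if "i < N" for i
    using that
  proof (induction i)
    case 0
    then show ?case using sandwiched_start[OF k] by simp
  next
    case (Suc i)
    then have N': "N - i = Suc (N - Suc i)" by simp
    show ?case unfolding bounding.simps
    proof (rule sandwiched_event)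
      show "sandwiched k (tau (N - i) \<omega>) (bounding N i \<omega>)" using Suc by simp
      show "tau (N - Suc i) \<omega> \<in> event_times \<omega>"
        using tau_Suc(1)[of "N - Suc i - 1"] Suc.prems by (simp del: tau.simps add: Suc_diff_Suc)
      show "tau (N - i) \<omega> < tau (N - Suc i) \<omega>" unfolding N' by (rule tau_Suc(2))
      show "tau (N - Suc i) \<omega> \<le> e" if "e \<in> event_times \<omega>" "tau (N - i) \<omega> < e" for e
        using tau_Suc(3)[OF that(1), of "N - Suc i"] that(2) unfolding N' by linarith
    qed
  qed
  from this[of "N - 1"] N have sw: "sandwiched k (tau 1 \<omega>) (bounding N (N - 1) \<omega>)" by simp
  have "tau j \<omega> \<le> 0" for j using tau_less[of 0 j] by (cases j) (auto simp del: tau.simps(2))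
  then have "{j \<in> {1..<N}. tau j \<omega> \<le> 0} = {1..<N}" by blast
  then have e: "events_until N 0 \<omega> = N - 1" by (simp add: events_until_def)
  define L where "L = fst (bounding N (N - 1) \<omega>)"
  define U where "U = snd (bounding N (N - 1) \<omega>)"
  have last: "e \<le> tau 1 \<omega>" if "e \<in> event_times \<omega>" for e
    using tau_Suc(3)[OF that, of 0] that by (simp add: event_times_def)
  have "birth n \<omega> \<le> tau 1 \<omega>" for n using last birth_neg by (auto simp: event_times_def)
  then have "{n. birth n \<omega> \<le> tau 1 \<omega>} = {0..}" by (simp only: atLeast_0) blast
  with sw[unfolded sandwiched_def, THEN conjunct2, rule_format, of 0]
    sw[unfolded sandwiched_def, THEN conjunct1]
  have *: "L \<subseteq> U"
    "(\<lambda>n. loc n \<omega>) ` (fst (run rho R x 0 k) \<inter> {n. tau 1 \<omega> < death n \<omega>}) \<subseteq> L"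
    "U \<subseteq> (\<lambda>n. loc n \<omega>) ` (snd (run rho R x 0 k) \<inter> {n. tau 1 \<omega> < death n \<omega>})"
    unfolding L_def U_def diff_zero by blast+
  have "U \<noteq> L" using neq by (simp add: upper_def lower_def e L_def U_def)
  with * obtain n where n: "n \<in> snd (run rho R x 0 k) - fst (run rho R x 0 k)" "tau 1 \<omega> < death n \<omega>"
    by blast
  \<comment> \<open>No event is left after \<open>tau 1\<close>, so a point that outlives it is
    alive up to time 0.\<close>
  have "\<not> death n \<omega> < 0" using last[of "death n \<omega>"] n(2) by (auto simp: event_times_def)
  then have "n \<in> alive x 0"
    by (simp add: alive_def death_def birth_age age_def) (simp add: x_def birth_simps)
  with n(1) show ?thesis by blast
qed

text \<open>The times \<open>tau 1, ..., tau N\<close> are distinct, lie in \<open>(s, 0)\<close>,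
  and each is a birth or a death time.\<close>

lemma many_events:
  assumes "s < tau N \<omega>"
  shows "N \<le> card {n. s < birth n \<omega>} + card {n. s < death n \<omega> \<and> death n \<omega> < 0}"
proof -
  define E where "E = (\<lambda>n. birth n \<omega>) ` {n. s < birth n \<omega>}
      \<union> (\<lambda>n. death n \<omega>) ` {n. s < death n \<omega> \<and> death n \<omega> < 0}"
  have fin: "finite {n. s < birth n \<omega>}" "finite {n. s < death n \<omega> \<and> death n \<omega> < 0}"
    by (auto intro: finite_subset[OF _ finite_births[of s]] finite_subset[OF _ finite_deaths[of s]])
  have inj: "inj_on (\<lambda>j. tau j \<omega>) {1..N}"
    by (rule inj_onI) (metis less_irrefl linorder_neqE_nat tau_less)
  have "(\<lambda>j. tau j \<omega>) ` {1..N} \<subseteq> E"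
  proof clarify
    fix j assume j: "j \<in> {1..N}"
    then have "tau N \<omega> \<le> tau j \<omega>" using tau_less[of j N] by (cases "j = N") auto
    moreover have "tau j \<omega> \<in> event_times \<omega>" using tau_Suc(1)[of "j - 1"] j by (simp del: tau.simps)
    ultimately show "tau j \<omega> \<in> E" using assms by (auto simp: E_def event_times_def)
  qed
  then have "N \<le> card E"
    using card_image[OF inj] card_mono[of E "(\<lambda>j. tau j \<omega>) ` {1..N}"] fin by (simp add: E_def)
  also have "\<dots> \<le> card {n. s < birth n \<omega>} + card {n. s < death n \<omega> \<and> death n \<omega> < 0}"
    unfolding E_def using fin by (meson card_Un_le card_image_le add_mono order.trans)
  finally show ?thesis .
qed

end

section \<open>Renewal inequalities for independent sequences\<close>

lemma nn_integral_exponential_tail: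
  assumes "0 \<le> a"
  shows "(\<integral>\<^sup>+l. indicator {l. a \<le> l} l \<partial>density lborel (exponential_density 1)) = ennreal (exp (- a))"
proof -
  have "(\<integral>\<^sup>+l. indicator {l. a \<le> l} l \<partial>density lborel (exponential_density 1))
      = (\<integral>\<^sup>+l. ennreal (exp (- l)) * indicator {a..} l \<partial>lborel)"
    using assms by (subst nn_integral_density)
      (auto intro!: nn_integral_cong simp: exponential_density_def indicator_def)
  also have "\<dots> = ennreal (0 - (- exp (- a)))"
  proof (rule nn_integral_FTC_atLeast)
    show "((\<lambda>l. - exp (- l)) \<longlongrightarrow> 0) (at_top :: real filter)"
      using tendsto_minus[OF filterlim_compose[OF exp_at_bot filterlim_uminus_at_bot_at_top]] by simp
  qed (auto intro!: derivative_eq_intros)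
  finally show ?thesis by simp
qed

text \<open>This integrates out one exponential gap. The equation \<open>G' = B (G - k)\<close> says
  precisely that \<open>- exp (- B g) * G (s + g)\<close> is an antiderivative of
  \<open>B exp (- B g) * k (s + g)\<close>; the values at \<open>t\<close> cancel by
  \<open>glue\<close>, and the limit removes the boundary term at infinity. Two pieces are needed
  because the integrand changes its form at the end \<open>t\<close> of the window.\<close>

lemma nn_integral_exponential_two_pieces:
  fixes B t s :: real and G1 G2 k1 k2 :: "real \<Rightarrow> real"
  assumes B: "0 < B"
    and [measurable]: "k1 \<in> borel_measurable borel" "k2 \<in> borel_measurable borel"
    and G1: "\<And>u. u \<le> t \<Longrightarrow> (G1 has_real_derivative B * (G1 u - k1 u)) (at u)"
    and G2: "\<And>u. t \<le> u \<Longrightarrow> (G2 has_real_derivative B * (G2 u - k2 u)) (at u)"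
    and k1: "\<And>u. s \<le> u \<Longrightarrow> u \<le> t \<Longrightarrow> 0 \<le> k1 u" and k2: "\<And>u. t \<le> u \<Longrightarrow> 0 \<le> k2 u"
    and glue: "G1 t = G2 t" and G2_nonneg: "0 \<le> G2 t"
    and lim: "((\<lambda>u. exp (- B * u) * G2 u) \<longlongrightarrow> 0) at_top"
  shows "(\<integral>\<^sup>+g. (if s + g < t then ennreal (k1 (s + g)) else ennreal (k2 (s + g)))
      \<partial>density lborel (exponential_density B)) = ennreal (if s < t then G1 s else G2 s)"
proof -
  define F1 where "F1 g = - exp (- B * g) * G1 (s + g)" for g
  define F2 where "F2 g = - exp (- B * g) * G2 (s + g)" for g
  define f1 where "f1 g = B * exp (- B * g) * k1 (s + g)" for g
  define f2 where "f2 g = B * exp (- B * g) * k2 (s + g)" for g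
  have [measurable]: "f1 \<in> borel_measurable borel" "f2 \<in> borel_measurable borel"
    unfolding f1_def[abs_def] f2_def[abs_def] by measurable
  have D1: "DERIV F1 g :> f1 g" if "g \<le> t - s" for g
  proof -
    have "((\<lambda>g. G1 (s + g)) has_real_derivative B * (G1 (s + g) - k1 (s + g))) (at g)"
      using G1[of "s + g"] that by (simp add: DERIV_shift add.commute)
    then show ?thesis unfolding F1_def[abs_def] f1_def
      by (auto intro!: derivative_eq_intros simp: algebra_simps)
  qed
  have D2: "DERIV F2 g :> f2 g" if "t - s \<le> g" for g
  proof -
    have "((\<lambda>g. G2 (s + g)) has_real_derivative B * (G2 (s + g) - k2 (s + g))) (at g)"
      using G2[of "s + g"] that by (simp add: DERIV_shift add.commute)
    then show ?thesis unfolding F2_def[abs_def] f2_def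
      by (auto intro!: derivative_eq_intros simp: algebra_simps)
  qed
  have f1: "0 \<le> f1 g" if "0 \<le> g" "g \<le> t - s" for g using that k1[of "s + g"] B by (simp add: f1_def)
  have f2: "0 \<le> f2 g" if "t - s \<le> g" for g using that k2[of "s + g"] B by (simp add: f2_def)
  have limF: "(F2 \<longlongrightarrow> 0) at_top"
  proof -
    have "((\<lambda>g. exp (- B * (g + s)) * G2 (g + s)) \<longlongrightarrow> 0) at_top"
      using filterlim_compose[OF lim filterlim_tendsto_add_at_top[OF tendsto_const filterlim_ident, of s]]
      by (simp add: add.commute)
    then have "((\<lambda>g. - exp (B * s) * (exp (- B * (g + s)) * G2 (g + s))) \<longlongrightarrow> - exp (B * s) * 0) at_top"
      by (rule tendsto_mult_left)
    moreover have "- exp (B * s) * (exp (- B * (g + s)) * G2 (g + s)) = F2 g" for g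
    proof -
      have "exp (B * s) * exp (- B * (g + s)) = exp (- B * g)"
        by (simp add: mult_exp_exp algebra_simps)
      then show ?thesis unfolding F2_def add.commute[of s g] by simp
    qed
    ultimately show ?thesis by (simp only: mult_zero_right)
  qed
  have dens: "(\<integral>\<^sup>+g. (if s + g < t then ennreal (k1 (s + g)) else ennreal (k2 (s + g)))
      \<partial>density lborel (exponential_density B))
    = (\<integral>\<^sup>+g. (if g < t - s then ennreal (f1 g) else ennreal (f2 g)) * indicator {0..} g \<partial>lborel)"
    using B by (subst nn_integral_density)
      (auto intro!: nn_integral_cong simp: exponential_density_def f1_def f2_def ennreal_mult''[symmetric]
        indicator_def algebra_simps)
  show ?thesis
  proof (cases "s < t")
    case True
    have "(\<integral>\<^sup>+g. (if g < t - s then ennreal (f1 g) else ennreal (f2 g)) * indicator {0..} g \<partial>lborel)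
      = (\<integral>\<^sup>+g. ennreal (f1 g) * indicator {0..t - s} g + ennreal (f2 g) * indicator {t - s..} g \<partial>lborel)"
      using AE_lborel_singleton[of "t - s"] True
      by (intro nn_integral_cong_AE) (auto simp: indicator_def)
    also have "\<dots> = (\<integral>\<^sup>+g. ennreal (f1 g) * indicator {0..t - s} g \<partial>lborel)
        + (\<integral>\<^sup>+g. ennreal (f2 g) * indicator {t - s..} g \<partial>lborel)"
      by (rule nn_integral_add) auto
    also have "(\<integral>\<^sup>+g. ennreal (f1 g) * indicator {0..t - s} g \<partial>lborel) = ennreal (F1 (t - s) - F1 0)"
      by (rule nn_integral_FTC_Icc) (use True f1 D1 in auto)
    also have "(\<integral>\<^sup>+g. ennreal (f2 g) * indicator {t - s..} g \<partial>lborel) = ennreal (0 - F2 (t - s))"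
      by (rule nn_integral_FTC_atLeast) (use f2 D2 limF in auto)
    also have "ennreal (F1 (t - s) - F1 0) + ennreal (0 - F2 (t - s))
        = ennreal (F1 (t - s) - F1 0 + (0 - F2 (t - s)))"
    proof (rule ennreal_plus[symmetric])
      show "0 \<le> F1 (t - s) - F1 0"
        using DERIV_nonneg_imp_nondecreasing[of 0 "t - s" F1] True D1 f1 by fastforce
      show "0 \<le> 0 - F2 (t - s)" using G2_nonneg by (simp add: F2_def)
    qed
    also have "F1 (t - s) - F1 0 + (0 - F2 (t - s)) = G1 s"
      using glue by (simp add: F1_def F2_def)
    finally show ?thesis using True dens by simp
  next
    case False
    have "(\<integral>\<^sup>+g. (if g < t - s then ennreal (f1 g) else ennreal (f2 g)) * indicator {0..} g \<partial>lborel)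
      = (\<integral>\<^sup>+g. ennreal (f2 g) * indicator {0..} g \<partial>lborel)"
      using False by (intro nn_integral_cong) (auto simp: indicator_def)
    also have "\<dots> = ennreal (0 - F2 0)"
      by (rule nn_integral_FTC_atLeast) (use f2 D2 limF False in auto)
    finally show ?thesis using False dens by (simp add: F2_def)
  qed
qed

text \<open>A multiplicative weight \<open>f\<close> and an additive reward \<open>h\<close>
  collected along the partial sums of \<open>g\<close>, with value \<open>e\<close> after
  \<open>m\<close> steps. Peeling off the head of the sequence fits the splitting of a product
  measure into its first coordinate and the rest.\<close>

primrec renewal :: "('a \<Rightarrow> real) \<Rightarrow> (real \<Rightarrow> 'a \<Rightarrow> ennreal) \<Rightarrow> (real \<Rightarrow> 'a \<Rightarrow> ennreal) \<Rightarrow> ennreal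
    \<Rightarrow> nat \<Rightarrow> real \<Rightarrow> (nat \<Rightarrow> 'a) \<Rightarrow> ennreal" where
  "renewal g f h e 0 s x = e"
| "renewal g f h e (Suc m) s x = h (s + g (x 0)) (x 0)
     + f (s + g (x 0)) (x 0) * renewal g f h e m (s + g (x 0)) (\<lambda>n. x (Suc n))"

lemma renewal_eq:
  "renewal g f h e m s x =
    (\<Sum>n<m. (\<Prod>i<n. f (s + (\<Sum>l<Suc i. g (x l))) (x i)) * h (s + (\<Sum>l<Suc n. g (x l))) (x n))
    + (\<Prod>i<m. f (s + (\<Sum>l<Suc i. g (x l))) (x i)) * e"
proof (induction m arbitrary: s x)
  case (Suc m)
  have *: "s + (\<Sum>l<Suc (Suc i). g (x l)) = s + g (x 0) + (\<Sum>l<Suc i. g (x (Suc l)))" for i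
    by (subst sum.lessThan_Suc_shift) (simp add: add.assoc)
  show ?case
    unfolding renewal.simps Suc.IH
    by (simp only: sum.lessThan_Suc_shift[of _ m] prod.lessThan_Suc_shift * o_def)
      (simp add: distrib_left sum_distrib_left mult.assoc)
qed simp

lemma (in sequence_space) renewal_measurable:
  assumes [measurable]: "g \<in> borel_measurable M"
    "(\<lambda>(u, y). f u y) \<in> borel_measurable (borel \<Otimes>\<^sub>M M)" "(\<lambda>(u, y). h u y) \<in> borel_measurable (borel \<Otimes>\<^sub>M M)"
  shows "(\<lambda>(s, x). renewal g f h e m s x) \<in> borel_measurable (borel \<Otimes>\<^sub>M S)"
proof (induction m)
  case (Suc m)
  note Suc[measurable]
  have [measurable]: "(\<lambda>p n. snd p (Suc n)) \<in> measurable (borel \<Otimes>\<^sub>M S) S"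
    by (rule measurable_PiM_single') (auto simp: space_pair_measure space_PiM)
  have "(\<lambda>(s, x). renewal g f h e (Suc m) s x) = (\<lambda>p.
     (\<lambda>(u, y). h u y) (fst p + g (snd p 0), snd p 0)
     + (\<lambda>(u, y). f u y) (fst p + g (snd p 0), snd p 0)
       * (\<lambda>(s, x). renewal g f h e m s x) (fst p + g (snd p 0), \<lambda>n. snd p (Suc n)))"
    by (auto simp: fun_eq_iff)
  also have "\<dots> \<in> borel_measurable (borel \<Otimes>\<^sub>M S)" by measurable
  finally show ?case .
qed simp

text \<open>After the first coordinate the remaining sequence has the same law, so the induction
  hypothesis applies at the new starting point \<open>s + g y\<close>, and \<open>super\<close>
  integrates out that coordinate. Nonnegative \<open>g\<close> keeps the starting point
  nonnegative.\<close>

lemma (in sequence_space) renewal_bound: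
  fixes G :: "real \<Rightarrow> ennreal"
  assumes g [measurable]: "g \<in> borel_measurable M" and g_pos: "AE y in M. 0 \<le> g y"
    and f [measurable]: "(\<lambda>(u, y). f u y) \<in> borel_measurable (borel \<Otimes>\<^sub>M M)"
    and h [measurable]: "(\<lambda>(u, y). h u y) \<in> borel_measurable (borel \<Otimes>\<^sub>M M)"
    and G [measurable]: "G \<in> borel_measurable borel"
    and super: "\<And>s. 0 \<le> s \<Longrightarrow>
      (\<integral>\<^sup>+y. h (s + g y) y + f (s + g y) y * G (s + g y) \<partial>M) \<le> G s"
    and e: "\<And>s. 0 \<le> s \<Longrightarrow> e \<le> G s"
    and s: "0 \<le> s"
  shows "(\<integral>\<^sup>+x. renewal g f h e m s x \<partial>S) \<le> G s"
  using s
proof (induction m arbitrary: s)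
  case 0
  then show ?case using e by (simp add: P.emeasure_space_1)
next
  case (Suc m)
  note renewal_measurable[OF g f h, measurable]
  have [measurable]: "renewal g f h e m s \<in> borel_measurable S" for m s
    using measurable_compose[OF measurable_Pair1'[of s borel S] renewal_measurable[OF g f h, of e m]] by simp
  have "(\<integral>\<^sup>+x. renewal g f h e (Suc m) s x \<partial>S)
      = (\<integral>\<^sup>+x. renewal g f h e (Suc m) s x \<partial>distr (M \<Otimes>\<^sub>M S) S (\<lambda>(s, \<omega>). case_nat s \<omega>))"
    by (simp only: PiM_iter)
  also have "\<dots> = (\<integral>\<^sup>+p. renewal g f h e (Suc m) s ((\<lambda>(s, \<omega>). case_nat s \<omega>) p) \<partial>(M \<Otimes>\<^sub>M S))"
    by (rule nn_integral_distr) measurable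
  also have "\<dots> = (\<integral>\<^sup>+y. \<integral>\<^sup>+x. renewal g f h e (Suc m) s (case_nat y x) \<partial>S \<partial>M)"
  proof (subst P.nn_integral_fst[symmetric])
    have "(\<lambda>(y, x). case_nat y x) \<in> measurable (M \<Otimes>\<^sub>M S) S" by measurable
    from measurable_compose[OF this, of "renewal g f h e (Suc m) s" borel]
    show "(\<lambda>p. renewal g f h e (Suc m) s ((\<lambda>(y, x). case_nat y x) p)) \<in> borel_measurable (M \<Otimes>\<^sub>M S)"
      by (simp del: renewal.simps)
  qed (simp del: renewal.simps)
  also have "\<dots> = (\<integral>\<^sup>+y. h (s + g y) y + f (s + g y) y * (\<integral>\<^sup>+x. renewal g f h e m (s + g y) x \<partial>S) \<partial>M)"
    by (intro nn_integral_cong) (simp add: nn_integral_add nn_integral_cmult P.emeasure_space_1)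
  also have "\<dots> \<le> (\<integral>\<^sup>+y. h (s + g y) y + f (s + g y) y * G (s + g y) \<partial>M)"
    using g_pos Suc by (intro nn_integral_mono_AE) (auto elim!: AE_mp intro!: add_left_mono mult_left_mono)
  also have "\<dots> \<le> G s" using super Suc by blast
  finally show ?case .
qed

text \<open>Overwriting one coordinate by an independent copy preserves the product measure. The
  right side acts as the expectation conditional on all other coordinates.\<close>

lemma nn_integral_resample:
  fixes Q :: "'b measure"
  assumes Q: "prob_space Q" and "F \<in> borel_measurable (PiM UNIV (\<lambda>_::'i. Q))"
  shows "(\<integral>\<^sup>+x. F x \<partial>PiM UNIV (\<lambda>_::'i. Q)) = (\<integral>\<^sup>+x. \<integral>\<^sup>+y. F (x(n := y)) \<partial>Q \<partial>PiM UNIV (\<lambda>_. Q))"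
proof -
  let ?P = "PiM UNIV (\<lambda>_::'i. Q)"
  interpret Q: prob_space Q by fact
  interpret P: prob_space ?P by (rule prob_space_PiM) (rule Q)
  interpret pair_sigma_finite Q ?P ..
  have upd: "(\<lambda>(y, x). x(n := y)) \<in> measurable (Q \<Otimes>\<^sub>M ?P) ?P"
  proof (rule measurable_PiM_single')
    fix i
    have "(\<lambda>p. (case p of (y, x) \<Rightarrow> x(n := y)) i) = (if i = n then fst else (\<lambda>p. snd p i))"
      by (auto simp: fun_eq_iff)
    also have "\<dots> \<in> measurable (Q \<Otimes>\<^sub>M ?P) Q" by simp
    finally show "(\<lambda>p. (case p of (y, x) \<Rightarrow> x(n := y)) i) \<in> measurable (Q \<Otimes>\<^sub>M ?P) Q" .
  qed (auto simp: space_pair_measure space_PiM)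
  have "(\<integral>\<^sup>+x. F x \<partial>?P) = (\<integral>\<^sup>+x. F x \<partial>distr (Q \<Otimes>\<^sub>M ?P) ?P (\<lambda>(y, x). x(n := y)))"
    using distr_pair_PiM_eq_PiM[of UNIV "\<lambda>_. Q" n] Q by simp
  also have "\<dots> = (\<integral>\<^sup>+p. F ((\<lambda>(y, x). x(n := y)) p) \<partial>(Q \<Otimes>\<^sub>M ?P))"
    using assms(2) by (intro nn_integral_distr[OF upd]) simp
  also have "\<dots> = (\<integral>\<^sup>+x. \<integral>\<^sup>+y. F (x(n := y)) \<partial>Q \<partial>?P)"
  proof (subst nn_integral_snd[symmetric])
    show "(\<lambda>p. F ((\<lambda>(y, x). x(n := y)) p)) \<in> borel_measurable (Q \<Otimes>\<^sub>M ?P)"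
      by (rule measurable_compose[OF upd]) fact
  qed simp
  finally show ?thesis .
qed

section \<open>The law of the birth sequence\<close>

definition set_life :: "'a birth \<Rightarrow> real \<Rightarrow> 'a birth" where
  "set_life y l = (bgap y, bloc y, l, bmark y, bcoin y)"

lemma set_life_simps [simp]:
  "bgap (set_life y l) = bgap y" "bloc (set_life y l) = bloc y" "blife (set_life y l) = l"
  "bmark (set_life y l) = bmark y" "bcoin (set_life y l) = bcoin y"
  by (simp_all add: set_life_def birth_simps)

lemma pred_le_real [measurable (raw)]:
  fixes f g :: "'b \<Rightarrow> real"
  assumes "f \<in> borel_measurable A" "g \<in> borel_measurable A"
  shows "Measurable.pred A (\<lambda>x. f x \<le> g x)"
  unfolding pred_def by (rule borel_measurable_le[OF assms])

lemma nn_integral_const_prob: "prob_space A \<Longrightarrow> (\<integral>\<^sup>+x. c \<partial>A) = c"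
  by (simp add: prob_space.emeasure_space_1)

context bounding_process
begin

abbreviation rate :: real where "rate \<equiv> beta1 * measure lam (space lam)"
abbreviation gap_law where "gap_law \<equiv> density lborel (exponential_density rate)"
abbreviation loc_law where "loc_law \<equiv> uniform_measure lam (space lam)"
abbreviation life_law where "life_law \<equiv> density lborel (exponential_density 1)"
abbreviation mark_law where "mark_law \<equiv> \<Pi>\<^sub>M m\<in>(UNIV::nat set). measure_pmf (bernoulli_pmf beta2)"
abbreviation coin_law where "coin_law \<equiv> measure_pmf (bernoulli_pmf pswap)"
abbreviation one_birth where "one_birth \<equiv> birth_law lam beta1 beta2 pswap"
abbreviation births where "births \<equiv> \<Pi>\<^sub>M n\<in>(UNIV::nat set). one_birth"

lemma finite_lam: "finite_measure lam"
  using lam_finite by (intro finite_measureI) auto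

lemma measure_lam_pos: "0 < measure lam (space lam)"
  using lam_pos lam_finite finite_measure.emeasure_eq_measure[OF finite_lam, of "space lam"]
  by (simp add: ennreal_less_zero_iff)

lemma rate_pos: "0 < rate"
  using beta1_pos measure_lam_pos by simp

lemma prob_space_gap_law: "prob_space gap_law"
  by (rule prob_space_exponential_density[OF rate_pos])

lemma prob_space_life_law: "prob_space life_law"
  by (rule prob_space_exponential_density) simp

lemma prob_space_loc_law: "prob_space loc_law"
  by (rule prob_space_uniform_measure) (use lam_pos lam_finite in auto)

lemma prob_space_mark_law: "prob_space mark_law"
  by (intro prob_space_PiM measure_pmf.prob_space_axioms)

lemmas component_prob_spaces = prob_space_gap_law prob_space_life_law prob_space_loc_law
  prob_space_mark_law measure_pmf.prob_space_axioms

lemmas integral_const_simps = component_prob_spaces[THEN nn_integral_const_prob]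
  prob_space_pair[OF prob_space_mark_law measure_pmf.prob_space_axioms, THEN nn_integral_const_prob]

lemma prob_space_one_birth: "prob_space one_birth"
  unfolding birth_law_def by (intro prob_space_pair component_prob_spaces)

lemma sequence_space_births: "sequence_space one_birth"
proof -
  interpret Q: prob_space one_birth by (rule prob_space_one_birth)
  show ?thesis by unfold_locales
qed

lemma sets_one_birth:
  "sets one_birth = sets (borel \<Otimes>\<^sub>M lam \<Otimes>\<^sub>M borel \<Otimes>\<^sub>M (\<Pi>\<^sub>M m\<in>(UNIV::nat set). count_space UNIV) \<Otimes>\<^sub>M count_space UNIV)"
  unfolding birth_law_def by (intro sets_pair_measure_cong sets_PiM_cong) auto

lemma birth_components_measurable [measurable]:
  "bgap \<in> borel_measurable one_birth" "bloc \<in> measurable one_birth lam"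
  "blife \<in> borel_measurable one_birth" "Measurable.pred one_birth (\<lambda>y. bmark y m)"
  "Measurable.pred one_birth bcoin"
  unfolding bgap_def[abs_def] bloc_def[abs_def] blife_def[abs_def] bcoin_def[abs_def]
    bmark_def[abs_def] measurable_cong_sets[OF sets_one_birth refl] by measurable

lemma set_life_measurable: "(\<lambda>(y, l). set_life y l) \<in> measurable (one_birth \<Otimes>\<^sub>M borel) one_birth"
proof -
  note sets_one_birth[measurable_cong]
  have [measurable]: "bmark \<in> measurable one_birth (\<Pi>\<^sub>M m\<in>(UNIV::nat set). count_space UNIV)"
    unfolding bmark_def[abs_def] by measurable
  show ?thesis unfolding set_life_def by measurable
qed

lemma nn_integral_one_birth:
  assumes F: "F \<in> borel_measurable one_birth"
  shows "(\<integral>\<^sup>+y. F y \<partial>one_birth) = (\<integral>\<^sup>+g. \<integral>\<^sup>+v. \<integral>\<^sup>+l. \<integral>\<^sup>+z. F (g, v, l, z)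
    \<partial>(mark_law \<Otimes>\<^sub>M coin_law) \<partial>life_law \<partial>loc_law \<partial>gap_law)"
proof -
  interpret z: prob_space "mark_law \<Otimes>\<^sub>M coin_law" by (intro prob_space_pair component_prob_spaces)
  interpret l: prob_space "life_law \<Otimes>\<^sub>M mark_law \<Otimes>\<^sub>M coin_law"
    by (intro prob_space_pair component_prob_spaces)
  interpret v: prob_space "loc_law \<Otimes>\<^sub>M life_law \<Otimes>\<^sub>M mark_law \<Otimes>\<^sub>M coin_law"
    by (intro prob_space_pair component_prob_spaces)
  have F1: "F \<in> borel_measurable (gap_law \<Otimes>\<^sub>M loc_law \<Otimes>\<^sub>M life_law \<Otimes>\<^sub>M mark_law \<Otimes>\<^sub>M coin_law)"
    using F by (simp add: birth_law_def)
  have F2: "(\<lambda>p. F (g, p)) \<in> borel_measurable (loc_law \<Otimes>\<^sub>M life_law \<Otimes>\<^sub>M mark_law \<Otimes>\<^sub>M coin_law)" for g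
    by (rule measurable_compose[OF measurable_Pair1' F1]) simp
  have F3: "(\<lambda>p. F (g, v, p)) \<in> borel_measurable (life_law \<Otimes>\<^sub>M mark_law \<Otimes>\<^sub>M coin_law)"
    if "v \<in> space lam" for g v
    by (rule measurable_compose[OF measurable_Pair1' F2]) (use that in simp)
  have "(\<integral>\<^sup>+y. F y \<partial>one_birth) = (\<integral>\<^sup>+g. \<integral>\<^sup>+p. F (g, p)
      \<partial>(loc_law \<Otimes>\<^sub>M life_law \<Otimes>\<^sub>M mark_law \<Otimes>\<^sub>M coin_law) \<partial>gap_law)"
    unfolding birth_law_def by (rule v.nn_integral_fst[OF F1, symmetric])
  also have "\<dots> = (\<integral>\<^sup>+g. \<integral>\<^sup>+v. \<integral>\<^sup>+p. F (g, v, p)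
      \<partial>(life_law \<Otimes>\<^sub>M mark_law \<Otimes>\<^sub>M coin_law) \<partial>loc_law \<partial>gap_law)"
    by (intro nn_integral_cong l.nn_integral_fst[OF F2, symmetric])
  also have "\<dots> = (\<integral>\<^sup>+g. \<integral>\<^sup>+v. \<integral>\<^sup>+l. \<integral>\<^sup>+z. F (g, v, l, z)
    \<partial>(mark_law \<Otimes>\<^sub>M coin_law) \<partial>life_law \<partial>loc_law \<partial>gap_law)"
    by (intro nn_integral_cong z.nn_integral_fst[OF F3, symmetric]) simp
  finally show ?thesis .
qed

lemma nn_integral_gap_life:
  assumes [measurable]: "(\<lambda>(g, l). F g l) \<in> borel_measurable (borel \<Otimes>\<^sub>M borel)"
  shows "(\<integral>\<^sup>+y. F (bgap y) (blife y) \<partial>one_birth) = (\<integral>\<^sup>+g. \<integral>\<^sup>+l. F g l \<partial>life_law \<partial>gap_law)"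
proof -
  have "(\<lambda>y. F (bgap y) (blife y)) \<in> borel_measurable one_birth" by measurable
  from nn_integral_one_birth[OF this] show ?thesis
    by (simp add: bgap_def blife_def integral_const_simps del: nn_integral_const)
qed

lemma nn_integral_gap:
  assumes [measurable]: "F \<in> borel_measurable borel"
  shows "(\<integral>\<^sup>+y. F (bgap y) \<partial>one_birth) = (\<integral>\<^sup>+g. F g \<partial>gap_law)"
  using nn_integral_gap_life[of "\<lambda>g l. F g"] by (simp add: integral_const_simps del: nn_integral_const)

lemma nn_integral_set_life:
  assumes F: "F \<in> borel_measurable one_birth"
  shows "(\<integral>\<^sup>+y. F y \<partial>one_birth) = (\<integral>\<^sup>+y. \<integral>\<^sup>+l. F (set_life y l) \<partial>life_law \<partial>one_birth)"
proof -
  interpret z: prob_space "mark_law \<Otimes>\<^sub>M coin_law" by (intro prob_space_pair component_prob_spaces)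
  interpret l: prob_space life_law by (rule prob_space_life_law)
  interpret lz: pair_sigma_finite life_law "mark_law \<Otimes>\<^sub>M coin_law" ..
  have m: "(\<lambda>(y, l). F (set_life y l)) \<in> borel_measurable (one_birth \<Otimes>\<^sub>M life_law)"
    using measurable_compose[OF set_life_measurable F] by (simp add: case_prod_beta' cong: measurable_cong_sets)
  have "(\<lambda>y. \<integral>\<^sup>+l. F (set_life y l) \<partial>life_law) \<in> borel_measurable one_birth"
    using l.borel_measurable_nn_integral[OF m] by simp
  from nn_integral_one_birth[OF this]
  have "(\<integral>\<^sup>+y. \<integral>\<^sup>+l. F (set_life y l) \<partial>life_law \<partial>one_birth)
    = (\<integral>\<^sup>+g. \<integral>\<^sup>+v. \<integral>\<^sup>+l'. \<integral>\<^sup>+z. \<integral>\<^sup>+l. F (g, v, l, z)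
       \<partial>life_law \<partial>(mark_law \<Otimes>\<^sub>M coin_law) \<partial>life_law \<partial>loc_law \<partial>gap_law)"
    by (simp add: set_life_def birth_simps)
  also have "\<dots> = (\<integral>\<^sup>+g. \<integral>\<^sup>+v. \<integral>\<^sup>+z. \<integral>\<^sup>+l. F (g, v, l, z)
       \<partial>life_law \<partial>(mark_law \<Otimes>\<^sub>M coin_law) \<partial>loc_law \<partial>gap_law)"
    by (simp add: integral_const_simps del: nn_integral_const)
  also have "\<dots> = (\<integral>\<^sup>+g. \<integral>\<^sup>+v. \<integral>\<^sup>+l. \<integral>\<^sup>+z. F (g, v, l, z)
       \<partial>(mark_law \<Otimes>\<^sub>M coin_law) \<partial>life_law \<partial>loc_law \<partial>gap_law)"
  proof (intro nn_integral_cong)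
    fix g v assume v: "v \<in> space loc_law"
    have F1: "F \<in> borel_measurable (gap_law \<Otimes>\<^sub>M loc_law \<Otimes>\<^sub>M life_law \<Otimes>\<^sub>M mark_law \<Otimes>\<^sub>M coin_law)"
      using F by (simp add: birth_law_def)
    have "(\<lambda>p. F (g, v, p)) \<in> borel_measurable (life_law \<Otimes>\<^sub>M mark_law \<Otimes>\<^sub>M coin_law)"
      by (rule measurable_compose[OF measurable_Pair1' measurable_compose[OF measurable_Pair1' F1]])
        (use v in simp_all)
    from lz.Fubini'[of "\<lambda>l z. F (g, v, l, z)"] this
    show "(\<integral>\<^sup>+z. \<integral>\<^sup>+l. F (g, v, l, z) \<partial>life_law \<partial>(mark_law \<Otimes>\<^sub>M coin_law))
      = (\<integral>\<^sup>+l. \<integral>\<^sup>+z. F (g, v, l, z) \<partial>(mark_law \<Otimes>\<^sub>M coin_law) \<partial>life_law)"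
      by (simp add: case_prod_beta')
  qed
  also have "\<dots> = (\<integral>\<^sup>+y. F y \<partial>one_birth)" by (rule nn_integral_one_birth[OF F, symmetric])
  finally show ?thesis ..
qed

lemma upd_measurable:
  "(\<lambda>(x, y). x(n := y)) \<in> measurable (births \<Otimes>\<^sub>M one_birth) births"
proof (rule measurable_PiM_single')
  fix i
  have "(\<lambda>p. (case p of (x, y) \<Rightarrow> x(n := y)) i) = (if i = n then snd else (\<lambda>p. fst p i))"
    by (auto simp: fun_eq_iff)
  also have "\<dots> \<in> measurable (births \<Otimes>\<^sub>M one_birth) one_birth" by simp
  finally show "(\<lambda>p. (case p of (x, y) \<Rightarrow> x(n := y)) i) \<in> measurable (births \<Otimes>\<^sub>M one_birth) one_birth" .
qed (auto simp: space_pair_measure space_PiM)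

lemma borel_measurable_upd:
  assumes x: "x \<in> space births" and f: "f \<in> borel_measurable births"
  shows "(\<lambda>y. f (x(n := y))) \<in> borel_measurable one_birth"
  using measurable_compose[OF measurable_compose[OF measurable_Pair1'[OF x] upd_measurable] f] by simp

text \<open>Conditioning on everything except the lifetime of birth \<open>n\<close>: the source of
  memorylessness, of the absence of ties, and of local finiteness.\<close>

lemma nn_integral_resample_life:
  assumes F: "F \<in> borel_measurable births"
  shows "(\<integral>\<^sup>+x. F x \<partial>births) = (\<integral>\<^sup>+x. \<integral>\<^sup>+l. F (x(n := set_life (x n) l)) \<partial>life_law \<partial>births)"
proof -
  interpret l: prob_space life_law by (rule prob_space_life_law)
  have m: "(\<lambda>(x, l). F (x(n := set_life (x n) l))) \<in> borel_measurable (births \<Otimes>\<^sub>M life_law)"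
  proof -
    have "(\<lambda>(x, l). (x, set_life (x n) l)) \<in> measurable (births \<Otimes>\<^sub>M life_law) (births \<Otimes>\<^sub>M one_birth)"
    proof -
      have "(\<lambda>(x, l). (x n, l)) \<in> measurable (births \<Otimes>\<^sub>M life_law) (one_birth \<Otimes>\<^sub>M borel)" by simp
      from measurable_compose[OF this set_life_measurable] show ?thesis
        by (auto simp: case_prod_beta' intro!: measurable_Pair)
    qed
    from measurable_compose[OF measurable_compose[OF this upd_measurable] F] show ?thesis
      by (simp add: case_prod_beta')
  qed
  have Fy: "(\<lambda>y. F (x(n := y))) \<in> borel_measurable one_birth" if "x \<in> space births" for x
    by (rule borel_measurable_upd[OF that F])
  have "(\<integral>\<^sup>+x. \<integral>\<^sup>+l. F (x(n := set_life (x n) l)) \<partial>life_law \<partial>births)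
     = (\<integral>\<^sup>+x. \<integral>\<^sup>+y. \<integral>\<^sup>+l. F (x(n := set_life y l)) \<partial>life_law \<partial>one_birth \<partial>births)"
    using l.borel_measurable_nn_integral[OF m]
    by (subst nn_integral_resample[OF prob_space_one_birth, where n = n]) simp_all
  also have "\<dots> = (\<integral>\<^sup>+x. \<integral>\<^sup>+y. F (x(n := y)) \<partial>one_birth \<partial>births)"
    by (intro nn_integral_cong nn_integral_set_life[symmetric] Fy)
  also have "\<dots> = (\<integral>\<^sup>+x. F x \<partial>births)"
    by (rule nn_integral_resample[OF prob_space_one_birth F, symmetric])
  finally show ?thesis ..
qed

lemma AE_births: "AE y in one_birth. Q y \<Longrightarrow> AE x in births. \<forall>n. Q (x n)"
proof -
  interpret sequence_space one_birth by (rule sequence_space_births)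
  assume "AE y in one_birth. Q y"
  then show ?thesis by (subst AE_all_countable) (auto intro: AE_component)
qed

lemma AE_exponential_pos: "0 < c \<Longrightarrow> AE l in density lborel (exponential_density c). 0 < l"
  using AE_lborel_singleton[of 0]
  by (subst AE_density) (auto simp: exponential_density_def)

lemma AE_bgap_pos: "AE y in one_birth. 0 < bgap y"
proof -
  have "(\<integral>\<^sup>+y. indicator {0..} (- bgap y) \<partial>one_birth) = (\<integral>\<^sup>+g. indicator {0..} (- g) \<partial>gap_law)"
    by (rule nn_integral_gap) measurable
  also have "\<dots> = (\<integral>\<^sup>+g. 0 \<partial>gap_law)"
    using AE_exponential_pos[OF rate_pos] by (intro nn_integral_cong_AE) auto
  finally have "AE y in one_birth. (indicator {0..} (- bgap y) :: ennreal) = 0"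
    by (subst nn_integral_0_iff_AE[symmetric]) simp_all
  then show ?thesis
    by (rule eventually_mono) (simp add: indicator_def split: if_splits)
qed

lemma AE_gap_pos: "AE x in births. \<forall>n. 0 < bgap (x n)"
  by (rule AE_births[OF AE_bgap_pos])

lemma AE_life_pos: "AE x in births. \<forall>n. 0 < blife (x n)"
proof (rule AE_births)
  have "(\<integral>\<^sup>+y. indicator {0..} (- blife y) \<partial>one_birth) = (\<integral>\<^sup>+g. \<integral>\<^sup>+l. indicator {0..} (- l) \<partial>life_law \<partial>gap_law)"
    by (rule nn_integral_gap_life) measurable
  also have "\<dots> = (\<integral>\<^sup>+g. \<integral>\<^sup>+l. 0 \<partial>life_law \<partial>gap_law)"
    using AE_exponential_pos[of 1] by (intro nn_integral_cong nn_integral_cong_AE) auto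
  finally have "AE y in one_birth. (indicator {0..} (- blife y) :: ennreal) = 0"
    by (subst nn_integral_0_iff_AE[symmetric]) simp_all
  then show "AE y in one_birth. 0 < blife y"
    by (rule eventually_mono) (simp add: indicator_def split: if_splits)
qed

lemma component_measurable: "(\<lambda>x. x n) \<in> measurable births one_birth"
  by simp

lemmas sequence_components_measurable [measurable] =
  birth_components_measurable[THEN measurable_compose[OF component_measurable]]

lemma age_measurable [measurable]: "(\<lambda>x. age x n) \<in> borel_measurable births"
  unfolding age_def by measurable

lemma alive_measurable [measurable]: "Measurable.pred births (\<lambda>x. n \<in> alive x j)"
  unfolding alive_def mem_Collect_eq by measurable

lemma rho_measurable' [measurable]:
  assumes "f \<in> measurable A lam" "g \<in> measurable A lam"
  shows "(\<lambda>x. rho (f x) (g x)) \<in> borel_measurable A"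
  using measurable_compose[OF measurable_Pair[OF assms] rho_measurable] by simp

lemma blocking_measurable [measurable]: "Measurable.pred births (\<lambda>x. n \<in> blocking rho R x j)"
  unfolding blocking_def by simp

lemma update_step_measurable:
  fixes LU :: "'c \<Rightarrow> nat set \<times> nat set"
  assumes [measurable]: "Measurable.pred A c" "\<And>n. Measurable.pred A (\<lambda>x. n \<in> K x)"
    "\<And>n. Measurable.pred A (\<lambda>x. n \<in> fst (LU x))" "\<And>n. Measurable.pred A (\<lambda>x. n \<in> snd (LU x))"
  shows "Measurable.pred A (\<lambda>x. n \<in> fst (update_step (c x) j (K x) (LU x)))"
    "Measurable.pred A (\<lambda>x. n \<in> snd (update_step (c x) j (K x) (LU x)))"
proof -
  have *: "S \<inter> T = {} \<longleftrightarrow> (\<forall>m. \<not> (m \<in> S \<and> m \<in> T))"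
    "at_most_one (S \<inter> T) \<longleftrightarrow> (\<forall>m k. m \<in> S \<longrightarrow> m \<in> T \<longrightarrow> k \<in> S \<longrightarrow> k \<in> T \<longrightarrow> m = k)" for S T :: "nat set"
    by (auto simp: at_most_one_def)
  have "n \<in> fst (update_step c j K LU) \<longleftrightarrow>
    (if \<not> c then (if snd LU \<inter> K = {} then n = j \<or> n \<in> fst LU else n \<in> fst LU)
     else if at_most_one (snd LU \<inter> K) then n = j \<or> n \<in> fst LU \<and> n \<notin> K
     else if \<not> at_most_one (fst LU \<inter> K) then n \<in> fst LU else n \<in> fst LU \<and> n \<notin> K)" for c K LU
    by (auto simp: update_step_def)
  then show "Measurable.pred A (\<lambda>x. n \<in> fst (update_step (c x) j (K x) (LU x)))"
    unfolding * by simp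
  have "n \<in> snd (update_step c j K LU) \<longleftrightarrow>
    (if \<not> c then (if fst LU \<inter> K = {} then n = j \<or> n \<in> snd LU else n \<in> snd LU)
     else if at_most_one (snd LU \<inter> K) then n = j \<or> n \<in> snd LU \<and> n \<notin> K
     else if \<not> at_most_one (fst LU \<inter> K) then n \<in> snd LU else n = j \<or> n \<in> snd LU)" for c K LU
    by (auto simp: update_step_def)
  then show "Measurable.pred A (\<lambda>x. n \<in> snd (update_step (c x) j (K x) (LU x)))"
    unfolding * by simp
qed

lemma run_measurable [measurable]:
  "Measurable.pred births (\<lambda>x. n \<in> fst (run rho R x j i))"
  "Measurable.pred births (\<lambda>x. n \<in> snd (run rho R x j i))"
proof -
  have "(\<forall>n. Measurable.pred births (\<lambda>x. n \<in> fst (run rho R x j i)))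
      \<and> (\<forall>n. Measurable.pred births (\<lambda>x. n \<in> snd (run rho R x j i)))"
  proof (induction i arbitrary: j)
    case (Suc i)
    then show ?case unfolding run.simps by (intro conjI allI update_step_measurable) (auto, measurable)
  qed simp
  then show "Measurable.pred births (\<lambda>x. n \<in> fst (run rho R x j i))"
    "Measurable.pred births (\<lambda>x. n \<in> snd (run rho R x j i))" by auto
qed

end

section \<open>Decay of the undecided points\<close>

text \<open>Extended values make expected counts meaningful before the sets are known to be finite;
  an infinite count only makes a bound trivial.\<close>

abbreviation count_nat :: "nat set \<Rightarrow> ennreal" where
  "count_nat \<equiv> emeasure (count_space UNIV)"

lemma count_nat_suminf: "count_nat A = (\<Sum>n. indicator A n)"
  by (simp add: nn_integral_count_space_nat[symmetric])

lemma count_nat_mono: "A \<subseteq> B \<Longrightarrow> count_nat A \<le> count_nat B"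
  by (rule emeasure_mono) auto

text \<open>Let \<open>d\<close> be the number of undecided blockers. Without a swap at most
  \<open>v\<close> becomes undecided, and only if \<open>d \<ge> 1\<close>, which gives
  \<open>\<kappa> = 1\<close>. With swap probability \<open>p\<close> two cases compete: a lone
  undecided blocker gives the mean change \<open>(1 - p) - p\<close>, and one lower blocker together
  with undecided ones gives at most \<open>2 p\<close>. These balance at \<open>p = 1/4\<close> with
  value \<open>1/2\<close>.\<close>

lemma update_step_drift:
  assumes sub: "L \<subseteq> U" "K \<subseteq> A" "v \<notin> A" "v \<notin> U"
    and p: "p = 0 \<and> \<kappa> = 1 \<or> p = 1/4 \<and> \<kappa> = (1/2 :: real)"
  defines "S c \<equiv> (snd (update_step c v K (L, U)) - fst (update_step c v K (L, U))) \<inter> insert v A"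
  shows "count_nat (S True) * ennreal p + count_nat (S False) * ennreal (1 - p)
    \<le> count_nat ((U - L) \<inter> A) + ennreal \<kappa> * count_nat ((U - L) \<inter> K)"
proof (cases "finite ((U - L) \<inter> A)")
  case False
  then show ?thesis by simp
next
  case fin: True
  define W where "W = (U - L) \<inter> A"
  define D where "D = (U - L) \<inter> K"
  have fW: "finite W" using fin by (simp add: W_def)
  have DW: "D \<subseteq> W" using sub by (auto simp: W_def D_def)
  have fD: "finite D" using DW fW by (rule finite_subset)
  have UK: "U \<inter> K = L \<inter> K \<union> D" using sub by (auto simp: D_def)
  have cd: "D \<noteq> {} \<Longrightarrow> 1 \<le> card D" using fD by (simp add: Suc_le_eq card_gt_0_iff)
  \<comment> \<open>\<open>v\<close> is left open only if no lower point blocks it but some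
    undecided point does; otherwise both processes accept it or both reject it.\<close>
  have SF: "S False = W \<union> (if L \<inter> K = {} \<and> D \<noteq> {} then {v} else {})"
    using sub by (auto simp: S_def update_step_def W_def UK)
  have cSF: "card (S False) = card W + (if L \<inter> K = {} \<and> D \<noteq> {} then 1 else 0)"
    using fW sub by (auto simp: SF W_def)
  have fSF: "finite (S False)" using fW by (simp add: SF)
  have ST: "finite (S True) \<and> 1/4 * real (card (S True)) + 3/4 * real (card (S False))
      \<le> real (card W) + 1/2 * real (card D)"
  proof -
    consider (one) "at_most_one (U \<inter> K)"
      | (two) "\<not> at_most_one (U \<inter> K)" "\<not> at_most_one (L \<inter> K)"
      | (three) "\<not> at_most_one (U \<inter> K)" "at_most_one (L \<inter> K)" by blast
    then show ?thesis
    proof cases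
      case one
      have "S True = W - D"
        using one sub by (auto simp: S_def update_step_def W_def D_def)
      then have "card (S True) = card W - card D" "finite (S True)"
        using fW fD DW by (simp_all add: card_Diff_subset)
      then have T: "real (card (S True)) = real (card W) - real (card D)" "finite (S True)"
        using card_mono[OF fW DW] by (simp_all add: of_nat_diff)
      show ?thesis
      \<comment> \<open>A lone undecided blocker: the swap removes it, and without the swap
        \<open>v\<close> joins it; \<open>- 1/4 + 3/4 = 1/2\<close> is exactly
        \<open>d / 2\<close>.\<close>
      proof (cases "L \<inter> K = {} \<and> D \<noteq> {}")
        case True
        then have "card D = 1"
          using one at_most_one_subset[of D "U \<inter> K"] at_most_one_iff_card[OF fD] cd
          by (auto simp: UK intro: antisym)
        moreover have "card (S False) = card W + 1" using True by (simp add: cSF)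
        ultimately show ?thesis using T by (simp add: field_simps)
      next
        case False
        then have "card (S False) = card W" unfolding cSF by simp
        then have "1/4 * real (card (S True)) + 3/4 * real (card (S False)) \<le> real (card W) + 1/2 * real (card D)"
          unfolding T(1) by (simp add: field_simps)
        then show ?thesis using T(2) by blast
      qed
    next
      case two
      then have "L \<inter> K \<noteq> {}" by (auto simp: at_most_one_def)
      moreover have "S True = W" using two sub by (auto simp: S_def update_step_def W_def)
      ultimately show ?thesis using fW by (auto simp: cSF)
    next
      case three
      have S: "S True = insert v (W \<union> (L \<inter> K))"
        using three sub by (auto simp: S_def update_step_def W_def)
      have fL: "finite (L \<inter> K)"
      proof (cases "L \<inter> K = {}")
        case False
        then obtain a where "a \<in> L \<inter> K" by blast
        with three(2) have "L \<inter> K \<subseteq> {a}" by (auto simp: at_most_one_def)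
        then show ?thesis by (rule finite_subset) simp
      qed simp
      have cS: "card (S True) \<le> card W + card (L \<inter> K) + 1"
        unfolding S using card_insert_le_m1 card_Un_le[of W "L \<inter> K"] fW fL
        by (metis Suc_eq_plus1 Suc_leI card_insert_if finite_UnI le_SucI le_imp_less_Suc)
      show ?thesis
      \<comment> \<open>With no lower blocker, \<open>v\<close> is the only new undecided point
        under either coin and \<open>d \<ge> 2\<close>. With one, the swap also makes that blocker
        undecided, but without the swap nothing changes: \<open>2 * 1/4 \<le> d / 2\<close>.\<close>
      proof (cases "L \<inter> K = {}")
        case True
        then have "\<not> at_most_one D" using three by (simp add: UK)
        then have "2 \<le> card D" using at_most_one_iff_card[OF fD] by simp
        then have "2 \<le> real (card D)" by simp
        moreover have "card (S True) \<le> card W + 1" "card (S False) \<le> card W + 1"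
          using cS True by (simp_all add: cSF)
        then have "real (card (S True)) \<le> real (card W) + 1" "real (card (S False)) \<le> real (card W) + 1"
          by linarith+
        ultimately have "1/4 * real (card (S True)) + 3/4 * real (card (S False))
            \<le> real (card W) + 1/2 * real (card D)" by linarith
        then show ?thesis using fW fL S by simp
      next
        case False
        have "D \<noteq> {}" using three by (auto simp: UK)
        then have "1 \<le> real (card D)" using cd by simp
        moreover have "card (S True) \<le> card W + 2" "card (S False) = card W"
          using cS False three at_most_one_iff_card[OF fL] unfolding cSF by auto
        then have "real (card (S True)) \<le> real (card W) + 2" "real (card (S False)) = real (card W)"
          by linarith+
        ultimately have "1/4 * real (card (S True)) + 3/4 * real (card (S False))
            \<le> real (card W) + 1/2 * real (card D)" by linarith
        then show ?thesis using fW fL S by simp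
      qed
    qed
  qed
  show ?thesis
  proof (cases "p = 0")
    case True
    have "card (S False) \<le> card W + card D" using cd by (auto simp: cSF)
    then have "ennreal (real (card (S False))) \<le> ennreal (real (card W) + real (card D))"
      by (intro ennreal_leI) linarith
    then show ?thesis
      using True p fin fSF fD fW
      by (simp add: W_def[symmetric] D_def[symmetric] ennreal_of_nat_eq_real_of_nat)
  next
    case False
    then have p: "p = 1/4" "\<kappa> = 1/2" using p by auto
    have "ennreal (real (card (S True)) * (1/4) + real (card (S False)) * (3/4))
      \<le> ennreal (real (card W) + 1/2 * real (card D))"
      using ST by (intro ennreal_leI) linarith
    moreover have "ennreal (real (card (S True)) * (1/4) + real (card (S False)) * (3/4))
        = count_nat (S True) * ennreal p + count_nat (S False) * ennreal (1 - p)"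
      using ST fSF by (simp add: p ennreal_of_nat_eq_real_of_nat ennreal_mult'[symmetric] del: ennreal_plus
        add: ennreal_plus[symmetric])
    moreover have "ennreal (real (card W) + 1/2 * real (card D))
        = count_nat W + ennreal \<kappa> * count_nat D"
      using fW fD ennreal_plus[of "real (card W)" "1/2 * real (card D)"]
        ennreal_mult[of "1/2" "real (card D)"]
      by (simp only: p emeasure_count_space_finite subset_UNIV ennreal_of_nat_eq_real_of_nat
        of_nat_0_le_iff zero_le_divide_1_iff zero_le_numeral mult_nonneg_nonneg True_implies_equals)
    ultimately show ?thesis by (simp add: W_def D_def)
  qed
qed

section \<open>Which births and lifetimes a run depends on\<close>

lemma age_diff: "m \<le> n \<Longrightarrow> age x n - age x m = (\<Sum>i\<in>{m..<n}. bgap (x i))"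
  unfolding age_def by (subst sum_diff_nat_ivl[of 0 m n, symmetric]) (auto simp: lessThan_atLeast0)

lemma age_mono: "(\<And>n. 0 \<le> bgap (x n)) \<Longrightarrow> m \<le> n \<Longrightarrow> age x m \<le> age x n"
  using age_diff[of m n x] sum_nonneg[of "{m..<n}" "\<lambda>i. bgap (x i)"] by simp

lemma alive_cong:
  assumes "\<And>i. m \<le> i \<Longrightarrow> x i = y i" "m \<le> n"
  shows "n \<in> alive x m \<longleftrightarrow> n \<in> alive y m"
proof -
  have "age x (Suc n) - age x m = age y (Suc n) - age y m"
    using assms by (simp add: age_diff)
  then show ?thesis using assms by (simp add: alive_def)
qed

lemma run_cong:
  assumes "\<And>m. j \<le> m \<Longrightarrow> bcoin (x m) = bcoin (y m)"
    and "\<And>m. j \<le> m \<Longrightarrow> blocking rho R x m = blocking rho R y m"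
  shows "run rho R x j i = run rho R y j i"
  using assms
proof (induction i arbitrary: j)
  case (Suc i)
  have "run rho R x (Suc j) i = run rho R y (Suc j) i" by (rule Suc.IH) (use Suc.prems in auto)
  then show ?case using Suc.prems[of j] by simp
qed simp

text \<open>The run up to birth \<open>j\<close> reads only births with index at least
  \<open>j\<close>. In \<open>undecided_drift\<close>, applied at \<open>Suc j\<close>, this makes
  the state before birth \<open>j\<close> independent of that birth.\<close>

lemma run_cong_later:
  assumes "\<And>i. j \<le> i \<Longrightarrow> x i = y i"
  shows "run rho R x j k = run rho R y j k"
proof (rule run_cong)
  fix m assume "j \<le> m"
  then have "n \<in> alive x (Suc m) \<longleftrightarrow> n \<in> alive y (Suc m)" if "m < n" for n
    by (intro alive_cong) (use that assms in auto)
  then show "blocking rho R x m = blocking rho R y m"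
    using assms \<open>j \<le> m\<close> unfolding blocking_def by auto
qed (use assms in auto)

lemma age_set_life [simp]: "age (x(n := set_life (x n) l)) m = age x m"
  unfolding age_def by (rule sum.cong) auto

text \<open>Given that point \<open>n\<close> is alive at birth \<open>j\<close>, the run up to that birth does not see its remaining lifetime.\<close>

lemma run_set_life:
  assumes gap: "\<And>n. 0 \<le> bgap (x n)" and n: "j \<le> n"
    and l: "age x (Suc n) - age x (Suc j) \<le> l" and l': "age x (Suc n) - age x (Suc j) \<le> l'"
  shows "run rho R (x(n := set_life (x n) l)) j i = run rho R (x(n := set_life (x n) l')) j i"
proof (rule run_cong)
  fix m assume m: "j \<le> m"
  have "age x (Suc j) \<le> age x (Suc m)" using age_mono[of x "Suc j" "Suc m"] gap m by simp
  then have "k \<in> alive (x(n := set_life (x n) l)) (Suc m) \<longleftrightarrow> k \<in> alive (x(n := set_life (x n) l')) (Suc m)" for k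
    using l l' by (auto simp: alive_def)
  then show "blocking rho R (x(n := set_life (x n) l)) m = blocking rho R (x(n := set_life (x n) l')) m"
    by (auto simp: blocking_def)
qed simp

context bounding_process
begin

definition undecided :: "(nat \<Rightarrow> 'a birth) \<Rightarrow> nat \<Rightarrow> nat \<Rightarrow> nat set" where
  "undecided x j i = snd (run rho R x j i) - fst (run rho R x j i)"

lemma undecided_subset: "undecided x j i \<subseteq> {j..}"
  using run_subset by (force simp: undecided_def)

lemma undecided_measurable [measurable]: "Measurable.pred births (\<lambda>x. n \<in> undecided x j i)"
  unfolding undecided_def by simp

text \<open>If \<open>f\<close> sees the lifetime of \<open>n\<close> only through the fact that
  \<open>n\<close> is alive, integrating that lifetime out leaves an exponential tail.\<close>

lemma nn_integral_alive:
  assumes [measurable]: "f \<in> borel_measurable births" and j: "j \<le> Suc n"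
    and f: "\<And>x l. (\<And>m. 0 \<le> bgap (x m)) \<Longrightarrow> age x (Suc n) - age x j \<le> l \<Longrightarrow>
      f (x(n := set_life (x n) l)) = f' x"
  shows "(\<integral>\<^sup>+x. f x * indicator (alive x j) n \<partial>births)
    = (\<integral>\<^sup>+x. f' x * ennreal (exp (- (age x (Suc n) - age x j))) \<partial>births)"
proof -
  have m: "(\<lambda>x. f x * indicator (alive x j) n) \<in> borel_measurable births"
    unfolding indicator_def by measurable
  show ?thesis
    unfolding nn_integral_resample_life[OF m, of n]
  proof (rule nn_integral_cong_AE, use AE_gap_pos in eventually_elim)
    fix x :: "nat \<Rightarrow> 'a birth" assume "\<forall>n. 0 < bgap (x n)"
    then have gap: "0 \<le> bgap (x m)" for m by (simp add: less_imp_le)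
    let ?a = "age x (Suc n) - age x j"
    have a: "0 \<le> ?a" using age_mono[OF gap j] by simp
    have "(\<integral>\<^sup>+l. f (x(n := set_life (x n) l)) * indicator (alive (x(n := set_life (x n) l)) j) n \<partial>life_law)
      = (\<integral>\<^sup>+l. f' x * indicator {l. ?a \<le> l} l \<partial>life_law)"
      using f[OF gap] by (intro nn_integral_cong) (auto simp: alive_def indicator_def)
    also have "\<dots> = f' x * ennreal (exp (- ?a))"
      using nn_integral_exponential_tail[OF a] by (subst nn_integral_cmult) auto
    finally show "(\<integral>\<^sup>+l. f (x(n := set_life (x n) l)) * indicator (alive (x(n := set_life (x n) l)) j) n \<partial>life_law)
      = f' x * ennreal (exp (- ?a))" .
  qed
qed

lemma nn_integral_count:
  assumes [measurable]: "w \<in> borel_measurable births" "\<And>n. Measurable.pred births (\<lambda>x. n \<in> A x)"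
  shows "(\<integral>\<^sup>+x. w x * count_nat (A x) \<partial>births) = (\<Sum>n. \<integral>\<^sup>+x. w x * indicator (A x) n \<partial>births)"
  unfolding count_nat_suminf ennreal_suminf_cmult[symmetric]
  by (rule nn_integral_suminf) (unfold indicator_def, measurable)

lemma count_measurable [measurable (raw)]:
  assumes [measurable]: "\<And>n. Measurable.pred B (\<lambda>x. n \<in> A x)"
  shows "(\<lambda>x. count_nat (A x)) \<in> borel_measurable B"
  unfolding count_nat_suminf indicator_def by measurable

text \<open>\<open>exp (- age x j)\<close> is the chance of surviving from \<open>- age x j\<close>
  until time 0. By memorylessness, both sides count each undecided \<open>n\<close> with its full
  survival probability \<open>exp (- age x (Suc n))\<close>, so crossing a gap loses
  nothing.\<close>

lemma undecided_memoryless: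
  assumes [measurable]: "w \<in> borel_measurable births"
    and w: "\<And>x y :: nat \<Rightarrow> 'a birth. (\<And>n. bgap (x n) = bgap (y n)) \<Longrightarrow> w x = w y"
  shows "(\<integral>\<^sup>+x. w x * ennreal (exp (- age x j)) * count_nat (undecided x j i \<inter> alive x j) \<partial>births)
    = (\<integral>\<^sup>+x. w x * ennreal (exp (- age x (Suc j))) * count_nat (undecided x j i \<inter> alive x (Suc j)) \<partial>births)"
proof -
  \<comment> \<open>Reference lifetime: \<open>n\<close> lives just until birth \<open>j\<close>.
    Any longer life yields the same run.\<close>
  define \<kappa> :: "nat \<Rightarrow> (nat \<Rightarrow> 'a birth) \<Rightarrow> ennreal" where
    "\<kappa> n x = indicator (undecided (x(n := set_life (x n) (age x (Suc n) - age x (Suc j)))) j i) n" for n x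
  have *: "(\<integral>\<^sup>+x. w x * ennreal (exp (- age x k)) * indicator (undecided x j i \<inter> alive x k) n \<partial>births)
      = (\<integral>\<^sup>+x. w x * ennreal (exp (- age x (Suc n))) * \<kappa> n x \<partial>births)"
    if n: "j \<le> n" and k: "k = j \<or> k = Suc j" for n k
  proof -
    have "(\<integral>\<^sup>+x. w x * ennreal (exp (- age x k)) * indicator (undecided x j i \<inter> alive x k) n \<partial>births)
        = (\<integral>\<^sup>+x. (w x * ennreal (exp (- age x k)) * indicator (undecided x j i) n) * indicator (alive x k) n \<partial>births)"
      by (intro nn_integral_cong) (auto simp: indicator_def)
    also have "\<dots> = (\<integral>\<^sup>+x. (w x * ennreal (exp (- age x k)) * \<kappa> n x) * ennreal (exp (- (age x (Suc n) - age x k))) \<partial>births)"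
    proof (rule nn_integral_alive)
      show "(\<lambda>x. w x * ennreal (exp (- age x k)) * indicator (undecided x j i) n) \<in> borel_measurable births"
        unfolding indicator_def by measurable
      show "k \<le> Suc n" using n k by auto
      fix x :: "nat \<Rightarrow> 'a birth" and l
      assume gap: "\<And>m. 0 \<le> bgap (x m)" and l: "age x (Suc n) - age x k \<le> l"
      have "age x k \<le> age x (Suc j)" using age_mono[OF gap, of k "Suc j"] k by auto
      then have "run rho R (x(n := set_life (x n) l)) j i
          = run rho R (x(n := set_life (x n) (age x (Suc n) - age x (Suc j)))) j i"
        by (intro run_set_life[OF gap n]) (use l in auto)
      moreover have "w (x(n := set_life (x n) l)) = w x" by (rule w) simp
      ultimately show "w (x(n := set_life (x n) l)) * ennreal (exp (- age (x(n := set_life (x n) l)) k))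
          * indicator (undecided (x(n := set_life (x n) l)) j i) n = w x * ennreal (exp (- age x k)) * \<kappa> n x"
        by (simp add: \<kappa>_def undecided_def)
    qed
    also have "\<dots> = (\<integral>\<^sup>+x. w x * ennreal (exp (- age x (Suc n))) * \<kappa> n x \<partial>births)"
    proof (rule nn_integral_cong)
      fix x :: "nat \<Rightarrow> 'a birth"
      have "ennreal (exp (- age x k)) * ennreal (exp (- (age x (Suc n) - age x k))) = ennreal (exp (- age x (Suc n)))"
        by (simp add: ennreal_mult'[symmetric] mult_exp_exp)
      then show "(w x * ennreal (exp (- age x k)) * \<kappa> n x) * ennreal (exp (- (age x (Suc n) - age x k)))
          = w x * ennreal (exp (- age x (Suc n))) * \<kappa> n x"
        by (metis mult.assoc mult.commute)
    qed
    finally show ?thesis .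
  qed
  have "(\<integral>\<^sup>+x. w x * ennreal (exp (- age x j)) * indicator (undecided x j i \<inter> alive x j) n \<partial>births)
    = (\<integral>\<^sup>+x. w x * ennreal (exp (- age x (Suc j))) * indicator (undecided x j i \<inter> alive x (Suc j)) n \<partial>births)" for n
  proof (cases "j \<le> n")
    case False
    then have "n \<notin> undecided x j i" for x using undecided_subset[of x j i] by auto
    then show ?thesis by simp
  qed (simp add: *)
  then show ?thesis
    by (subst (1 2) nn_integral_count) simp_all
qed

text \<open>At the start every birth from \<open>k\<close> on is undecided, and birth
  \<open>n\<close> survives until time 0 with probability
  \<open>exp (- age x (Suc n))\<close>.\<close>

lemma initial_count:
  assumes [measurable]: "w \<in> borel_measurable births"
    and w: "\<And>x y :: nat \<Rightarrow> 'a birth. (\<And>n. bgap (x n) = bgap (y n)) \<Longrightarrow> w x = w y"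
  shows "(\<integral>\<^sup>+x. w x * ennreal (exp (- age x k)) * count_nat (undecided x k 0 \<inter> alive x k) \<partial>births)
    = (\<integral>\<^sup>+x. w x * (\<Sum>n. indicator {k..} n * ennreal (exp (- age x (Suc n)))) \<partial>births)"
proof -
  have "(\<integral>\<^sup>+x. w x * ennreal (exp (- age x k)) * indicator (undecided x k 0 \<inter> alive x k) n \<partial>births)
    = (\<integral>\<^sup>+x. w x * (indicator {k..} n * ennreal (exp (- age x (Suc n)))) \<partial>births)" for n
  proof (cases "k \<le> n")
    case False
    then have "n \<notin> undecided x k 0" for x using undecided_subset[of x k 0] by auto
    then show ?thesis using False by simp
  next
    case True
    have "(\<integral>\<^sup>+x. w x * ennreal (exp (- age x k)) * indicator (undecided x k 0 \<inter> alive x k) n \<partial>births)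
        = (\<integral>\<^sup>+x. w x * ennreal (exp (- age x k)) * indicator (alive x k) n \<partial>births)"
      using True by (intro nn_integral_cong) (auto simp: indicator_def undecided_def)
    also have "\<dots> = (\<integral>\<^sup>+x. w x * ennreal (exp (- age x k)) * ennreal (exp (- (age x (Suc n) - age x k))) \<partial>births)"
    proof (rule nn_integral_alive)
      fix x :: "nat \<Rightarrow> 'a birth" and l
      have "w (x(n := set_life (x n) l)) = w x" by (rule w) simp
      then show "w (x(n := set_life (x n) l)) * ennreal (exp (- age (x(n := set_life (x n) l)) k))
        = w x * ennreal (exp (- age x k))" by simp
    qed (use True in auto)
    also have "\<dots> = (\<integral>\<^sup>+x. w x * (indicator {k..} n * ennreal (exp (- age x (Suc n)))) \<partial>births)"
      using True by (intro nn_integral_cong) (simp add: mult.assoc ennreal_mult'[symmetric] mult_exp_exp)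
    finally show ?thesis .
  qed
  then show ?thesis
    by (subst nn_integral_count) (simp_all add: nn_integral_suminf[symmetric])
qed

section \<open>The expected effect of a single birth\<close>

definition ball_sup :: real where
  "ball_sup = (SUP v\<in>space lam. measure lam {w \<in> space lam. rho v w \<le> R})"

text \<open>The \<open>c\<close> of the overview: it bounds the probability that a given living
  point blocks a new birth, which must fall into the ball around that point and carry a mark 0 for
  it.\<close>

definition block_rate :: real where
  "block_rate = (1 - beta2) * ball_sup / measure lam (space lam)"

lemma nn_integral_mark: "(\<integral>\<^sup>+k. indicator {k. \<not> k n} k \<partial>mark_law) = ennreal (1 - beta2)"
proof -
  interpret m: product_prob_space "\<lambda>_. measure_pmf (bernoulli_pmf beta2)" "UNIV :: nat set"
    by unfold_locales
  have "(\<integral>\<^sup>+k. indicator {k. \<not> k n} k \<partial>mark_law) = (\<integral>\<^sup>+k. indicator {False} (k n) \<partial>mark_law)"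
    by (intro nn_integral_cong) (auto simp: indicator_def)
  also have "\<dots> = (\<integral>\<^sup>+b. indicator {False} b \<partial>distr mark_law (measure_pmf (bernoulli_pmf beta2)) (\<lambda>k. k n))"
    by (subst nn_integral_distr) auto
  also have "\<dots> = (\<integral>\<^sup>+b. indicator {False} b \<partial>measure_pmf (bernoulli_pmf beta2))"
    by (subst m.PiM_component) auto
  also have "\<dots> = ennreal (1 - beta2)"
    using beta2_range by (subst nn_integral_bernoulli_pmf) auto
  finally show ?thesis .
qed

lemma ball_bound:
  assumes u: "u \<in> space lam"
  shows "(\<integral>\<^sup>+v. indicator {v. rho v u \<le> R} v \<partial>loc_law) \<le> ennreal (ball_sup / measure lam (space lam))"
proof -
  interpret l: finite_measure lam by (rule finite_lam)
  define A where "A = {w \<in> space lam. rho u w \<le> R}"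
  have [measurable]: "(\<lambda>w. rho u w) \<in> borel_measurable lam"
    using u by (intro rho_measurable') auto
  have A: "A \<in> sets lam" unfolding A_def by measurable
  have "(\<integral>\<^sup>+v. indicator {v. rho v u \<le> R} v \<partial>loc_law) = (\<integral>\<^sup>+v. indicator A v \<partial>loc_law)"
    using u Metric_space.commute[OF metric] by (intro nn_integral_cong) (auto simp: A_def indicator_def)
  also have "\<dots> = emeasure loc_law A" using A by (intro nn_integral_indicator) simp
  also have "\<dots> = ennreal (measure lam A / measure lam (space lam))"
    using A measure_lam_pos
    by (subst emeasure_uniform_measure) (auto simp: l.emeasure_eq_measure divide_ennreal sets.Int_space_eq1)
  also have "\<dots> \<le> ennreal (ball_sup / measure lam (space lam))"
  proof (intro ennreal_leI divide_right_mono)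
    show "measure lam A \<le> ball_sup" unfolding ball_sup_def A_def
      by (rule cSUP_upper[OF u]) (auto intro!: bdd_aboveI[of _ "measure lam (space lam)"] l.bounded_measure)
  qed simp
  finally show ?thesis .
qed

lemma ball_sup_nonneg: "0 \<le> ball_sup"
proof -
  interpret l: finite_measure lam by (rule finite_lam)
  obtain u where u: "u \<in> space lam" using lam_pos by fastforce
  have "measure lam {w \<in> space lam. rho u w \<le> R} \<le> ball_sup" unfolding ball_sup_def
    by (rule cSUP_upper[OF u]) (auto intro!: bdd_aboveI[of _ "measure lam (space lam)"] l.bounded_measure)
  then show ?thesis using measure_nonneg order.trans by blast
qed

lemma block_rate_nonneg: "0 \<le> block_rate"
  using ball_sup_nonneg beta2_range by (simp add: block_rate_def)

text \<open>With the state before birth \<open>j\<close> frozen, its coin is averaged by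
  \<open>update_step_drift\<close>, each mark contributes \<open>1 - beta2\<close>, and the location
  contributes the mass of a ball around the older point. Linearity over the undecided points makes
  independence between different blockers irrelevant.\<close>

lemma nn_integral_drift:
  fixes x :: "nat \<Rightarrow> 'a birth" and a :: ennreal
  assumes x: "\<And>n. bloc (x n) \<in> space lam"
    and p: "pswap = 0 \<and> \<kappa> = 1 \<or> pswap = 1/4 \<and> \<kappa> = 1/2"
    and LU: "L \<subseteq> U" "U \<subseteq> {Suc j..}" and A: "A \<subseteq> {Suc j..}"
  defines "K v k \<equiv> {m \<in> A. rho v (bloc (x m)) \<le> R \<and> \<not> k m}"
  defines "S v z \<equiv> (snd (update_step (snd z) j (K v (fst z)) (L, U))
    - fst (update_step (snd z) j (K v (fst z)) (L, U))) \<inter> insert j A"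
  shows "(\<integral>\<^sup>+v. \<integral>\<^sup>+z. a * count_nat (S v z) \<partial>(mark_law \<Otimes>\<^sub>M coin_law) \<partial>loc_law)
    \<le> a * (ennreal (1 + \<kappa> * block_rate) * count_nat ((U - L) \<inter> A))"
proof -
  have \<kappa>: "0 \<le> \<kappa>" using p by auto
  let ?W = "(U - L) \<inter> A"
  let ?B = "\<lambda>n v. indicator {v. rho v (bloc (x n)) \<le> R} v :: ennreal"
  let ?J = "\<lambda>v. count_nat ?W + ennreal \<kappa> * (\<Sum>n. indicator ?W n * ennreal (1 - beta2) * ?B n v)"
  have z: "(\<integral>\<^sup>+z. a * count_nat (S v z) \<partial>(mark_law \<Otimes>\<^sub>M coin_law)) \<le> a * ?J v" for v
  proof -
    have [measurable]: "(\<lambda>k. k n) \<in> measurable mark_law (count_space UNIV)" for n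
      using measurable_component_singleton[of n "UNIV :: nat set" "\<lambda>_. measure_pmf (bernoulli_pmf beta2)"]
      by (simp cong: measurable_cong_sets)
    have K [measurable]: "Measurable.pred mark_law (\<lambda>k. n \<in> K v k)" for n
      unfolding K_def by measurable
    have K' [measurable]: "Measurable.pred (mark_law \<Otimes>\<^sub>M coin_law) (\<lambda>z. n \<in> K v (fst z))" for n
      using measurable_compose[OF measurable_fst K] by simp
    have [measurable]: "Measurable.pred (mark_law \<Otimes>\<^sub>M coin_law) snd"
      using measurable_snd[of mark_law coin_law] by (simp cong: measurable_cong_sets)
    have "Measurable.pred (mark_law \<Otimes>\<^sub>M coin_law) (\<lambda>z. n \<in> S v z)" for n
    proof -
      note update_step_measurable[where A = "mark_law \<Otimes>\<^sub>M coin_law" and c = snd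
        and K = "\<lambda>z. K v (fst z)" and LU = "\<lambda>_. (L, U)" and j = j, simplified, measurable]
      show ?thesis unfolding S_def by measurable
    qed
    then have S [measurable]: "(\<lambda>z. count_nat (S v z)) \<in> borel_measurable (mark_law \<Otimes>\<^sub>M coin_law)"
      by (rule count_measurable)
    have ind: "(\<integral>\<^sup>+k. indicator ((U - L) \<inter> K v k) n \<partial>mark_law)
        = indicator ?W n * ennreal (1 - beta2) * ?B n v" for n
    proof -
      have "(\<integral>\<^sup>+k. indicator ((U - L) \<inter> K v k) n \<partial>mark_law)
        = (\<integral>\<^sup>+k. (indicator ?W n * ?B n v) * indicator {k. \<not> k n} k \<partial>mark_law)"
        by (intro nn_integral_cong) (auto simp: indicator_def K_def)
      also have "\<dots> = (indicator ?W n * ?B n v) * (\<integral>\<^sup>+k. indicator {k. \<not> k n} k \<partial>mark_law)"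
        by (rule nn_integral_cmult) (unfold indicator_def mem_Collect_eq, measurable)
      finally show ?thesis by (simp add: nn_integral_mark mult.assoc mult.commute mult.left_commute)
    qed
    have "(\<integral>\<^sup>+z. count_nat (S v z) \<partial>(mark_law \<Otimes>\<^sub>M coin_law))
      = (\<integral>\<^sup>+k. \<integral>\<^sup>+c. count_nat (S v (k, c)) \<partial>coin_law \<partial>mark_law)"
      by (rule measure_pmf.nn_integral_fst[OF S, symmetric])
    also have "\<dots> \<le> (\<integral>\<^sup>+k. count_nat ?W + ennreal \<kappa> * count_nat ((U - L) \<inter> K v k) \<partial>mark_law)"
    proof (rule nn_integral_mono)
      fix k
      have "(\<integral>\<^sup>+c. count_nat (S v (k, c)) \<partial>coin_law)
        = count_nat (S v (k, True)) * ennreal pswap + count_nat (S v (k, False)) * ennreal (1 - pswap)"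
        using pswap_range by (subst nn_integral_bernoulli_pmf) auto
      also have "\<dots> \<le> count_nat ?W + ennreal \<kappa> * count_nat ((U - L) \<inter> K v k)"
        unfolding S_def fst_conv snd_conv
        by (rule update_step_drift) (use LU A p in \<open>auto simp: K_def\<close>)
      finally show "(\<integral>\<^sup>+c. count_nat (S v (k, c)) \<partial>coin_law)
        \<le> count_nat ?W + ennreal \<kappa> * count_nat ((U - L) \<inter> K v k)" .
    qed
    also have "\<dots> = count_nat ?W + ennreal \<kappa> * (\<integral>\<^sup>+k. count_nat ((U - L) \<inter> K v k) \<partial>mark_law)"
      by (subst nn_integral_add) (auto simp: nn_integral_cmult integral_const_simps simp del: nn_integral_const)
    also have "(\<integral>\<^sup>+k. count_nat ((U - L) \<inter> K v k) \<partial>mark_law)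
        = (\<Sum>n. \<integral>\<^sup>+k. indicator ((U - L) \<inter> K v k) n \<partial>mark_law)"
      unfolding count_nat_suminf indicator_def by (rule nn_integral_suminf) measurable
    also have "\<dots> = (\<Sum>n. indicator ?W n * ennreal (1 - beta2) * ?B n v)" by (simp only: ind)
    finally show ?thesis by (simp add: nn_integral_cmult mult_left_mono)
  qed
  have [measurable]: "?B n \<in> borel_measurable loc_law" for n
  proof -
    have [measurable]: "(\<lambda>v. rho v (bloc (x n))) \<in> borel_measurable lam"
      using x by (intro rho_measurable') auto
    have "?B n \<in> borel_measurable lam" unfolding indicator_def mem_Collect_eq by measurable
    then show ?thesis by simp
  qed
  have "(\<integral>\<^sup>+v. \<integral>\<^sup>+z. a * count_nat (S v z) \<partial>(mark_law \<Otimes>\<^sub>M coin_law) \<partial>loc_law)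
    \<le> (\<integral>\<^sup>+v. a * ?J v \<partial>loc_law)" by (intro nn_integral_mono z)
  also have "\<dots> = a * (count_nat ?W + ennreal \<kappa> * (\<Sum>n. indicator ?W n * ennreal (1 - beta2) * (\<integral>\<^sup>+v. ?B n v \<partial>loc_law)))"
    by (simp add: nn_integral_cmult nn_integral_add nn_integral_suminf integral_const_simps del: nn_integral_const)
  also have "\<dots> \<le> a * (count_nat ?W + ennreal \<kappa> * (\<Sum>n. indicator ?W n * ennreal (1 - beta2)
      * ennreal (ball_sup / measure lam (space lam))))"
    by (intro mult_left_mono add_left_mono suminf_le ball_bound x) auto
  also have "\<dots> = a * (count_nat ?W + ennreal \<kappa> * (count_nat ?W * ennreal block_rate))"
  proof -
    have "ennreal (1 - beta2) * ennreal (ball_sup / measure lam (space lam)) = ennreal block_rate"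
      using beta2_range by (simp add: block_rate_def ennreal_mult'[symmetric])
    then show ?thesis by (simp add: count_nat_suminf mult.assoc)
  qed
  also have "\<dots> = a * (ennreal (1 + \<kappa> * block_rate) * count_nat ?W)"
    using \<kappa> block_rate_nonneg
    by (simp add: ennreal_mult' algebra_simps)
  finally show ?thesis .
qed

text \<open>Birth \<open>j\<close> is resampled with all other births fixed. Neither the run from
  \<open>Suc j\<close> nor the survival of older points up to birth \<open>j\<close> involves it,
  and \<open>w\<close> sees only its gap, so location, marks and coin can be averaged out.\<close>

lemma undecided_drift:
  assumes [measurable]: "w \<in> borel_measurable births"
    and w: "\<And>x y :: nat \<Rightarrow> 'a birth. (\<And>n. bgap (x n) = bgap (y n)) \<Longrightarrow> w x = w y"
    and p: "pswap = 0 \<and> \<kappa> = 1 \<or> pswap = 1/4 \<and> \<kappa> = 1/2"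
  shows "(\<integral>\<^sup>+x. w x * count_nat (undecided x j (Suc i) \<inter> alive x (Suc j)) \<partial>births)
    \<le> ennreal (1 + \<kappa> * block_rate)
       * (\<integral>\<^sup>+x. w x * count_nat (undecided x (Suc j) i \<inter> alive x (Suc j)) \<partial>births)"
proof -
  define C where "C = ennreal (1 + \<kappa> * block_rate)"
  define F where "F x = w x * count_nat (undecided x j (Suc i) \<inter> alive x (Suc j))" for x
  define H where "H x = C * (w x * count_nat (undecided x (Suc j) i \<inter> alive x (Suc j)))" for x
  have F [measurable]: "F \<in> borel_measurable births" and H [measurable]: "H \<in> borel_measurable births"
    unfolding F_def[abs_def] H_def[abs_def] by measurable
  have "(\<integral>\<^sup>+x. F x \<partial>births) = (\<integral>\<^sup>+x. \<integral>\<^sup>+y. F (x(j := y)) \<partial>one_birth \<partial>births)"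
    by (rule nn_integral_resample[OF prob_space_one_birth F])
  also have "\<dots> \<le> (\<integral>\<^sup>+x. \<integral>\<^sup>+y. H (x(j := y)) \<partial>one_birth \<partial>births)"
  proof (rule nn_integral_mono)
    fix x assume x: "x \<in> space births"
    have bloc: "bloc (x n) \<in> space lam" for n
    proof -
      have "x n \<in> space one_birth" using x by (auto simp: space_PiM)
      then show ?thesis by (rule measurable_space[OF birth_components_measurable(2)])
    qed
    define A where "A = alive x (Suc j) \<inter> {Suc j..}"
    define L where "L = fst (run rho R x (Suc j) i)"
    define U where "U = snd (run rho R x (Suc j) i)"
    define K where "K v k = {m \<in> A. rho v (bloc (x m)) \<le> R \<and> \<not> k m}" for v k
    define S where "S v z = (snd (update_step (snd z) j (K v (fst z)) (L, U))
      - fst (update_step (snd z) j (K v (fst z)) (L, U))) \<inter> insert j A" for v z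
    \<comment> \<open>\<open>w\<close> reads only gaps, so the other components of birth
      \<open>j\<close> may be left \<open>undefined\<close>.\<close>
    define a where "a g = w (x(j := (g, undefined)))" for g
    have LU: "L \<subseteq> U" "U \<subseteq> {Suc j..}" by (auto simp: L_def U_def run_nested run_subset)
    have wa: "w (x(j := (g, v, l, z))) = a g" for g v l z
      unfolding a_def by (rule w) (simp add: bgap_def)
    have later: "run rho R (x(j := y)) (Suc j) i = (L, U)" for y
      unfolding L_def U_def prod.collapse by (rule run_cong_later) simp
    have alive: "n \<in> alive (x(j := y)) (Suc j) \<longleftrightarrow> n \<in> alive x (Suc j)" if "Suc j \<le> n" for n y
      using that by (intro alive_cong) auto
    have Hz: "H (x(j := (g, v, l, z))) = a g * (C * count_nat ((U - L) \<inter> A))" for g v l z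
    proof -
      have "undecided (x(j := y)) (Suc j) i \<inter> alive (x(j := y)) (Suc j) = (U - L) \<inter> A" for y
      proof -
        have "n \<in> alive (x(j := y)) (Suc j) \<longleftrightarrow> n \<in> alive x (Suc j)" if "n \<in> U" for n
          using that LU by (intro alive) auto
        then show ?thesis using LU unfolding undecided_def later A_def fst_conv snd_conv by blast
      qed
      then show ?thesis by (simp add: H_def wa mult.left_commute)
    qed
    \<comment> \<open>Only an inequality, because \<open>S\<close> keeps \<open>j\<close> without
      checking its lifetime; in return the bound does not depend on that lifetime.\<close>
    have Fz: "F (x(j := (g, v, l, z))) \<le> a g * count_nat (S v z)" for g v l z
    proof -
      let ?y = "(g, v, l, z)"
      have alive': "n \<in> alive (x(j := ?y)) (Suc j) \<longleftrightarrow> n \<in> alive x (Suc j)" if "Suc j \<le> n" for n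
        by (rule alive[OF that])
      have K: "blocking rho R (x(j := ?y)) j = K v (fst z)"
        using alive' by (auto simp: blocking_def K_def A_def Suc_le_eq) (auto simp: birth_simps)
      have "undecided (x(j := ?y)) j (Suc i) \<inter> alive (x(j := ?y)) (Suc j) \<subseteq> S v z"
      proof -
        have "bcoin ((x(j := ?y)) j) = snd z" by (simp add: bcoin_def)
        then have "undecided (x(j := ?y)) j (Suc i) = snd (update_step (snd z) j (K v (fst z)) (L, U))
          - fst (update_step (snd z) j (K v (fst z)) (L, U))"
          unfolding undecided_def run.simps later K by simp
        moreover have "n \<in> insert j A" if n: "n \<in> undecided (x(j := ?y)) j (Suc i)" "n \<in> alive (x(j := ?y)) (Suc j)" for n
        proof (cases "n = j")
          case False
          have "j \<le> n" using n(1) undecided_subset[of "x(j := ?y)" j "Suc i"] by auto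
          with False have "Suc j \<le> n" by simp
          then show ?thesis using n(2) alive'[of n] by (simp add: A_def)
        qed simp
        ultimately show ?thesis unfolding S_def by blast
      qed
      then show ?thesis by (simp add: F_def wa mult_left_mono count_nat_mono)
    qed
    have "(\<integral>\<^sup>+y. F (x(j := y)) \<partial>one_birth)
      \<le> (\<integral>\<^sup>+g. \<integral>\<^sup>+v. \<integral>\<^sup>+l. \<integral>\<^sup>+z. a g * count_nat (S v z) \<partial>(mark_law \<Otimes>\<^sub>M coin_law) \<partial>life_law \<partial>loc_law \<partial>gap_law)"
      unfolding nn_integral_one_birth[OF borel_measurable_upd[OF x F]] by (intro nn_integral_mono Fz)
    also have "\<dots> = (\<integral>\<^sup>+g. \<integral>\<^sup>+v. \<integral>\<^sup>+z. a g * count_nat (S v z) \<partial>(mark_law \<Otimes>\<^sub>M coin_law) \<partial>loc_law \<partial>gap_law)"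
      by (simp add: integral_const_simps del: nn_integral_const)
    also have "\<dots> \<le> (\<integral>\<^sup>+g. a g * (C * count_nat ((U - L) \<inter> A)) \<partial>gap_law)"
      unfolding C_def S_def K_def
      by (intro nn_integral_mono nn_integral_drift bloc p LU) (auto simp: A_def)
    also have "\<dots> = (\<integral>\<^sup>+y. H (x(j := y)) \<partial>one_birth)"
      unfolding nn_integral_one_birth[OF borel_measurable_upd[OF x H]] Hz by (simp add: integral_const_simps del: nn_integral_const)
    finally show "(\<integral>\<^sup>+y. F (x(j := y)) \<partial>one_birth) \<le> (\<integral>\<^sup>+y. H (x(j := y)) \<partial>one_birth)" .
  qed
  also have "\<dots> = (\<integral>\<^sup>+x. H x \<partial>births)"
    by (rule nn_integral_resample[OF prob_space_one_birth H, symmetric])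
  also have "\<dots> = C * (\<integral>\<^sup>+x. w x * count_nat (undecided x (Suc j) i \<inter> alive x (Suc j)) \<partial>births)"
    unfolding H_def by (rule nn_integral_cmult) measurable
  finally show ?thesis by (simp add: F_def C_def)
qed

text \<open>Memorylessness crosses a gap at no cost and the drift crosses a birth at the cost of one
  factor. Alternating the two \<open>k\<close> times leads from birth 0 back to the uninformed
  start.\<close>

lemma undecided_bound:
  assumes [measurable]: "w \<in> borel_measurable births"
    and w: "\<And>x y :: nat \<Rightarrow> 'a birth. (\<And>n. bgap (x n) = bgap (y n)) \<Longrightarrow> w x = w y"
    and p: "pswap = 0 \<and> \<kappa> = 1 \<or> pswap = 1/4 \<and> \<kappa> = 1/2"
  shows "(\<integral>\<^sup>+x. w x * count_nat (undecided x 0 k \<inter> alive x 0) \<partial>births)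
    \<le> ennreal (1 + \<kappa> * block_rate) ^ k
       * (\<integral>\<^sup>+x. w x * (\<Sum>n. indicator {k..} n * ennreal (exp (- age x (Suc n)))) \<partial>births)"
proof -
  define b where "b j i = (\<integral>\<^sup>+x. w x * ennreal (exp (- age x j)) * count_nat (undecided x j i \<inter> alive x j) \<partial>births)" for j i
  let ?C = "ennreal (1 + \<kappa> * block_rate)"
  have step: "b j (Suc i) \<le> ?C * b (Suc j) i" for j i
  proof -
    have "b j (Suc i) = (\<integral>\<^sup>+x. w x * ennreal (exp (- age x (Suc j))) * count_nat (undecided x j (Suc i) \<inter> alive x (Suc j)) \<partial>births)"
      unfolding b_def by (rule undecided_memoryless[OF assms(1) w])
    also have "\<dots> \<le> ?C * b (Suc j) i" unfolding b_def
    proof (rule undecided_drift[OF _ _ p])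
      fix x y :: "nat \<Rightarrow> 'a birth"
      assume *: "\<And>n. bgap (x n) = bgap (y n)"
      then have "age x (Suc j) = age y (Suc j)" by (simp add: age_def)
      then show "w x * ennreal (exp (- age x (Suc j))) = w y * ennreal (exp (- age y (Suc j)))"
        using w[of x y] * by simp
    qed measurable
    finally show ?thesis .
  qed
  have "b j i \<le> ?C ^ i * b (j + i) 0" for i j
  proof (induction i arbitrary: j)
    case (Suc i)
    have "b j (Suc i) \<le> ?C * b (Suc j) i" by (rule step)
    also have "\<dots> \<le> ?C * (?C ^ i * b (Suc j + i) 0)" by (intro mult_left_mono Suc.IH) simp
    finally show ?case by (simp add: mult.assoc)
  qed simp
  from this[of 0 k] show ?thesis
    using initial_count[OF assms(1) w] by (simp add: b_def age_def[of _ 0])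
qed

end

section \<open>Exponential moments of the event counts\<close>

text \<open>\<open>0.68\<close> is the value for which \<open>ln 2 / 2 - 1/4 \<ge> 0.09\<close>. It
  follows from \<open>exp (- 0.01) \<ge> 0.99\<close> and
  \<open>0.99 ^ 68 \<ge> 1/2\<close>.\<close>

lemma ln_2_ge: "0.68 \<le> ln (2::real)"
proof -
  have "1/2 \<le> (99/100 :: real) ^ 68" by (simp add: power_divide)
  also have "\<dots> \<le> exp (- 0.01) ^ 68"
    using exp_ge_add_one_self[of "- 0.01 :: real"] by (intro power_mono) auto
  also have "\<dots> = exp (- 0.68 :: real)" by (simp flip: exp_of_nat_mult)
  finally have "exp (0.68 :: real) \<le> 2" by (simp add: exp_minus field_simps)
  then show ?thesis by (subst ln_ge_iff) simp_all
qed

text \<open>The conditions at infinity for the three renewal solutions: births, deaths and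
  discounted births, in this order.\<close>

lemma exp_decay_limits:
  fixes c t :: real
  assumes "0 < c"
  shows "((\<lambda>u. exp (- c * u) * 1) \<longlongrightarrow> 0) at_top"
    and "((\<lambda>u. exp (- c * u) * exp (c * (exp (t - u) - exp (- u)))) \<longlongrightarrow> 0) at_top"
    and "((\<lambda>u. exp (- c * u) * (c * exp (- u))) \<longlongrightarrow> 0) at_top"
proof -
  show *: "((\<lambda>u. exp (- c * u) * 1) \<longlongrightarrow> 0) at_top" using assms by real_asymp
  show "((\<lambda>u. exp (- c * u) * exp (c * (exp (t - u) - exp (- u)))) \<longlongrightarrow> 0) at_top"
    using assms by real_asymp
  have "((\<lambda>u::real. exp (- u)) \<longlongrightarrow> 0) at_top" by real_asymp
  from tendsto_mult[OF * tendsto_mult[OF tendsto_const this]]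
  show "((\<lambda>u. exp (- c * u) * (c * exp (- u))) \<longlongrightarrow> 0) at_top" by simp
qed

lemma nn_integral_exponential_tail_le:
  "(\<integral>\<^sup>+l. indicator {l. a \<le> l} l \<partial>density lborel (exponential_density 1)) \<le> ennreal (exp (- a))"
proof (cases "0 \<le> a")
  case True
  then show ?thesis using nn_integral_exponential_tail by simp
next
  case False
  interpret prob_space "density lborel (exponential_density 1)"
    by (rule prob_space_exponential_density) simp
  have "(\<integral>\<^sup>+l. indicator {l. a \<le> l} l \<partial>density lborel (exponential_density 1)) \<le>
      (\<integral>\<^sup>+l. 1 \<partial>density lborel (exponential_density 1))"
    by (intro nn_integral_mono) (simp add: indicator_def)
  also have "\<dots> = ennreal 1" by (simp add: nn_integral_const_prob prob_space_axioms del: nn_integral_const)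
  also have "\<dots> \<le> ennreal (exp (- a))" using False by (intro ennreal_leI) simp
  finally show ?thesis .
qed

context bounding_process
begin

lemma renewal_births_bound:
  fixes G :: "real \<Rightarrow> ennreal"
  assumes "(\<lambda>(u, y). f u y) \<in> borel_measurable (borel \<Otimes>\<^sub>M one_birth)"
    and "(\<lambda>(u, y). h u y) \<in> borel_measurable (borel \<Otimes>\<^sub>M one_birth)"
    and "G \<in> borel_measurable borel"
    and "\<And>s. 0 \<le> s \<Longrightarrow>
      (\<integral>\<^sup>+y. h (s + bgap y) y + f (s + bgap y) y * G (s + bgap y) \<partial>one_birth) \<le> G s"
    and "\<And>s. 0 \<le> s \<Longrightarrow> e \<le> G s"
  shows "(\<integral>\<^sup>+x. (\<Sum>n<m. (\<Prod>i<n. f (age x (Suc i)) (x i)) * h (age x (Suc n)) (x n))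
    + (\<Prod>i<m. f (age x (Suc i)) (x i)) * e \<partial>births) \<le> G 0"
proof -
  interpret S: sequence_space one_birth by (rule sequence_space_births)
  have "AE y in one_birth. 0 \<le> bgap y"
    using AE_bgap_pos by (rule eventually_mono) simp
  from S.renewal_bound[OF birth_components_measurable(1) this assms, of 0 m]
  show ?thesis by (simp add: renewal_eq age_def)
qed

text \<open>Beyond age \<open>s < t\<close>, the number of births in the window is Poisson with mean
  \<open>rate * (t - s)\<close>, and its mean of \<open>2^X\<close> is the function
  \<open>G1\<close>; beyond \<open>t\<close> there are none.\<close>

lemma births_exponential_moment:
  assumes t: "0 < t"
  shows "(\<integral>\<^sup>+x. (\<Prod>i<m. if age x (Suc i) < t then 2 else 1) \<partial>births) \<le> ennreal (exp (rate * t))"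
proof -
  define G1 where "G1 u = exp (rate * (t - u))" for u
  define G where "G s = ennreal (if s < t then G1 s else 1)" for s
  have [measurable]: "G1 \<in> borel_measurable borel" "G \<in> borel_measurable borel"
    unfolding G1_def[abs_def] G_def[abs_def] by measurable
  have "(\<integral>\<^sup>+x. (\<Sum>n<m. (\<Prod>i<n. if age x (Suc i) < t then 2 else 1) * 0)
    + (\<Prod>i<m. if age x (Suc i) < t then 2 else 1) * 1 \<partial>births) \<le> G 0"
  proof (rule renewal_births_bound)
    fix s :: real assume "0 \<le> s"
    have "(\<integral>\<^sup>+y. 0 + (if s + bgap y < t then 2 else 1) * G (s + bgap y) \<partial>one_birth)
      = (\<integral>\<^sup>+g. 0 + (if s + g < t then 2 else 1) * G (s + g) \<partial>gap_law)"
      by (rule nn_integral_gap) measurable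
    also have "\<dots> = (\<integral>\<^sup>+g. (if s + g < t then ennreal (2 * G1 (s + g)) else ennreal 1) \<partial>gap_law)"
      by (intro nn_integral_cong) (simp add: G_def ennreal_mult')
    also have "\<dots> = ennreal (if s < t then G1 s else 1)"
    proof (rule nn_integral_exponential_two_pieces[where ?k1.0 = "\<lambda>u. 2 * G1 u" and ?k2.0 = "\<lambda>_. 1" and ?G2.0 = "\<lambda>_. 1"])
      show "0 < rate" by (rule rate_pos)
      show "(G1 has_real_derivative rate * (G1 u - 2 * G1 u)) (at u)" for u
        unfolding G1_def[abs_def] by (auto intro!: derivative_eq_intros)
      show "((\<lambda>u. exp (- rate * u) * 1) \<longlongrightarrow> 0) at_top"
        by (rule exp_decay_limits[OF rate_pos])
    qed (auto simp: G1_def intro!: derivative_eq_intros)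
    finally show "(\<integral>\<^sup>+y. 0 + (if s + bgap y < t then 2 else 1) * G (s + bgap y) \<partial>one_birth) \<le> G s"
      by (simp add: G_def)
    show "1 \<le> G s" using rate_pos by (auto simp: G_def G1_def)
  qed (auto, measurable)
  then show ?thesis using t by (simp add: G_def G1_def)
qed

text \<open>A birth of age \<open>u\<close> dies in the window with probability \<open>q1 u\<close>
  if \<open>u < t\<close> and \<open>q2 u\<close> otherwise. Thinning makes the deaths of births
  older than \<open>s\<close> Poisson, with mean \<open>rate\<close> times the integral of this
  probability over \<open>u > s\<close>. That integral is \<open>t - s + q1 s\<close> for
  \<open>s < t\<close> and \<open>q2 s\<close> afterwards, whence \<open>G1\<close> and
  \<open>G2\<close>; at \<open>s = 0\<close> it is \<open>t\<close>.\<close>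

lemma deaths_exponential_moment:
  assumes t: "0 < t"
  shows "(\<integral>\<^sup>+x. (\<Prod>i<m. if age x (Suc i) - t < blife (x i) \<and> blife (x i) < age x (Suc i) then 2 else 1) \<partial>births)
    \<le> ennreal (exp (rate * t))"
proof -
  define q1 where "q1 u = 1 - exp (- u)" for u :: real
  define q2 where "q2 u = exp (t - u) - exp (- u)" for u :: real
  define G1 where "G1 u = exp (rate * (t - u + q1 u))" for u
  define G2 where "G2 u = exp (rate * q2 u)" for u
  define G where "G s = ennreal (if s < t then G1 s else G2 s)" for s
  let ?f = "\<lambda>(u::real) (y::'a birth). if u - t < blife y \<and> blife y < u then 2 else (1::ennreal)"
  have [measurable]: "G1 \<in> borel_measurable borel" "G2 \<in> borel_measurable borel" "G \<in> borel_measurable borel"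
    "q1 \<in> borel_measurable borel" "q2 \<in> borel_measurable borel"
    unfolding G1_def[abs_def] G2_def[abs_def] G_def[abs_def] q1_def[abs_def] q2_def[abs_def] by measurable
  have q1: "0 \<le> q1 u" if "0 \<le> u" for u using that by (simp add: q1_def)
  have q2: "0 \<le> q2 u" for u using t by (simp add: q2_def)
  have life: "(\<integral>\<^sup>+l. (if u - t < l \<and> l < u then 2 else 1) \<partial>life_law)
    \<le> ennreal (1 + (if u < t then q1 u else q2 u))" if u: "0 \<le> u" for u
  proof -
    define I where "I = (\<integral>\<^sup>+l. indicator {u - t<..<u} l \<partial>life_law)"
    \<comment> \<open>Lifetimes are positive, so the lower end of the interval is cut at 0, which
      treats both ranges of \<open>u\<close> at once.\<close>
    define b where "b = max 0 (u - t)"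
    have "I + ennreal (exp (- u)) = (\<integral>\<^sup>+l. indicator {u - t<..<u} l + indicator {l. u \<le> l} l \<partial>life_law)"
      unfolding I_def using nn_integral_exponential_tail[OF u] by (subst nn_integral_add) auto
    also have "\<dots> \<le> (\<integral>\<^sup>+l. indicator {l. b \<le> l} l \<partial>life_law)"
      using AE_exponential_pos[of 1] t u
      by (intro nn_integral_mono_AE) (auto elim!: eventually_mono simp: indicator_def b_def)
    also have "\<dots> = ennreal (exp (- b))" by (rule nn_integral_exponential_tail) (simp add: b_def)
    finally have "I + ennreal (exp (- u)) - ennreal (exp (- u)) \<le> ennreal (exp (- b)) - ennreal (exp (- u))"
      by (rule ennreal_minus_mono) simp
    then have "I \<le> ennreal (exp (- b) - exp (- u))"
      by (simp add: ennreal_minus)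
    also have "exp (- b) - exp (- u) = (if u < t then q1 u else q2 u)"
      by (auto simp: b_def q1_def q2_def)
    finally have I: "I \<le> ennreal (if u < t then q1 u else q2 u)" .
    have "(\<integral>\<^sup>+l. (if u - t < l \<and> l < u then 2 else 1) \<partial>life_law)
      = (\<integral>\<^sup>+l. 1 + indicator {u - t<..<u} l \<partial>life_law)"
      by (intro nn_integral_cong) (auto simp: indicator_def one_add_one)
    also have "\<dots> = 1 + I"
      unfolding I_def by (subst nn_integral_add) (auto simp: integral_const_simps simp del: nn_integral_const)
    also have "\<dots> \<le> 1 + ennreal (if u < t then q1 u else q2 u)" by (intro add_left_mono I)
    also have "\<dots> = ennreal (1 + (if u < t then q1 u else q2 u))"
      using q1[OF u] q2[of u] by simp
    finally show ?thesis .
  qed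
  have "(\<integral>\<^sup>+x. (\<Sum>n<m. (\<Prod>i<n. ?f (age x (Suc i)) (x i)) * 0)
    + (\<Prod>i<m. ?f (age x (Suc i)) (x i)) * 1 \<partial>births) \<le> G 0"
  proof (rule renewal_births_bound)
    fix s :: real assume s: "0 \<le> s"
    have "(\<integral>\<^sup>+y. 0 + ?f (s + bgap y) y * G (s + bgap y) \<partial>one_birth)
      = (\<integral>\<^sup>+g. \<integral>\<^sup>+l. 0 + (if s + g - t < l \<and> l < s + g then 2 else 1) * G (s + g) \<partial>life_law \<partial>gap_law)"
      by (rule nn_integral_gap_life) measurable
    also have "\<dots> = (\<integral>\<^sup>+g. (\<integral>\<^sup>+l. (if s + g - t < l \<and> l < s + g then 2 else 1) \<partial>life_law) * G (s + g) \<partial>gap_law)"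
      by (intro nn_integral_cong) (simp add: nn_integral_multc)
    also have "\<dots> \<le> (\<integral>\<^sup>+g. (if s + g < t then ennreal ((1 + q1 (s + g)) * G1 (s + g))
        else ennreal ((1 + q2 (s + g)) * G2 (s + g))) \<partial>gap_law)"
    proof (rule nn_integral_mono_AE, use AE_exponential_pos[OF rate_pos] in eventually_elim)
      fix g :: real assume "0 < g"
      then have "(\<integral>\<^sup>+l. (if s + g - t < l \<and> l < s + g then 2 else 1) \<partial>life_law) * G (s + g)
        \<le> ennreal (1 + (if s + g < t then q1 (s + g) else q2 (s + g))) * G (s + g)"
        using s by (intro mult_right_mono life) auto
      also have "\<dots> = (if s + g < t then ennreal ((1 + q1 (s + g)) * G1 (s + g))
        else ennreal ((1 + q2 (s + g)) * G2 (s + g)))"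
        by (auto simp: G_def G1_def G2_def ennreal_mult''[symmetric])
      finally show "(\<integral>\<^sup>+l. (if s + g - t < l \<and> l < s + g then 2 else 1) \<partial>life_law) * G (s + g) \<le> \<dots>" .
    qed
    also have "\<dots> = ennreal (if s < t then G1 s else G2 s)"
    proof (rule nn_integral_exponential_two_pieces[where ?k1.0 = "\<lambda>u. (1 + q1 u) * G1 u" and ?k2.0 = "\<lambda>u. (1 + q2 u) * G2 u"])
      show "0 < rate" by (rule rate_pos)
      show "(G1 has_real_derivative rate * (G1 u - (1 + q1 u) * G1 u)) (at u)" for u
        unfolding G1_def[abs_def] q1_def by (auto intro!: derivative_eq_intros simp: algebra_simps)
      show "(G2 has_real_derivative rate * (G2 u - (1 + q2 u) * G2 u)) (at u)" for u
        unfolding G2_def[abs_def] q2_def by (auto intro!: derivative_eq_intros simp: algebra_simps)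
      show "((\<lambda>u. exp (- rate * u) * G2 u) \<longlongrightarrow> 0) at_top"
        unfolding G2_def q2_def by (rule exp_decay_limits[OF rate_pos])
      show "0 \<le> (1 + q1 u) * G1 u" if "s \<le> u" for u
        using q1[of u] s that by (simp add: G1_def)
      show "0 \<le> (1 + q2 u) * G2 u" for u
        using q2[of u] by (simp add: G2_def)
    qed (auto simp: G1_def G2_def q1_def q2_def)
    finally show "(\<integral>\<^sup>+y. 0 + ?f (s + bgap y) y * G (s + bgap y) \<partial>one_birth) \<le> G s"
      by (simp add: G_def)
    show "1 \<le> G s" using rate_pos q1[OF s] q2[of s] by (auto simp: G_def G1_def G2_def)
  qed (auto, measurable)
  then show ?thesis using t by (simp add: G_def G1_def q1_def)
qed

text \<open>Births older than \<open>s \<ge> t\<close> have mean discounted number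
  \<open>rate * exp (- s)\<close>. From \<open>s < t\<close>, the Poisson number of births up to age
  \<open>t\<close> multiplies the value at \<open>t\<close> by the mean of \<open>(1 + c)^X\<close>,
  which is \<open>exp (rate * c * (t - s))\<close>.\<close>

lemma discounted_births_bound:
  assumes t: "0 \<le> t" and c: "0 \<le> c"
  shows "(\<integral>\<^sup>+x. (\<Sum>n. (\<Prod>i<n. if age x (Suc i) < t then ennreal (1 + c) else 1)
      * (if age x (Suc n) < t then 0 else ennreal (exp (- age x (Suc n))))) \<partial>births)
    \<le> ennreal (rate * exp (rate * c * t - t))"
proof -
  define G1 where "G1 u = rate * exp (rate * c * (t - u) - t)" for u
  define G2 where "G2 u = rate * exp (- u)" for u
  define G where "G s = ennreal (if s < t then G1 s else G2 s)" for s
  have [measurable]: "G1 \<in> borel_measurable borel" "G2 \<in> borel_measurable borel" "G \<in> borel_measurable borel"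
    unfolding G1_def[abs_def] G2_def[abs_def] G_def[abs_def] by measurable
  let ?f = "\<lambda>u. if u < t then ennreal (1 + c) else 1"
  let ?h = "\<lambda>u. if u < t then 0 else ennreal (exp (- u))"
  have partial: "(\<integral>\<^sup>+x. (\<Sum>n<m. (\<Prod>i<n. ?f (age x (Suc i))) * ?h (age x (Suc n)))
    + (\<Prod>i<m. ?f (age x (Suc i))) * 0 \<partial>births) \<le> G 0" for m
  proof (rule renewal_births_bound)
    fix s :: real
    have "(\<integral>\<^sup>+y. ?h (s + bgap y) + ?f (s + bgap y) * G (s + bgap y) \<partial>one_birth)
      = (\<integral>\<^sup>+g. ?h (s + g) + ?f (s + g) * G (s + g) \<partial>gap_law)"
      by (rule nn_integral_gap) measurable
    also have "\<dots> = (\<integral>\<^sup>+g. (if s + g < t then ennreal ((1 + c) * G1 (s + g))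
        else ennreal (exp (- (s + g)) + G2 (s + g))) \<partial>gap_law)"
    proof -
      have "0 \<le> G1 u" "0 \<le> G2 u" for u
        using rate_pos by (simp_all add: G1_def G2_def)
      then show ?thesis using c
        by (intro nn_integral_cong) (auto simp: G_def ennreal_mult'[symmetric] ennreal_plus[symmetric] simp del: ennreal_plus)
    qed
    also have "\<dots> = ennreal (if s < t then G1 s else G2 s)"
    proof (rule nn_integral_exponential_two_pieces[where ?k1.0 = "\<lambda>u. (1 + c) * G1 u" and ?k2.0 = "\<lambda>u. exp (- u) + G2 u"])
      show "0 < rate" by (rule rate_pos)
      show "(G1 has_real_derivative rate * (G1 u - (1 + c) * G1 u)) (at u)" for u
        unfolding G1_def[abs_def] by (auto intro!: derivative_eq_intros simp: algebra_simps)
      show "(G2 has_real_derivative rate * (G2 u - (exp (- u) + G2 u))) (at u)" for u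
        unfolding G2_def[abs_def] by (auto intro!: derivative_eq_intros simp: algebra_simps)
      show "((\<lambda>u. exp (- rate * u) * G2 u) \<longlongrightarrow> 0) at_top"
        unfolding G2_def by (rule exp_decay_limits[OF rate_pos])
    qed (use c rate_pos in \<open>auto simp: G1_def G2_def\<close>)
    finally show "(\<integral>\<^sup>+y. ?h (s + bgap y) + ?f (s + bgap y) * G (s + bgap y) \<partial>one_birth) \<le> G s"
      by (simp add: G_def)
  qed (auto, measurable)
  have "(\<integral>\<^sup>+x. (\<Sum>n. (\<Prod>i<n. ?f (age x (Suc i))) * ?h (age x (Suc n))) \<partial>births)
    = (\<Sum>n. \<integral>\<^sup>+x. (\<Prod>i<n. ?f (age x (Suc i))) * ?h (age x (Suc n)) \<partial>births)"
    by (rule nn_integral_suminf) measurable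
  also have "\<dots> \<le> G 0"
  proof (rule suminf_le_const[OF summableI])
    fix m
    have "(\<Sum>n<m. \<integral>\<^sup>+x. (\<Prod>i<n. ?f (age x (Suc i))) * ?h (age x (Suc n)) \<partial>births)
      = (\<integral>\<^sup>+x. (\<Sum>n<m. (\<Prod>i<n. ?f (age x (Suc i))) * ?h (age x (Suc n))) \<partial>births)"
      by (rule nn_integral_sum[symmetric]) measurable
    then show "(\<Sum>n<m. \<integral>\<^sup>+x. (\<Prod>i<n. ?f (age x (Suc i))) * ?h (age x (Suc n)) \<partial>births) \<le> G 0"
      using partial[of m] by simp
  qed
  also have "G 0 = ennreal (rate * exp (rate * c * t - t))"
    using t by (auto simp: G_def G1_def G2_def)
  finally show ?thesis .
qed

text \<open>Markov's inequality for \<open>2^X\<close> at the level \<open>2^(N/2)\<close>. The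
  moment is available for each finite range only; the events increase with \<open>m\<close>, so the
  bound passes to their union.\<close>

lemma chernoff_count:
  fixes A :: "(nat \<Rightarrow> 'a birth) \<Rightarrow> nat \<Rightarrow> bool"
  assumes [measurable]: "\<And>n. Measurable.pred births (\<lambda>x. A x n)"
    and moment: "\<And>m. (\<integral>\<^sup>+x. (\<Prod>i<m. if A x i then 2 else 1) \<partial>births) \<le> ennreal (exp (real N / 4))"
  shows "emeasure births {x \<in> space births. \<exists>m. N \<le> 2 * card {n \<in> {..<m}. A x n}} \<le> ennreal (exp (- 0.09 * real N))"
proof -
  define E where "E m = {x \<in> space births. N \<le> 2 * card {n \<in> {..<m}. A x n}}" for m
  have card: "card {n \<in> {..<m}. A x n} = (\<Sum>n<m. if A x n then 1 else 0)" for m x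
    unfolding card_eq_sum by (intro sum.mono_neutral_cong_left) auto
  have E [measurable]: "E m \<in> sets births" for m unfolding E_def card by measurable
  have "emeasure births {x \<in> space births. \<exists>m. N \<le> 2 * card {n \<in> {..<m}. A x n}} = emeasure births (\<Union>m. E m)"
    by (rule arg_cong[of _ _ "emeasure births"]) (auto simp: E_def)
  also have "\<dots> = (SUP m. emeasure births (E m))"
  proof (rule SUP_emeasure_incseq[symmetric])
    show "incseq E"
    proof (rule incseq_SucI)
      fix m
      have "card {n \<in> {..<m}. A x n} \<le> card {n \<in> {..<Suc m}. A x n}" for x
        by (rule card_mono) auto
      then show "E m \<subseteq> E (Suc m)" unfolding E_def by (fastforce intro: order.trans)
    qed
  qed auto
  also have "\<dots> \<le> ennreal (exp (- 0.09 * real N))"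
  proof (rule SUP_least)
    fix m
    have "emeasure births (E m) = (\<integral>\<^sup>+x. indicator (E m) x \<partial>births)" by simp
    also have "\<dots> \<le> (\<integral>\<^sup>+x. ennreal (exp (- (real N / 2 * ln 2))) * (\<Prod>i<m. if A x i then 2 else 1) \<partial>births)"
    proof (rule nn_integral_mono)
      fix x
      let ?c = "card {n \<in> {..<m}. A x n}"
      have prod: "(\<Prod>i<m. if A x i then 2 else 1) = (2::ennreal) ^ ?c"
        by (simp add: prod.If_cases Int_def)
      have "1 \<le> ennreal (exp (- (real N / 2 * ln 2))) * 2 ^ ?c" if "N \<le> 2 * ?c"
      proof -
        have "real N / 2 * ln 2 \<le> real ?c * ln 2" using that by (intro mult_right_mono) auto
        then have "1 \<le> exp (- (real N / 2 * ln 2)) * exp (real ?c * ln 2)" by (simp add: mult_exp_exp)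
        also have "exp (real ?c * ln 2) = 2 ^ ?c" by (simp add: exp_of_nat_mult)
        finally have "ennreal 1 \<le> ennreal (exp (- (real N / 2 * ln 2)) * 2 ^ ?c)" by (rule ennreal_leI)
        then show ?thesis by (simp add: ennreal_mult' ennreal_power[symmetric])
      qed
      then show "indicator (E m) x \<le> ennreal (exp (- (real N / 2 * ln 2))) * (\<Prod>i<m. if A x i then 2 else 1)"
        unfolding prod by (auto simp: E_def indicator_def)
    qed
    also have "\<dots> = ennreal (exp (- (real N / 2 * ln 2))) * (\<integral>\<^sup>+x. (\<Prod>i<m. if A x i then 2 else 1) \<partial>births)"
      by (rule nn_integral_cmult) measurable
    also have "\<dots> \<le> ennreal (exp (- (real N / 2 * ln 2))) * ennreal (exp (real N / 4))"
      by (intro mult_left_mono moment) simp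
    also have "\<dots> = ennreal (exp (real N / 4 - real N / 2 * ln 2))"
      by (simp add: ennreal_mult'[symmetric] mult_exp_exp)
    also have "\<dots> \<le> ennreal (exp (- 0.09 * real N))"
    proof (intro ennreal_leI)
      have "real N / 2 * 0.68 \<le> real N / 2 * ln 2" by (intro mult_left_mono ln_2_ge) simp
      then show "exp (real N / 4 - real N / 2 * ln 2) \<le> exp (- 0.09 * real N)" by simp
    qed
    finally show "emeasure births (E m) \<le> ennreal (exp (- 0.09 * real N))" .
  qed
  finally show ?thesis .
qed

end

section \<open>The probability of disagreement\<close>

context bounding_process
begin

section \<open>Transfer to the product law and almost sure regularity\<close>

definition history :: "'w \<Rightarrow> nat \<Rightarrow> 'a birth" where
  "history \<omega> = (\<lambda>n. (gap n \<omega>, loc n \<omega>, life n \<omega>, (\<lambda>m. mark n m \<omega>), coin n \<omega>))"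

lemma history_measurable: "history \<in> measurable M births"
proof (rule measurable_PiM_single')
  show "(\<lambda>\<omega>. history \<omega> n) \<in> measurable M one_birth" for n
    using births_indep unfolding indep_vars_def history_def by auto
qed (auto simp: space_PiM history_def birth_law_def space_pair_measure measurable_space[OF loc_measurable])

lemma distr_history: "distr M births history = births"
proof -
  have rv: "random_variable one_birth (\<lambda>\<omega>. history \<omega> n)" for n
    using measurable_compose[OF history_measurable component_measurable] .
  have "indep_vars (\<lambda>_. one_birth) (\<lambda>n \<omega>. history \<omega> n) UNIV"
    using births_indep by (simp add: history_def)
  then have "distr M births (\<lambda>\<omega>. \<lambda>n\<in>UNIV. history \<omega> n) = (\<Pi>\<^sub>M n\<in>UNIV. distr M one_birth (\<lambda>\<omega>. history \<omega> n))"
    by (subst (asm) indep_vars_iff_distr_eq_PiM') (auto intro: rv)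
  moreover have "distr M one_birth (\<lambda>\<omega>. history \<omega> n) = one_birth" for n
    unfolding history_def by (rule births_law)
  ultimately show ?thesis by (simp add: restrict_def)
qed

lemma AE_history: "AE x in births. Q x \<Longrightarrow> AE \<omega> in M. Q (history \<omega>)"
  by (rule AE_distrD[OF history_measurable]) (subst distr_history)

text \<open>Given everything else, the lifetime has a density, so it misses the one forbidden
  value.\<close>

lemma AE_no_ties: "AE x in births. \<forall>m n. blife (x n) \<noteq> age x (Suc n) - age x (Suc m)"
proof -
  have "AE x in births. blife (x n) \<noteq> age x (Suc n) - age x (Suc m)" for m n
  proof -
    let ?I = "\<lambda>x. if blife (x n) = age x (Suc n) - age x (Suc m) then 1 else (0::ennreal)"
    have I: "?I \<in> borel_measurable births" by measurable
    have "(\<integral>\<^sup>+x. ?I x \<partial>births) = (\<integral>\<^sup>+x. \<integral>\<^sup>+l. ?I (x(n := set_life (x n) l)) \<partial>life_law \<partial>births)"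
      by (rule nn_integral_resample_life[OF I])
    also have "\<dots> = (\<integral>\<^sup>+x. \<integral>\<^sup>+l. 0 \<partial>life_law \<partial>births)"
    proof (rule nn_integral_cong, rule nn_integral_cong_AE)
      fix x :: "nat \<Rightarrow> 'a birth"
      have "AE l in life_law. l \<noteq> age x (Suc n) - age x (Suc m)"
        using AE_lborel_singleton[of "age x (Suc n) - age x (Suc m)"]
        by (subst AE_density) (auto elim!: eventually_mono)
      then show "AE l in life_law. ?I (x(n := set_life (x n) l)) = 0" by simp
    qed
    finally have "AE x in births. ?I x = 0" by (subst nn_integral_0_iff_AE[symmetric]) (use I in auto)
    then show ?thesis by (rule eventually_mono) (auto split: if_splits)
  qed
  then show ?thesis by (simp add: AE_all_countable)
qed

text \<open>Given birth \<open>m\<close>, the location of birth \<open>n\<close> avoids a single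
  point because \<open>lam\<close> is diffuse. The singleton is measurable as a zero set of
  \<open>rho\<close>.\<close>

lemma AE_distinct_locs: "AE x in births. \<forall>m n. m \<noteq> n \<longrightarrow> bloc (x m) \<noteq> bloc (x n)"
proof -
  have "AE x in births. bloc (x m) \<noteq> bloc (x n)" if "m \<noteq> n" for m n
  proof -
    let ?I = "\<lambda>x. if rho (bloc (x m)) (bloc (x n)) = 0 then 1 else (0::ennreal)"
    have I: "?I \<in> borel_measurable births" by measurable
    have zero: "(\<integral>\<^sup>+y. ?I (x(n := y)) \<partial>one_birth) = 0" if x: "x \<in> space births" for x
    proof -
      have "x m \<in> space one_birth" using x by (auto simp: space_PiM)
      then have u: "bloc (x m) \<in> space lam"
        by (rule measurable_space[OF birth_components_measurable(2)])
      let ?u = "bloc (x m)"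
      note Iy = borel_measurable_upd[OF x I, of n]
      have [measurable]: "(\<lambda>v. rho ?u v) \<in> borel_measurable lam"
        using u by (intro rho_measurable') auto
      have sing: "{?u} = {v \<in> space lam. rho ?u v = 0}"
        using Metric_space.zero[OF metric u] u by auto
      have sing_sets: "{?u} \<in> sets lam" unfolding sing by measurable
      have "(\<integral>\<^sup>+y. ?I (x(n := y)) \<partial>one_birth) = (\<integral>\<^sup>+v. (if rho ?u v = 0 then 1 else 0) \<partial>loc_law)"
        unfolding nn_integral_one_birth[OF Iy] using \<open>m \<noteq> n\<close>
        by (simp add: bloc_def integral_const_simps del: nn_integral_const)
      also have "\<dots> = (\<integral>\<^sup>+v. indicator {?u} v \<partial>loc_law)"
        using Metric_space.zero[OF metric u] by (intro nn_integral_cong) (auto simp: indicator_def)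
      also have "\<dots> = emeasure loc_law {?u}" using sing_sets by (intro nn_integral_indicator) simp
      also have "\<dots> = 0"
        using sing_sets diffuse[OF u] by (subst emeasure_uniform_measure) (auto simp: u)
      finally show ?thesis .
    qed
    have "(\<integral>\<^sup>+x. ?I x \<partial>births) = (\<integral>\<^sup>+x. \<integral>\<^sup>+y. ?I (x(n := y)) \<partial>one_birth \<partial>births)"
      by (rule nn_integral_resample[OF prob_space_one_birth I])
    also have "\<dots> = (\<integral>\<^sup>+x. 0 \<partial>births)" by (intro nn_integral_cong zero)
    finally have "AE x in births. ?I x = 0" by (subst nn_integral_0_iff_AE[symmetric]) (use I in auto)
    then show ?thesis
    proof (rule AE_mp, intro AE_I2 impI)
      fix x assume x: "x \<in> space births" and *: "?I x = 0"
      have "x m \<in> space one_birth" using x by (auto simp: space_PiM)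
      then have "bloc (x m) \<in> space lam"
        by (rule measurable_space[OF birth_components_measurable(2)])
      then show "bloc (x m) \<noteq> bloc (x n)" using * Metric_space.zero[OF metric] by (auto split: if_splits)
    qed
  qed
  then show ?thesis by (auto simp: AE_all_countable)
qed

text \<open>A first moment argument: the expected number of births still alive at time
  \<open>- s\<close> or dying later is at most \<open>exp s\<close> times the discounted number of
  all births, which is finite.\<close>

lemma AE_finite_deaths: "AE x in births. \<forall>s::nat. finite {n. age x (Suc n) - real s \<le> blife (x n)}"
proof -
  have "AE x in births. finite {n. age x (Suc n) - real s \<le> blife (x n)}" for s :: nat
  proof -
    let ?A = "\<lambda>x. {n. age x (Suc n) - real s \<le> blife (x n)}"
    have [measurable]: "Measurable.pred births (\<lambda>x. n \<in> ?A x)" for n by (simp, measurable)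
    have single: "(\<integral>\<^sup>+x. indicator (?A x) n \<partial>births) \<le> (\<integral>\<^sup>+x. ennreal (exp (real s)) * ennreal (exp (- age x (Suc n))) \<partial>births)" for n
    proof -
      have "(\<lambda>x. indicator (?A x) n :: ennreal) \<in> borel_measurable births"
        unfolding indicator_def by measurable
      from nn_integral_resample_life[OF this, of n]
      have "(\<integral>\<^sup>+x. indicator (?A x) n \<partial>births)
        = (\<integral>\<^sup>+x. \<integral>\<^sup>+l. indicator {l. age x (Suc n) - real s \<le> l} l \<partial>life_law \<partial>births)"
        by (simp add: indicator_def)
      also have "\<dots> \<le> (\<integral>\<^sup>+x. ennreal (exp (- (age x (Suc n) - real s))) \<partial>births)"
        by (intro nn_integral_mono nn_integral_exponential_tail_le)
      also have "\<dots> = (\<integral>\<^sup>+x. ennreal (exp (real s)) * ennreal (exp (- age x (Suc n))) \<partial>births)"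
        by (intro nn_integral_cong) (simp add: ennreal_mult'[symmetric] mult_exp_exp)
      finally show ?thesis .
    qed
    have "(\<integral>\<^sup>+x. count_nat (?A x) \<partial>births) = (\<Sum>n. \<integral>\<^sup>+x. indicator (?A x) n \<partial>births)"
      using nn_integral_count[of "\<lambda>_. 1" ?A] by simp
    also have "\<dots> \<le> (\<Sum>n. \<integral>\<^sup>+x. ennreal (exp (real s)) * ennreal (exp (- age x (Suc n))) \<partial>births)"
      by (intro suminf_le single) auto
    also have "\<dots> = ennreal (exp (real s)) * (\<integral>\<^sup>+x. (\<Sum>n. ennreal (exp (- age x (Suc n)))) \<partial>births)"
      by (simp add: nn_integral_cmult nn_integral_suminf)
    \<comment> \<open>An empty window with \<open>t = 0\<close> and \<open>c = 0\<close> makes all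
      factors 1, so the discounted bound covers the whole past.\<close>
    also have "(\<integral>\<^sup>+x. (\<Sum>n. ennreal (exp (- age x (Suc n)))) \<partial>births)
      = (\<integral>\<^sup>+x. (\<Sum>n. (\<Prod>i<n. if age x (Suc i) < 0 then ennreal (1 + 0) else 1)
      * (if age x (Suc n) < 0 then 0 else ennreal (exp (- age x (Suc n))))) \<partial>births)"
    proof (rule nn_integral_cong_AE, use AE_gap_pos in eventually_elim)
      fix x :: "nat \<Rightarrow> 'a birth" assume "\<forall>n. 0 < bgap (x n)"
      then have "\<not> age x n < 0" for n
        unfolding age_def not_less by (intro sum_nonneg) (simp add: less_imp_le)
      then show "(\<Sum>n. ennreal (exp (- age x (Suc n)))) = (\<Sum>n. (\<Prod>i<n. if age x (Suc i) < 0 then ennreal (1 + 0) else 1)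
      * (if age x (Suc n) < 0 then 0 else ennreal (exp (- age x (Suc n)))))" by simp
    qed
    also have "\<dots> \<le> ennreal (rate * exp (rate * 0 * 0 - 0))" by (rule discounted_births_bound) auto
    finally have "(\<integral>\<^sup>+x. count_nat (?A x) \<partial>births) \<le> ennreal (exp (real s)) * ennreal (rate * exp (rate * 0 * 0 - 0))"
      by (simp add: mult_left_mono)
    also have "\<dots> < \<infinity>" by (simp add: ennreal_mult'[symmetric])
    finally have "AE x in births. count_nat (?A x) \<noteq> \<infinity>"
      by (intro nn_integral_PInf_AE) auto
    then show ?thesis by (rule eventually_mono) (auto simp: emeasure_count_space split: if_splits)
  qed
  then show ?thesis by (simp add: AE_all_countable)
qed

lemma AE_regular: "AE \<omega> in M. regular_record gap loc life mark coin \<omega> (history \<omega>)"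
  using AE_history[OF AE_gap_pos] AE_history[OF AE_life_pos] AE_history[OF AE_no_ties]
    AE_history[OF AE_distinct_locs] AE_history[OF AE_finite_deaths]
proof eventually_elim
  case (elim \<omega>)
  have birth: "birth n \<omega> = - age (history \<omega>) (Suc n)" for n
    by (simp add: birth_def age_def history_def bgap_def lessThan_Suc_atMost)
  have life: "blife (history \<omega> n) = life n \<omega>" for n by (simp add: history_def blife_def)
  show ?case
  proof
    show "0 < gap n \<omega>" for n using elim(1) by (simp add: history_def bgap_def)
    show "0 < life n \<omega>" for n using elim(2) by (simp add: life)
    show "inj (\<lambda>n. loc n \<omega>)" using elim(4) by (force simp: history_def bloc_def inj_def)
    show "death n \<omega> \<noteq> birth m \<omega>" for m n
      using elim(3)[rule_format, of n m] by (simp add: death_def birth life)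
    show "finite {n. s \<le> death n \<omega>}" for s
    proof -
      obtain k :: nat where "- s \<le> real k" using real_arch_simple by blast
      then have "{n. s \<le> death n \<omega>} \<subseteq> {n. age (history \<omega>) (Suc n) - real k \<le> blife (history \<omega> n)}"
        by (auto simp: death_def birth life)
      then show ?thesis using elim(5) finite_subset by blast
    qed
  qed (simp add: history_def)
qed

text \<open>The births in the window \<open>(-t, 0)\<close> are \<open>0, ..., k - 1\<close>.\<close>

definition window :: "real \<Rightarrow> nat \<Rightarrow> (nat \<Rightarrow> 'a birth) \<Rightarrow> bool" where
  "window t k x \<longleftrightarrow> age x k < t \<and> t \<le> age x (Suc k)"

lemma window_measurable [measurable]: "Measurable.pred births (window t k)"
  unfolding window_def[abs_def] by measurable

text \<open>At most one \<open>k\<close> fits the window. For it, the births younger than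
  \<open>t\<close> are those with index below \<open>k\<close>, so \<open>C ^ k\<close> is a product
  over them and \<open>n \<ge> k\<close> means age at least \<open>t\<close>; this is the form that
  the renewal bound evaluates.\<close>

lemma window_sum_le:
  assumes gap: "\<And>n. 0 \<le> bgap (x n)"
  shows "(\<Sum>k. C ^ k * (indicator {x. window t k x} x * (\<Sum>n. indicator {k..} n * ennreal (exp (- age x (Suc n))))))
    \<le> (\<Sum>n. (\<Prod>i<n. if age x (Suc i) < t then C else 1)
      * (if age x (Suc n) < t then 0 else ennreal (exp (- age x (Suc n)))))"
proof (cases "\<exists>k. window t k x")
  case False
  then show ?thesis by simp
next
  case True
  then obtain k where k: "window t k x" by blast
  have mono: "m \<le> n \<Longrightarrow> age x m \<le> age x n" for m n using age_mono[OF gap] .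
  have unique: "\<not> window t k' x" if "k' \<noteq> k" for k'
    using that k mono[of "Suc k" k'] mono[of "Suc k'" k] by (auto simp: window_def neq_iff Suc_le_eq)
  have "(\<Sum>k. C ^ k * (indicator {x. window t k x} x * (\<Sum>n. indicator {k..} n * ennreal (exp (- age x (Suc n))))))
    = (\<Sum>k\<in>{k}. C ^ k * (indicator {x. window t k x} x * (\<Sum>n. indicator {k..} n * ennreal (exp (- age x (Suc n))))))"
    by (rule suminf_finite) (use unique in auto)
  also have "\<dots> = (\<Sum>n. C ^ k * (indicator {k..} n * ennreal (exp (- age x (Suc n)))))"
    using k by simp
  also have "\<dots> \<le> (\<Sum>n. (\<Prod>i<n. if age x (Suc i) < t then C else 1)
      * (if age x (Suc n) < t then 0 else ennreal (exp (- age x (Suc n)))))"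
  proof (rule suminf_le)
    fix n
    show "C ^ k * (indicator {k..} n * ennreal (exp (- age x (Suc n))))
      \<le> (\<Prod>i<n. if age x (Suc i) < t then C else 1)
      * (if age x (Suc n) < t then 0 else ennreal (exp (- age x (Suc n))))"
    proof (cases "k \<le> n")
      case True
      have "age x (Suc i) < t \<longleftrightarrow> i < k" for i
        using k mono[of "Suc i" k] mono[of "Suc k" "Suc i"] by (cases "i < k") (auto simp: window_def)
      moreover have "(\<Prod>i<n. if i < k then C else 1) = (\<Prod>i<k. C)"
        using True by (intro prod.mono_neutral_cong_right) auto
      ultimately show ?thesis using True by simp
    qed simp
  qed auto
  finally show ?thesis .
qed

text \<open>A union bound over \<open>k\<close>, then the probability of an undecided survivor is at
  most their expected number. The window indicator is a function of the gaps, hence admissible as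
  the weight \<open>w\<close>.\<close>

lemma undecided_window_bound:
  assumes p: "pswap = 0 \<and> \<kappa> = 1 \<or> pswap = 1/4 \<and> \<kappa> = 1/2" and t: "0 \<le> t"
  shows "emeasure births {x \<in> space births. \<exists>k. window t k x \<and> (\<exists>n\<in>alive x 0. n \<in> undecided x 0 k)}
    \<le> ennreal (rate * exp (rate * (\<kappa> * block_rate) * t - t))"
proof -
  let ?C = "ennreal (1 + \<kappa> * block_rate)"
  have nonneg: "0 \<le> \<kappa> * block_rate" using p block_rate_nonneg by auto
  let ?E = "\<lambda>k. {x \<in> space births. window t k x \<and> (\<exists>n. n \<in> alive x 0 \<and> n \<in> undecided x 0 k)}"
  let ?w = "\<lambda>k x. indicator {x. window t k x} x :: ennreal"
  let ?s = "\<lambda>k x. \<Sum>n. indicator {k..} n * ennreal (exp (- age x (Suc n)))"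
  have w: "?w k \<in> borel_measurable births" for k unfolding indicator_def mem_Collect_eq by measurable
  have s: "?s k \<in> borel_measurable births" for k by measurable
  have E: "?E k \<in> sets births" for k by measurable
  have "emeasure births {x \<in> space births. \<exists>k. window t k x \<and> (\<exists>n\<in>alive x 0. n \<in> undecided x 0 k)}
    = emeasure births (\<Union>k. ?E k)"
    by (rule arg_cong[of _ _ "emeasure births"]) auto
  also have "\<dots> \<le> (\<Sum>k. emeasure births (?E k))"
    by (rule emeasure_subadditive_countably) (use E in auto)
  also have "\<dots> \<le> (\<Sum>k. \<integral>\<^sup>+x. ?C ^ k * (?w k x * ?s k x) \<partial>births)"
  proof (rule suminf_le)
    fix k
    have "emeasure births (?E k) = (\<integral>\<^sup>+x. indicator (?E k) x \<partial>births)" using E by simp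
    also have "\<dots> \<le> (\<integral>\<^sup>+x. ?w k x * count_nat (undecided x 0 k \<inter> alive x 0) \<partial>births)"
    proof (rule nn_integral_mono)
      fix x
      have "1 \<le> count_nat (undecided x 0 k \<inter> alive x 0)" if "n \<in> undecided x 0 k \<inter> alive x 0" for n
        using count_nat_mono[of "{n}" "undecided x 0 k \<inter> alive x 0"] that by simp
      then show "indicator (?E k) x \<le> ?w k x * count_nat (undecided x 0 k \<inter> alive x 0)"
        by (auto simp: indicator_def)
    qed
    also have "\<dots> \<le> ?C ^ k * (\<integral>\<^sup>+x. ?w k x * ?s k x \<partial>births)"
    proof (rule undecided_bound[OF w _ p])
      fix x y :: "nat \<Rightarrow> 'a birth" assume "\<And>n. bgap (x n) = bgap (y n)"
      then have "age x n = age y n" for n by (simp add: age_def)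
      then show "?w k x = ?w k y" by (simp add: window_def indicator_def)
    qed
    also have "\<dots> = (\<integral>\<^sup>+x. ?C ^ k * (?w k x * ?s k x) \<partial>births)"
      by (rule nn_integral_cmult[symmetric]) (intro borel_measurable_times_ennreal w s)
    finally show "emeasure births (?E k) \<le> (\<integral>\<^sup>+x. ?C ^ k * (?w k x * ?s k x) \<partial>births)" .
  qed auto
  also have "\<dots> = (\<integral>\<^sup>+x. (\<Sum>k. ?C ^ k * (?w k x * ?s k x)) \<partial>births)"
    by (rule nn_integral_suminf[symmetric]) (intro borel_measurable_times_ennreal w s borel_measurable_const)
  also have "\<dots> \<le> (\<integral>\<^sup>+x. (\<Sum>n. (\<Prod>i<n. if age x (Suc i) < t then ?C else 1)
      * (if age x (Suc n) < t then 0 else ennreal (exp (- age x (Suc n))))) \<partial>births)"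
  proof (rule nn_integral_mono_AE, use AE_gap_pos in eventually_elim)
    fix x :: "nat \<Rightarrow> 'a birth" assume "\<forall>n. 0 < bgap (x n)"
    then show "(\<Sum>k. ?C ^ k * (?w k x * ?s k x)) \<le> (\<Sum>n. (\<Prod>i<n. if age x (Suc i) < t then ?C else 1)
      * (if age x (Suc n) < t then 0 else ennreal (exp (- age x (Suc n)))))"
      by (intro window_sum_le) (simp add: less_imp_le)
  qed
  also have "\<dots> \<le> ennreal (rate * exp (rate * (\<kappa> * block_rate) * t - t))"
    by (rule discounted_births_bound[OF t nonneg])
  finally show ?thesis .
qed

text \<open>If \<open>tau N\<close> lies inside the window, at least \<open>N\<close> births and
  deaths do too, and one kind makes up at least half of them. Otherwise all \<open>k\<close> births
  of the window come after \<open>tau N\<close>, and the sandwich applies. Counting over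
  \<open>{..<m}\<close> keeps the events accessible to finite moments.\<close>

lemma disagreement_cases:
  assumes reg: "regular_record gap loc life mark coin \<omega> (history \<omega>)"
    and t: "0 < t" and N: "1 \<le> N" and neq: "upper N 0 \<omega> \<noteq> lower N 0 \<omega>"
  defines "x \<equiv> history \<omega>"
  shows "(\<exists>m. N \<le> 2 * card {n \<in> {..<m}. age x (Suc n) < t})
    \<or> (\<exists>m. N \<le> 2 * card {n \<in> {..<m}. age x (Suc n) - t < blife (x n) \<and> blife (x n) < age x (Suc n)})
    \<or> (\<exists>k. window t k x \<and> (\<exists>n\<in>alive x 0. n \<in> undecided x 0 k))"
proof -
  interpret reg: regular_record rho R gap loc life mark coin \<omega> x using reg by (simp add: x_def)
  have life: "blife (x n) = life n \<omega>" for n by (simp add: x_def history_def blife_def)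
  show ?thesis
  proof (cases "- t < tau N \<omega>")
    case True
    have births: "{n. - t < birth n \<omega>} = {n. age x (Suc n) < t}"
      by (simp add: reg.birth_age)
    have deaths: "{n. - t < death n \<omega> \<and> death n \<omega> < 0}
        = {n. age x (Suc n) - t < blife (x n) \<and> blife (x n) < age x (Suc n)}"
      by (auto simp: death_def reg.birth_age life)
    have bounded: "\<exists>m. S = {n \<in> {..<m}. n \<in> S}" if "finite S" for S :: "nat set"
    proof -
      have "\<exists>m. \<forall>n\<in>S. n < m" using that by (simp add: finite_nat_set_iff_bounded)
      then obtain m where "\<forall>n\<in>S. n < m" by blast
      then show ?thesis by (intro exI[of _ m]) auto
    qed
    have fin: "finite {n. - t < birth n \<omega>}" "finite {n. - t < death n \<omega> \<and> death n \<omega> < 0}"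
      by (auto intro: finite_subset[OF _ reg.finite_births[of "- t"]] finite_subset[OF _ reg.finite_deaths[of "- t"]])
    obtain m1 where m1: "{n. age x (Suc n) < t} = {n \<in> {..<m1}. age x (Suc n) < t}"
      using bounded[OF fin(1)] unfolding births by auto
    obtain m2 where m2: "{n. age x (Suc n) - t < blife (x n) \<and> blife (x n) < age x (Suc n)}
        = {n \<in> {..<m2}. age x (Suc n) - t < blife (x n) \<and> blife (x n) < age x (Suc n)}"
      using bounded[OF fin(2)] unfolding deaths by auto
    have "N \<le> card {n. age x (Suc n) < t}
        + card {n. age x (Suc n) - t < blife (x n) \<and> blife (x n) < age x (Suc n)}"
      using reg.many_events[OF True] unfolding births deaths .
    then have "N \<le> 2 * card {n \<in> {..<m1}. age x (Suc n) < t}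
        \<or> N \<le> 2 * card {n \<in> {..<m2}. age x (Suc n) - t < blife (x n) \<and> blife (x n) < age x (Suc n)}"
      unfolding m1[symmetric] m2[symmetric] by linarith
    then show ?thesis by blast
  next
    case False
    obtain n where "birth n \<omega> < - t" using reg.ex_birth_less by blast
    then have ex: "t \<le> age x (Suc n)" by (simp add: reg.birth_age)
    \<comment> \<open>Births \<open>0, ..., k - 1\<close> are the ones younger than
      \<open>t\<close>, and birth \<open>k\<close> is the first at or before
      \<open>-t\<close>.\<close>
    define k where "k = (LEAST n. t \<le> age x (Suc n))"
    have k: "t \<le> age x (Suc k)" unfolding k_def using ex by (rule LeastI)
    have "age x k < t"
    proof (cases k)
      case 0
      then show ?thesis using t by (simp add: age_def)
    next
      case (Suc j)
      then have "\<not> t \<le> age x (Suc j)" unfolding k_def by (intro not_less_Least) simp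
      then show ?thesis using Suc by simp
    qed
    then have "window t k x" using k by (simp add: window_def)
    moreover have "tau N \<omega> < birth i \<omega>" if "i < k" for i
    proof -
      have "\<not> t \<le> age x (Suc i)" using that unfolding k_def by (rule not_less_Least)
      then show ?thesis using False by (simp add: reg.birth_age)
    qed
    then have "\<exists>n\<in>alive x 0. n \<in> undecided x 0 k"
      using reg.disagreement_imp[OF neq N] unfolding undecided_def by blast
    ultimately show ?thesis by blast
  qed
qed

text \<open>Up to a null set, disagreement is contained in the preimage of three events of the birth
  sequence, so it suffices to add their probabilities under the product law.\<close>

lemma disagreement_bound:
  assumes p: "pswap = 0 \<and> \<kappa> = 1 \<or> pswap = 1/4 \<and> \<kappa> = 1/2" and N: "1 \<le> N"
  shows "prob {\<omega> \<in> space M. upper N 0 \<omega> \<noteq> lower N 0 \<omega>}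
    \<le> 2 * exp (- 0.09 * real N) + rate * exp (- (real N * (1 - \<kappa> * (rate * block_rate))) / (4 * rate))"
proof -
  define t where "t = real N / (4 * rate)"
  have t: "0 < t" using rate_pos N unfolding t_def by (intro divide_pos_pos) auto
  have "c * (real N / (4 * c)) = real N / 4" if "0 < c" for c :: real using that by simp
  from this[OF rate_pos] have rt: "rate * t = real N / 4" by (simp only: t_def)
  define E1 where "E1 = {x \<in> space births. \<exists>m. N \<le> 2 * card {n \<in> {..<m}. age x (Suc n) < t}}"
  define E2 where "E2 = {x \<in> space births. \<exists>m. N \<le> 2 * card {n \<in> {..<m}.
    age x (Suc n) - t < blife (x n) \<and> blife (x n) < age x (Suc n)}}"
  define E3 where "E3 = {x \<in> space births. \<exists>k. window t k x \<and> (\<exists>n\<in>alive x 0. n \<in> undecided x 0 k)}"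
  have card: "card {n \<in> {..<m}. P n} = (\<Sum>n<m. if P n then 1 else 0)" for m :: nat and P
    unfolding card_eq_sum by (intro sum.mono_neutral_cong_left) auto
  have E: "E1 \<in> sets births" "E2 \<in> sets births" "E3 \<in> sets births"
    unfolding E1_def E2_def E3_def card Bex_def by measurable
  have E1: "emeasure births E1 \<le> ennreal (exp (- 0.09 * real N))"
    unfolding E1_def using births_exponential_moment[OF t] unfolding rt by (intro chernoff_count) measurable
  have E2: "emeasure births E2 \<le> ennreal (exp (- 0.09 * real N))"
    unfolding E2_def using deaths_exponential_moment[OF t] unfolding rt by (intro chernoff_count) measurable
  have E3: "emeasure births E3 \<le> ennreal (rate * exp (rate * (\<kappa> * block_rate) * t - t))"
    unfolding E3_def using t by (intro undecided_window_bound[OF p]) simp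
  have "emeasure M {\<omega> \<in> space M. upper N 0 \<omega> \<noteq> lower N 0 \<omega>} \<le> emeasure M (history -` (E1 \<union> E2 \<union> E3) \<inter> space M)"
  proof (rule emeasure_mono_AE)
    show "AE \<omega> in M. \<omega> \<in> {\<omega> \<in> space M. upper N 0 \<omega> \<noteq> lower N 0 \<omega>}
        \<longrightarrow> \<omega> \<in> history -` (E1 \<union> E2 \<union> E3) \<inter> space M"
      using AE_regular
    proof (eventually_elim, intro impI)
      fix \<omega> assume "regular_record gap loc life mark coin \<omega> (history \<omega>)"
        and \<omega>: "\<omega> \<in> {\<omega> \<in> space M. upper N 0 \<omega> \<noteq> lower N 0 \<omega>}"
      from disagreement_cases[OF this(1) t N] \<omega> measurable_space[OF history_measurable, of \<omega>]
      show "\<omega> \<in> history -` (E1 \<union> E2 \<union> E3) \<inter> space M"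
        by (simp add: E1_def E2_def E3_def)
    qed
    show "history -` (E1 \<union> E2 \<union> E3) \<inter> space M \<in> events"
      using E by (intro measurable_sets[OF history_measurable]) auto
  qed
  also have "\<dots> = emeasure births (E1 \<union> E2 \<union> E3)"
    using emeasure_distr[OF history_measurable, of "E1 \<union> E2 \<union> E3"] E unfolding distr_history by simp
  also have "\<dots> \<le> emeasure births E1 + emeasure births E2 + emeasure births E3"
    using E by (intro order.trans[OF emeasure_subadditive] add_right_mono emeasure_subadditive) auto
  also have "\<dots> \<le> ennreal (exp (- 0.09 * real N)) + ennreal (exp (- 0.09 * real N))
      + ennreal (rate * exp (rate * (\<kappa> * block_rate) * t - t))"
    by (intro add_mono E1 E2 E3)
  also have "\<dots> = ennreal (2 * exp (- 0.09 * real N) + rate * exp (rate * (\<kappa> * block_rate) * t - t))"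
  proof -
    have *: "ennreal a + ennreal a + ennreal b = ennreal (2 * a + b)" if "0 \<le> a" "0 \<le> b" for a b
      unfolding mult_2 using that by (simp only: ennreal_plus add_nonneg_nonneg)
    show ?thesis by (rule *) (use rate_pos in \<open>simp_all add: less_imp_le del: mult_pos_pos\<close>)
  qed
  finally have "prob {\<omega> \<in> space M. upper N 0 \<omega> \<noteq> lower N 0 \<omega>}
      \<le> 2 * exp (- 0.09 * real N) + rate * exp (rate * (\<kappa> * block_rate) * t - t)"
    unfolding emeasure_eq_measure using rate_pos by (subst (asm) ennreal_le_iff) (auto intro!: add_nonneg_nonneg)
  also have "rate * (\<kappa> * block_rate) * t - t = - (real N * (1 - \<kappa> * (rate * block_rate))) / (4 * rate)"
  proof -
    have "c * (\<kappa> * block_rate) * (real N / (4 * c)) - real N / (4 * c)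
      = - (real N * (1 - \<kappa> * (c * block_rate))) / (4 * c)" if "0 < c" for c :: real
      using that by (simp add: field_simps)
    from this[OF rate_pos] show ?thesis by (simp only: t_def)
  qed
  finally show ?thesis .
qed

lemma rate_block_rate: "rate * block_rate = beta1 * (1 - beta2) * ball_sup"
  using measure_lam_pos by (simp add: block_rate_def)

end

theorem theorem4p1:
  fixes lam :: "'a measure" and rho :: "'a \<Rightarrow> 'a \<Rightarrow> real" and beta1 beta2 R r pswap :: real
    and M :: "'w measure"
    and gap :: "nat \<Rightarrow> 'w \<Rightarrow> real" and loc :: "nat \<Rightarrow> 'w \<Rightarrow> 'a" and life :: "nat \<Rightarrow> 'w \<Rightarrow> real"
    and mark :: "nat \<Rightarrow> nat \<Rightarrow> 'w \<Rightarrow> bool" and coin :: "nat \<Rightarrow> 'w \<Rightarrow> bool"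
    and N :: nat
  assumes process: "bounding_process lam rho beta1 beta2 R pswap M gap loc life mark coin"
    and r: "r = (SUP v\<in>space lam. measure lam {w \<in> space lam. rho v w \<le> R})"
    and N: "N \<ge> 1"
  shows "(pswap = 0 \<and> beta1 * (1 - beta2) * r < 1 \<longrightarrow>
      \<P>(\<omega> in M. birth_record.upper rho R gap loc life mark coin N 0 \<omega>
               \<noteq> birth_record.lower rho R gap loc life mark coin N 0 \<omega>)
      \<le> 2 * exp (- 0.09 * real N)
        + beta1 * measure lam (space lam)
          * exp (- (real N * (1 - beta1 * (1 - beta2) * r)) / (4 * beta1 * measure lam (space lam))))
    \<and> (pswap = 1 / 4 \<and> beta1 * (1 - beta2) * r < 2 \<longrightarrow>
      \<P>(\<omega> in M. birth_record.upper rho R gap loc life mark coin N 0 \<omega>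
               \<noteq> birth_record.lower rho R gap loc life mark coin N 0 \<omega>)
      \<le> 2 * exp (- 0.09 * real N)
        + beta1 * measure lam (space lam)
          * exp (- (real N * (1 - 0.5 * beta1 * (1 - beta2) * r)) / (4 * beta1 * measure lam (space lam))))"
proof -
  interpret bounding_process lam rho beta1 beta2 R pswap M gap loc life mark coin by (rule process)
  have r': "ball_sup = r" by (simp add: ball_sup_def r)
  have *: "rate * block_rate = beta1 * (1 - beta2) * r" by (simp add: rate_block_rate r')
  note bound = disagreement_bound[OF _ N, unfolded *]
  have assoc: "4 * rate = 4 * beta1 * measure lam (space lam)" by simp
  have half: "1/2 * (beta1 * (1 - beta2) * r) = 0.5 * beta1 * (1 - beta2) * r" by simp
  show ?thesis
    using bound[of 1] bound[of "1/2"] unfolding assoc half mult_1 by blast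
qed

end
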